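(* Assume the standing setup below and $\beta_n n^{-\alpha}\to\infty$. Let $a_n=(C(q)n)^\alpha$. Then $\sqrt{a_n}\,\mathcal Y_n(q)\to V\Phi$ in distribution, where $\Phi=\sqrt{2R_1}\,\Theta_1$, $R_1\ge0$ is a random variable with $\mathbb P(R_1>r)=e^{-r^{1/\alpha}}$ for $r\ge0$, and $\Theta_1$ is independent of $R_1$ and uniformly distributed on $\mathbb S_q^{d-2}$. In particular $\mathcal Y_n(q)\to0$ and $\mathrm{ATT}(n)\to Vq$ in probability.
   Context: Standing setup: Fix an integer $d\ge 2$; let $\mathbb S^{d-1}\subset\mathbb R^d$ be the unit sphere with surface measure $\sigma$. Fix $q\in\mathbb S^{d-1}$. Let $x_1,x_2,\dots$ be i.i.d. random vectors on $\mathbb S^{d-1}$ with law $\rho(x)\,d\sigma(x)$, where $\rho$ is a $C^2$ probability density on $\mathbb S^{d-1}$ with $\rho(q)>0$. Let $(\beta_n)_{n\ge1}$ be positive reals and set $\alpha=2/(d-1)$. Define $T_i=1-\langle q,x_i\rangle$, $Z_n=\sum_{j=1}^n e^{-\beta_nT_j}$, $A_i=e^{-\beta_nT_i}/Z_n$. Let $V\in\mathbb R^{d\times d}$ be fixed, $\mathrm{ATT}(n)=V\sum_{j=1}^nA_jx_j$ and $\mathcal Y_n(q)=\mathrm{ATT}(n)-Vq=V\sum_{i=1}^nA_i(x_i-q)$. Let $C(q)=\frac{2^{1/\alpha}\sigma_{d-2}}{d-1}\rho(q)$ with $\sigma_{d-2}$ the surface area of $\mathbb S^{d-2}$. Let $\mathbb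 S_q^{d-2}=\{\theta\in\mathbb R^d:\langle\theta,q\rangle=0,\ \|\theta\|=1\}$ be the unit sphere of the tangent space at $q$. *)

theory Defs
  imports "HOL-Probability.Probability"
begin

definition C2_on :: "'a::euclidean_space set \<Rightarrow> ('a \<Rightarrow> real) \<Rightarrow> bool" where
  "C2_on S f \<longleftrightarrow> open S \<and>
     (\<exists>f' :: 'a \<Rightarrow> 'a \<Rightarrow>\<^sub>L real. \<exists>f'' :: 'a \<Rightarrow> 'a \<Rightarrow>\<^sub>L ('a \<Rightarrow>\<^sub>L real).
        (\<forall>x\<in>S. (f has_derivative blinfun_apply (f' x)) (at x)) \<and>
        (\<forall>x\<in>S. (f' has_derivative blinfun_apply (f'' x)) (at x)) \<and>
        continuous_on S f'')"

text \<open>Surface measure on the unit sphere of a Euclidean space (cone construction):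
  sigma(A) = DIM * Lebesgue measure of the cone {t x | 0 < t \<le> 1, x \<in> A}.\<close>
definition sphere_surface_measure :: "'a::euclidean_space measure" where
  "sphere_surface_measure =
     scale_measure (of_nat DIM('a))
       (distr (restrict_space lborel (cball 0 1 - {0})) borel (\<lambda>x. x /\<^sub>R norm x))"

text \<open>Surface area of the unit sphere S^k in R^(k+1).\<close>
definition sphere_area :: "nat \<Rightarrow> real" where
  "sphere_area k = 2 * pi powr ((real k + 1) / 2) / Gamma ((real k + 1) / 2)"

definition tangent_sphere :: "'a::euclidean_space \<Rightarrow> 'a set" where
  "tangent_sphere q = {\<theta>. \<theta> \<bullet> q = 0 \<and> norm \<theta> = 1}"

text \<open>Uniform distribution on the tangent sphere: concentrated on it and invariant under
  all orthogonal transformations fixing q (the unique such probability law).\<close>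
definition uniform_on_tangent_sphere :: "'a::euclidean_space \<Rightarrow> 'b measure \<Rightarrow> ('b \<Rightarrow> 'a) \<Rightarrow> bool" where
  "uniform_on_tangent_sphere q N \<Theta> \<longleftrightarrow>
     \<Theta> \<in> borel_measurable N \<and> (AE \<omega> in N. \<Theta> \<omega> \<in> tangent_sphere q) \<and>
     (\<forall>U. orthogonal_transformation U \<and> U q = q \<longrightarrow> distr N borel (U \<circ> \<Theta>) = distr N borel \<Theta>)"

definition weak_conv_vec :: "(nat \<Rightarrow> 'a::euclidean_space measure) \<Rightarrow> 'a measure \<Rightarrow> bool" where
  "weak_conv_vec \<mu>s \<mu> \<longleftrightarrow>
     (\<forall>f :: 'a \<Rightarrow> real. continuous_on UNIV f \<and> bounded (range f) \<longrightarrow>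
        (\<lambda>n. integral\<^sup>L (\<mu>s n) f) \<longlonglongrightarrow> integral\<^sup>L \<mu> f)"

definition conv_in_prob :: "'b measure \<Rightarrow> (nat \<Rightarrow> 'b \<Rightarrow> 'a::metric_space) \<Rightarrow> 'a \<Rightarrow> bool" where
  "conv_in_prob M Y c \<longleftrightarrow>
     (\<forall>\<epsilon>>0. (\<lambda>n. measure M {\<omega>\<in>space M. dist (Y n \<omega>) c > \<epsilon>}) \<longlonglongrightarrow> 0)"

end

theory Submission
  imports Defs "HOL-Real_Asymp.Real_Asymp"
begin

text \<open>
  Near \<open>q\<close> the sample, blown up by \<open>sqrt a\<^sub>n\<close>, looks like a Poisson process that is invariant under the
  rotations fixing \<open>q\<close>, and since \<open>\<beta>\<^sub>n / a\<^sub>n \<rightarrow> \<infinity>\<close> all attention goes to the point nearest to \<open>q\<close>.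

  It suffices to show \<open>liminf E f(sqrt a\<^sub>n disp\<^sub>n) \<ge> E f(\<Phi>)\<close> for \<open>f \<ge> 0\<close> bounded and continuous (apply it to
  \<open>f + B\<close> and \<open>B - f\<close>). Cut the scaled heights \<open>a\<^sub>n T\<^sub>i\<close> into cells of width \<open>\<delta>\<close>. The events ``point \<open>i\<close> lies in
  cell \<open>k\<close> and all other points lie above height \<open>(k + 2) \<delta>\<close>'' are pairwise disjoint, their
  probabilities factor by independence, and on them the displacement is close to
  \<open>sqrt (2 k \<delta>)\<close> times the tangential direction of \<open>x\<^sub>i\<close>. Samples with a second point just above the cell
  are discarded; their probability vanishes as \<open>\<delta> \<rightarrow> 0\<close>. Within a cell the direction is asymptotically uniform
  because the surface measure is rotation invariant and a rotation invariant law on the tangent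
  sphere is unique, so polar coordinates are never needed; only the cap asymptotics are computed.
\<close>

section \<open>Uniqueness of the invariant law on the tangent sphere\<close>

text \<open>The tail of \<open>R\<close> is a statement about caps. A cap of small height
  \<open>t\<close> at \<open>q\<close> has mass about \<open>C(q)\<close> times
  \<open>t powr (1 / \<alpha>)\<close>, so with heights multiplied by \<open>a\<^sub>n\<close> the
  mean number of points below \<open>r\<close> tends to \<open>r powr (1 / \<alpha>)\<close>, and
  the chance of finding none tends to the exponential of minus this number. The root in
  \<open>\<Phi>\<close> comes from the identity that the squared distance of unit vectors
  \<open>x\<close> and \<open>q\<close> is \<open>2 * (1 - q \<bullet> x)\<close>. The obstacle is
  that the attention error is a sum over all \<open>n\<close> points, most of which are far from
  \<open>q\<close> on the new scale. It is dominated by a vanishing prefactor times the sum of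
  \<open>exp (- (a\<^sub>n * T\<^sub>j) / 2)\<close>, and the expectation of that sum is bounded in
  \<open>n\<close>. Convergence in probability has its own argument and is not deduced from the
  limit law: the distributional claim ranges over the triples \<open>N\<close>, \<open>R\<close>,
  \<open>\<Theta>\<close> on an arbitrary type, and such a type may carry none.\<close>

definition tangent_invariant :: "'a::euclidean_space \<Rightarrow> 'a measure \<Rightarrow> bool" where
  "tangent_invariant q \<mu> \<longleftrightarrow> sets \<mu> = sets borel \<and> (AE \<theta> in \<mu>. \<theta> \<in> tangent_sphere q) \<and>
     (\<forall>U. orthogonal_transformation U \<and> U q = q \<longrightarrow> distr \<mu> borel U = \<mu>)"

lemma reflection_swaps:
  fixes q y z :: "'a::euclidean_space"
  assumes "y \<in> tangent_sphere q" "z \<in> tangent_sphere q"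
  obtains U where "orthogonal_transformation U" "U q = q" "U y = z"
proof (cases "y = z")
  case True
  then show ?thesis using that[of "\<lambda>x. x"] by (simp add: orthogonal_transformation_id)
next
  case False
  define v where "v = y - z"
  define U where "U = (\<lambda>x. x - (2 * (x \<bullet> v) / (v \<bullet> v)) *\<^sub>R v)"
  have vv: "v \<bullet> v > 0" using False by (simp add: v_def)
  have yz: "y \<bullet> y = 1" "z \<bullet> z = 1" "y \<bullet> q = 0" "z \<bullet> q = 0"
    using assms by (auto simp: tangent_sphere_def norm_eq_1)
  have "linear U" unfolding U_def
  proof (rule linearI)
    show "x + w - (2 * ((x + w) \<bullet> v) / (v \<bullet> v)) *\<^sub>R v
        = x - (2 * (x \<bullet> v) / (v \<bullet> v)) *\<^sub>R v + (w - (2 * (w \<bullet> v) / (v \<bullet> v)) *\<^sub>R v)" for x w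
      by (simp add: inner_add_left scaleR_add_left add_divide_distrib distrib_left)
    show "r *\<^sub>R x - (2 * ((r *\<^sub>R x) \<bullet> v) / (v \<bullet> v)) *\<^sub>R v = r *\<^sub>R (x - (2 * (x \<bullet> v) / (v \<bullet> v)) *\<^sub>R v)" for r x
      by (simp add: scaleR_diff_right)
  qed
  moreover have "U x \<bullet> U w = x \<bullet> w" for x w
  proof -
    define a b where "a = 2 * (x \<bullet> v) / (v \<bullet> v)" and "b = 2 * (w \<bullet> v) / (v \<bullet> v)"
    have ab: "x \<bullet> v = a * (v \<bullet> v) / 2" "w \<bullet> v = b * (v \<bullet> v) / 2"
      using vv unfolding a_def b_def by simp_all
    have "U x \<bullet> U w = x \<bullet> w - b * (x \<bullet> v) - a * (w \<bullet> v) + a * b * (v \<bullet> v)"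
      unfolding U_def a_def[symmetric] b_def[symmetric]
      by (simp add: inner_diff_left inner_diff_right inner_commute[of v w] right_diff_distrib)
    then show ?thesis unfolding ab by (simp add: field_simps)
  qed
  ultimately have "orthogonal_transformation U" unfolding orthogonal_transformation_def by blast
  moreover have "q \<bullet> v = 0" using yz by (simp add: v_def inner_diff_right inner_commute[of q])
  then have "U q = q" by (simp add: U_def)
  moreover have "U y = z"
  proof -
    have "2 * (y \<bullet> v) = v \<bullet> v" using yz by (simp add: v_def inner_diff_left inner_diff_right inner_commute[of z y])
    then have "U y = y - v" using vv by (simp add: U_def)
    then show ?thesis by (simp add: v_def)
  qed
  ultimately show ?thesis by (rule that)
qed

lemma orthogonal_transformation_borel_measurable:
  fixes U :: "'a::euclidean_space \<Rightarrow> 'a"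
  assumes "orthogonal_transformation U" shows "U \<in> borel_measurable borel"
  using assms by (intro borel_measurable_continuous_onI linear_continuous_on)
    (auto simp: orthogonal_transformation_def linear_linear)

text \<open>An isometry that fixes \<open>q\<close> and takes \<open>y\<close> to \<open>z\<close>
  pulls the ball about \<open>z\<close> back to the ball about \<open>y\<close>.\<close>

lemma tangent_invariant_ball:
  fixes q :: "'a::euclidean_space"
  assumes "tangent_invariant q \<mu>" "y \<in> tangent_sphere q" "z \<in> tangent_sphere q"
  shows "measure \<mu> (ball y r) = measure \<mu> (ball z r)"
proof -
  obtain U where U: "orthogonal_transformation U" "U q = q" "U y = z"
    using reflection_swaps assms(2,3) by blast
  have sets: "sets \<mu> = sets borel" and inv: "distr \<mu> borel U = \<mu>"
    using assms(1) U by (auto simp: tangent_invariant_def)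
  have space: "space \<mu> = UNIV" using sets_eq_imp_space_eq[OF sets] by simp
  have [measurable]: "U \<in> measurable \<mu> borel"
    using orthogonal_transformation_borel_measurable[OF U(1)] measurable_cong_sets[OF sets refl] by blast
  have "measure \<mu> (ball z r) = measure (distr \<mu> borel U) (ball z r)" by (simp add: inv)
  also have "\<dots> = measure \<mu> (U -` ball z r)" by (subst measure_distr) (auto simp: space)
  also have "U -` ball z r = ball y r"
    using U by (auto simp: dist_norm orthogonal_transformation_norm
        simp flip: U(3) linear_diff[OF orthogonal_transformation_linear[OF U(1)]])
  finally show ?thesis ..
qed

lemma compact_tangent_sphere: "compact (tangent_sphere (q::'a::euclidean_space))"
proof -
  have "closed (tangent_sphere q)" unfolding tangent_sphere_def
    by (intro closed_Collect_conj closed_Collect_eq continuous_intros)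
  then show ?thesis
    by (auto simp: compact_eq_bounded_closed bounded_iff tangent_sphere_def)
qed

text \<open>If one such ball were null, all would be, and by compactness finitely many of them cover
  the tangent sphere, which carries the full mass. Positivity is what permits division by the ball
  mass in the uniqueness proof.\<close>

lemma tangent_invariant_ball_pos:
  fixes q :: "'a::euclidean_space"
  assumes inv: "tangent_invariant q \<nu>" and "prob_space \<nu>" and y: "y \<in> tangent_sphere q" and r: "r > 0"
  shows "measure \<nu> (ball y r) > 0"
proof (rule ccontr)
  interpret prob_space \<nu> by fact
  assume "\<not> measure \<nu> (ball y r) > 0"
  then have zero: "measure \<nu> (ball z r) = 0" if "z \<in> tangent_sphere q" for z
    using tangent_invariant_ball[OF inv y that, of r] measure_nonneg[of \<nu> "ball y r"] by linarith
  have sets: "sets \<nu> = sets borel" and AE: "AE \<theta> in \<nu>. \<theta> \<in> tangent_sphere q"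
    using inv by (auto simp: tangent_invariant_def)
  obtain D where D: "D \<subseteq> tangent_sphere q" "finite D" "tangent_sphere q \<subseteq> (\<Union>z\<in>D. ball z r)"
    using compactE_image[OF compact_tangent_sphere[of q], of "tangent_sphere q" "\<lambda>z. ball z r"] r
    by (metis (no_types, lifting) UN_iff centre_in_ball open_ball subsetI)
  have "(\<Union>z\<in>D. ball z r) \<in> null_sets \<nu>"
    using D zero by (intro null_sets_UN' countable_finite)
       (auto simp: null_sets_def sets emeasure_eq_measure)
  then have "AE \<theta> in \<nu>. \<theta> \<notin> (\<Union>z\<in>D. ball z r)" by (rule AE_not_in)
  with AE have "AE \<theta> in \<nu>. False" by eventually_elim (use D in auto)
  then show False by simp
qed

text \<open>Integrating \<open>g x - g y\<close> over the pairs at distance less than \<open>r\<close> compares the two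
  integrals, because the ball masses do not depend on the centre.\<close>
lemma tangent_invariant_integral_unique:
  fixes q :: "'a::euclidean_space" and g :: "'a \<Rightarrow> real"
  assumes \<mu>: "tangent_invariant q \<mu>" "finite_measure \<mu>"
    and \<nu>: "tangent_invariant q \<nu>" "prob_space \<nu>"
    and g: "continuous_on UNIV g" "bounded (range g)"
  shows "integral\<^sup>L \<mu> g = measure \<mu> UNIV * integral\<^sup>L \<nu> g"
proof -
  interpret \<mu>: finite_measure \<mu> by fact
  interpret \<nu>: prob_space \<nu> by fact
  interpret pair_sigma_finite \<mu> \<nu> by standard
  interpret P: finite_measure "\<mu> \<Otimes>\<^sub>M \<nu>"
    by (intro finite_measure_pair_measure \<mu>(2) \<nu>.finite_measure_axioms)
  have s[measurable_cong]: "sets \<mu> = sets borel" "sets \<nu> = sets borel"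
    and AE: "AE \<theta> in \<mu>. \<theta> \<in> tangent_sphere q" "AE \<theta> in \<nu>. \<theta> \<in> tangent_sphere q"
    using \<mu> \<nu> by (auto simp: tangent_invariant_def)
  have sp: "space \<mu> = UNIV" "space \<nu> = UNIV" using s[THEN sets_eq_imp_space_eq] by auto
  obtain p where p: "p \<in> tangent_sphere q"
    using AE(2) \<nu>.AE_prob_1 \<nu>.not_empty by (metis (no_types, lifting) AE_E2 \<nu>.AE_False eventually_mono)
  have [measurable]: "tangent_sphere q \<in> sets borel"
    by (intro borel_closed compact_imp_closed compact_tangent_sphere)
  have gm[measurable]: "g \<in> borel_measurable borel"
    using g(1) by (rule borel_measurable_continuous_onI)
  obtain B where B: "\<And>x. \<bar>g x\<bar> \<le> B" using g(2) by (auto simp: bounded_iff)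
  have ucont: "uniformly_continuous_on (tangent_sphere q) g"
    by (intro compact_uniformly_continuous compact_tangent_sphere continuous_on_subset[OF g(1)]) auto
  have est: "\<bar>integral\<^sup>L \<mu> g - measure \<mu> UNIV * integral\<^sup>L \<nu> g\<bar> \<le> \<epsilon> * measure \<mu> UNIV" if "\<epsilon> > 0" for \<epsilon>
  proof -
    obtain r where r: "r > 0" and gr: "\<And>x y. x \<in> tangent_sphere q \<Longrightarrow> y \<in> tangent_sphere q \<Longrightarrow>
        dist x y < r \<Longrightarrow> \<bar>g x - g y\<bar> < \<epsilon>"
      using ucont \<open>\<epsilon> > 0\<close> unfolding uniformly_continuous_on_def dist_real_def
      by (metis dist_commute)
    \<comment> \<open>\<open>W\<close> is a symmetric kernel whose partial integrals are constant on
      the tangent sphere: \<open>c\<close> when \<open>y\<close> is integrated out, \<open>e\<close>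
      when \<open>x\<close> is.\<close>
    define W :: "'a \<Rightarrow> 'a \<Rightarrow> real" where "W x y = (if dist x y < r then 1 else 0)" for x y
    have [measurable]: "(\<lambda>p. W (fst p) (snd p)) \<in> borel_measurable (borel \<Otimes>\<^sub>M borel)"
      unfolding W_def by measurable
    have [measurable]: "(\<lambda>y. \<integral>x. W x y \<partial>\<mu>) \<in> borel_measurable borel"
      unfolding W_def by measurable
    have W01: "0 \<le> W x y" "W x y \<le> 1" for x y by (auto simp: W_def)
    define c where "c = measure \<nu> (ball p r)"
    define e where "e = measure \<mu> (ball p r)"
    have c: "c > 0" unfolding c_def by (rule tangent_invariant_ball_pos[OF \<nu> p r])
    have Wx: "(\<integral>y. W x y \<partial>\<nu>) = c" if "x \<in> tangent_sphere q" for x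
    proof -
      have "(\<integral>y. W x y \<partial>\<nu>) = (\<integral>y. indicator (ball x r) y \<partial>\<nu>)"
        by (intro Bochner_Integration.integral_cong) (auto simp: W_def indicator_def)
      then show ?thesis using tangent_invariant_ball[OF \<nu>(1) that p, of r] by (simp add: c_def sp)
    qed
    have Wy: "(\<integral>x. W x y \<partial>\<mu>) = e" if "y \<in> tangent_sphere q" for y
    proof -
      have "(\<integral>x. W x y \<partial>\<mu>) = (\<integral>x. indicator (ball y r) x \<partial>\<mu>)"
        by (intro Bochner_Integration.integral_cong) (auto simp: W_def indicator_def dist_commute)
      then show ?thesis using tangent_invariant_ball[OF \<mu>(1) that p, of r] by (simp add: e_def sp)
    qed
    have int: "integrable (\<mu> \<Otimes>\<^sub>M \<nu>) (\<lambda>(x, y). h x y * W x y)"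
      if "(\<lambda>p. h (fst p) (snd p)) \<in> borel_measurable (borel \<Otimes>\<^sub>M borel)" "\<And>x y. \<bar>h x y\<bar> \<le> B'" for h :: "'a \<Rightarrow> 'a \<Rightarrow> real" and B'
    proof (rule P.integrable_const_bound[where B = B'])
      show "(\<lambda>(x, y). h x y * W x y) \<in> borel_measurable (\<mu> \<Otimes>\<^sub>M \<nu>)"
        using that(1) unfolding split_beta by measurable
      have "\<bar>h x y\<bar> * W x y \<le> B' * 1" for x y using that(2)[of x y] W01[of x y]
        by (intro mult_mono) (auto intro: order_trans)
      then show "AE p in \<mu> \<Otimes>\<^sub>M \<nu>. norm (case p of (x, y) \<Rightarrow> h x y * W x y) \<le> B'"
        by (auto simp: abs_mult W01)
    qed
    note i1 = int[of "\<lambda>x y. g x" B, simplified, OF B]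
    note i2 = int[of "\<lambda>x y. g y" B, simplified, OF B]
    note i3 = int[of "\<lambda>x y. 1" 1, simplified]
    have "(\<integral>p. (case p of (x, y) \<Rightarrow> g x * W x y) \<partial>(\<mu> \<Otimes>\<^sub>M \<nu>)) = (\<integral>x. \<integral>y. g x * W x y \<partial>\<nu> \<partial>\<mu>)"
      using integral_fst'[OF i1] by simp
    also have "\<dots> = (\<integral>x. g x * c \<partial>\<mu>)"
      using AE(1) by (intro integral_cong_AE) (auto simp: Wx)
    finally have e1: "(\<integral>p. (case p of (x, y) \<Rightarrow> g x * W x y) \<partial>(\<mu> \<Otimes>\<^sub>M \<nu>)) = integral\<^sup>L \<mu> g * c" by simp
    have "(\<integral>p. (case p of (x, y) \<Rightarrow> g y * W x y) \<partial>(\<mu> \<Otimes>\<^sub>M \<nu>)) = (\<integral>y. \<integral>x. g y * W x y \<partial>\<mu> \<partial>\<nu>)"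
      using integral_snd[OF i2] by simp
    also have "\<dots> = (\<integral>y. g y * (\<integral>x. W x y \<partial>\<mu>) \<partial>\<nu>)" by simp
    also have "\<dots> = (\<integral>y. g y * e \<partial>\<nu>)"
      using AE(2) by (intro integral_cong_AE) (measurable, auto simp: Wy)
    finally have e2: "(\<integral>p. (case p of (x, y) \<Rightarrow> g y * W x y) \<partial>(\<mu> \<Otimes>\<^sub>M \<nu>)) = integral\<^sup>L \<nu> g * e" by simp
    have "(\<integral>p. (case p of (x, y) \<Rightarrow> W x y) \<partial>(\<mu> \<Otimes>\<^sub>M \<nu>)) = (\<integral>x. \<integral>y. W x y \<partial>\<nu> \<partial>\<mu>)"
      using integral_fst'[OF i3] by simp
    also have "\<dots> = (\<integral>x. c \<partial>\<mu>)"
      using AE(1) by (intro integral_cong_AE) (auto simp: Wx)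
    finally have e3: "(\<integral>p. (case p of (x, y) \<Rightarrow> W x y) \<partial>(\<mu> \<Otimes>\<^sub>M \<nu>)) = measure \<mu> UNIV * c" by (simp add: sp)
    have "(\<integral>p. (case p of (x, y) \<Rightarrow> W x y) \<partial>(\<mu> \<Otimes>\<^sub>M \<nu>)) = (\<integral>y. \<integral>x. W x y \<partial>\<mu> \<partial>\<nu>)"
      using integral_snd[OF i3] by simp
    also have "\<dots> = (\<integral>y. e \<partial>\<nu>)"
      using AE(2) by (intro integral_cong_AE) (auto simp: Wy)
    \<comment> \<open>The mass of the close pairs, computed in both orders, ties the two constants
      together and turns the comparison of integrals into one with the common factor
      \<open>c\<close>.\<close>
    finally have e4: "e = measure \<mu> UNIV * c" using e3 \<nu>.prob_space by (simp add: sp)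
    have "AE x in \<mu>. AE y in \<nu>. x \<in> tangent_sphere q \<and> y \<in> tangent_sphere q"
      using AE(1) by eventually_elim (use AE(2) in auto)
    then have AEp: "AE p in \<mu> \<Otimes>\<^sub>M \<nu>. fst p \<in> tangent_sphere q \<and> snd p \<in> tangent_sphere q"
    proof (intro AE_pair_measure)
      have "{p \<in> space (\<mu> \<Otimes>\<^sub>M \<nu>). fst p \<in> tangent_sphere q \<and> snd p \<in> tangent_sphere q}
          = tangent_sphere q \<times> tangent_sphere q" by (auto simp: space_pair_measure sp)
      then show "{p \<in> space (\<mu> \<Otimes>\<^sub>M \<nu>). fst p \<in> tangent_sphere q \<and> snd p \<in> tangent_sphere q}
          \<in> sets (\<mu> \<Otimes>\<^sub>M \<nu>)" by (simp add: s)
    qed simp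
    have "\<bar>integral\<^sup>L \<mu> g * c - integral\<^sup>L \<nu> g * e\<bar>
        = \<bar>\<integral>p. (case p of (x, y) \<Rightarrow> g x * W x y) - (case p of (x, y) \<Rightarrow> g y * W x y) \<partial>(\<mu> \<Otimes>\<^sub>M \<nu>)\<bar>"
      using Bochner_Integration.integral_diff[OF i1 i2] e1 e2 by simp
    also have "\<dots> \<le> (\<integral>p. \<bar>(case p of (x, y) \<Rightarrow> g x * W x y) - (case p of (x, y) \<Rightarrow> g y * W x y)\<bar> \<partial>(\<mu> \<Otimes>\<^sub>M \<nu>))"
      by (rule integral_abs_bound)
    also have "\<dots> \<le> (\<integral>p. \<epsilon> * (case p of (x, y) \<Rightarrow> W x y) \<partial>(\<mu> \<Otimes>\<^sub>M \<nu>))"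
    proof (rule integral_mono_AE)
      show "integrable (\<mu> \<Otimes>\<^sub>M \<nu>) (\<lambda>p. \<bar>(case p of (x, y) \<Rightarrow> g x * W x y) - (case p of (x, y) \<Rightarrow> g y * W x y)\<bar>)"
        using i1 i2 by (intro integrable_abs Bochner_Integration.integrable_diff)
      show "integrable (\<mu> \<Otimes>\<^sub>M \<nu>) (\<lambda>p. \<epsilon> * (case p of (x, y) \<Rightarrow> W x y))"
        using i3 by (intro integrable_mult_right)
      show "AE p in \<mu> \<Otimes>\<^sub>M \<nu>. \<bar>(case p of (x, y) \<Rightarrow> g x * W x y) - (case p of (x, y) \<Rightarrow> g y * W x y)\<bar>
          \<le> \<epsilon> * (case p of (x, y) \<Rightarrow> W x y)"
        using AEp by eventually_elim (auto simp: W_def intro!: less_imp_le[OF gr])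
    qed
    also have "\<dots> = \<epsilon> * (measure \<mu> UNIV * c)" using e3 by simp
    finally have "\<bar>integral\<^sup>L \<mu> g * c - integral\<^sup>L \<nu> g * e\<bar> \<le> \<epsilon> * measure \<mu> UNIV * c" by simp
    moreover have "(integral\<^sup>L \<mu> g - measure \<mu> UNIV * integral\<^sup>L \<nu> g) * c = integral\<^sup>L \<mu> g * c - integral\<^sup>L \<nu> g * e"
      by (simp add: e4 algebra_simps)
    then have "\<bar>integral\<^sup>L \<mu> g - measure \<mu> UNIV * integral\<^sup>L \<nu> g\<bar> * c = \<bar>integral\<^sup>L \<mu> g * c - integral\<^sup>L \<nu> g * e\<bar>"
      using c by (metis abs_mult abs_of_pos)
    ultimately have "\<bar>integral\<^sup>L \<mu> g - measure \<mu> UNIV * integral\<^sup>L \<nu> g\<bar> * c \<le> \<epsilon> * measure \<mu> UNIV * c"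
      by simp
    then show ?thesis using c by simp
  qed
  have "\<bar>integral\<^sup>L \<mu> g - measure \<mu> UNIV * integral\<^sup>L \<nu> g\<bar> \<le> 0"
  proof (rule field_le_epsilon)
    fix \<epsilon> :: real assume "\<epsilon> > 0"
    \<comment> \<open>Adding 1 keeps the quotient meaningful when \<open>\<mu>\<close> is the zero
      measure.\<close>
    have "\<bar>integral\<^sup>L \<mu> g - measure \<mu> UNIV * integral\<^sup>L \<nu> g\<bar>
        \<le> (\<epsilon> / (measure \<mu> UNIV + 1)) * measure \<mu> UNIV"
      by (rule est, rule divide_pos_pos[OF \<open>\<epsilon> > 0\<close>]) (simp add: add_nonneg_pos)
    also have "\<dots> \<le> \<epsilon>" using \<open>\<epsilon> > 0\<close> measure_nonneg[of \<mu> UNIV]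
      by (simp add: divide_le_eq add_nonneg_pos mult_left_mono)
    finally show "\<bar>integral\<^sup>L \<mu> g - measure \<mu> UNIV * integral\<^sup>L \<nu> g\<bar> \<le> 0 + \<epsilon>" by simp
  qed
  then show ?thesis by simp
qed

section \<open>Surface measure of spherical caps\<close>

lemma emeasure_lborel_reflect:
  fixes A :: "'a::euclidean_space set"
  assumes [measurable]: "A \<in> sets borel"
  shows "emeasure lborel {y. c - y \<in> A} = emeasure lborel A"
proof -
  have "emeasure lborel A = emeasure (density (distr lborel borel (\<lambda>x. c + (-1) *\<^sub>R x))
      (\<lambda>_. ennreal (\<bar>-1\<bar> ^ DIM('a)))) A"
    by (subst lborel_affine[of "-1" c, symmetric]) auto
  also have "\<dots> = emeasure lborel {y. c - y \<in> A}"
    by (simp add: emeasure_density_const emeasure_distr vimage_def)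
  finally show ?thesis ..
qed

lemma emeasure_lborel_translate:
  fixes A :: "'a::euclidean_space set"
  assumes [measurable]: "A \<in> sets borel"
  shows "emeasure lborel {y. c + y \<in> A} = emeasure lborel A"
proof -
  have "emeasure lborel A = emeasure (distr lborel borel ((+) c)) A"
    by (simp add: lborel_distr_plus)
  also have "\<dots> = emeasure lborel {y. c + y \<in> A}"
    by (simp add: emeasure_distr vimage_def)
  finally show ?thesis ..
qed

text \<open>Integrating \<open>1\<^sub>A (U x) 1\<^sub>B (U x + y)\<close> over \<open>(x, y)\<close> in both orders, with \<open>B\<close> the unit ball.\<close>
lemma emeasure_lborel_orthogonal_vimage:
  fixes U :: "'a::euclidean_space \<Rightarrow> 'a"
  assumes U: "orthogonal_transformation U" and A[measurable]: "A \<in> sets borel"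
  shows "emeasure lborel (U -` A) = emeasure lborel A"
proof -
  let ?L = "lborel :: 'a measure"
  define B where "B = ball (0::'a) 1"
  have B[measurable]: "B \<in> sets borel" by (simp add: B_def)
  have lin: "linear U" using U by (rule orthogonal_transformation_linear)
  have [measurable]: "U \<in> borel_measurable borel"
    using lin by (intro borel_measurable_continuous_onI linear_continuous_on) (simp add: linear_linear)
  have UB: "U -` B = B" by (auto simp: B_def orthogonal_transformation_norm[OF U])
  have B_pos: "emeasure ?L B \<noteq> 0" "emeasure ?L B \<noteq> \<infinity>"
    unfolding B_def using emeasure_ball[of 1 "0::'a"] unit_ball_vol_pos[of "real DIM('a)"]
    by (simp_all del: unit_ball_vol_pos)
  define J where "J x y = indicator A (U x) * (indicator B (U x + y) :: ennreal)" for x y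
  have Jm: "(\<lambda>(x, y). J x y) \<in> borel_measurable (?L \<Otimes>\<^sub>M ?L)" unfolding J_def by measurable
  have "(\<integral>\<^sup>+y. \<integral>\<^sup>+x. J x y \<partial>?L \<partial>?L) = (\<integral>\<^sup>+x. \<integral>\<^sup>+y. J x y \<partial>?L \<partial>?L)"
    using lborel_pair.Fubini'[OF Jm] .
  also have "\<dots> = (\<integral>\<^sup>+x. indicator A (U x) * emeasure ?L B \<partial>?L)"
  proof (intro nn_integral_cong)
    fix x
    have "(\<integral>\<^sup>+y. J x y \<partial>?L) = indicator A (U x) * (\<integral>\<^sup>+y. indicator {y. U x + y \<in> B} y \<partial>?L)"
      unfolding J_def by (subst nn_integral_cmult[symmetric]) (auto simp: indicator_def intro!: nn_integral_cong)
    also have "(\<integral>\<^sup>+y. indicator {y. U x + y \<in> B} y \<partial>?L) = emeasure ?L {y. U x + y \<in> B}"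
      by (rule nn_integral_indicator) measurable
    finally show "(\<integral>\<^sup>+y. J x y \<partial>?L) = indicator A (U x) * emeasure ?L B"
      by (simp only: emeasure_lborel_translate[OF B])
  qed
  also have "\<dots> = (\<integral>\<^sup>+x. indicator (U -` A) x \<partial>?L) * emeasure ?L B"
    by (subst nn_integral_multc[symmetric]) (auto simp: indicator_def intro!: nn_integral_cong)
  also have "\<dots> = emeasure ?L (U -` A) * emeasure ?L B"
    using measurable_sets_borel[of U borel A] by simp
  finally have 1: "(\<integral>\<^sup>+y. \<integral>\<^sup>+x. J x y \<partial>?L \<partial>?L) = emeasure ?L (U -` A) * emeasure ?L B" .
  \<comment> \<open>Translating \<open>x\<close> by a preimage of \<open>y\<close> moves
    \<open>y\<close> from the ball factor into the factor of \<open>A\<close>. The inner integral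
    over \<open>y\<close> then measures a reflected copy of \<open>A\<close>.\<close>
  have shift: "(\<integral>\<^sup>+x. J x y \<partial>?L) = (\<integral>\<^sup>+x. indicator A (U x - y) * indicator B (U x) \<partial>?L)" for y
  proof -
    obtain w where w: "U w = y" using orthogonal_transformation_surj[OF U] by (metis surjD)
    have "(\<integral>\<^sup>+x. J x y \<partial>?L) = (\<integral>\<^sup>+x. J x y \<partial>distr ?L borel ((+) (- w)))" by (simp add: lborel_distr_plus)
    also have "\<dots> = (\<integral>\<^sup>+x. J (- w + x) y \<partial>?L)"
      unfolding J_def by (intro nn_integral_distr) auto
    also have "\<dots> = (\<integral>\<^sup>+x. indicator A (U x - y) * indicator B (U x) \<partial>?L)"
      by (simp add: J_def linear_diff[OF lin] w)
    finally show ?thesis .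
  qed
  have "(\<integral>\<^sup>+y. \<integral>\<^sup>+x. J x y \<partial>?L \<partial>?L) = (\<integral>\<^sup>+y. \<integral>\<^sup>+x. indicator A (U x - y) * indicator B (U x) \<partial>?L \<partial>?L)"
    by (simp add: shift)
  also have "\<dots> = (\<integral>\<^sup>+x. \<integral>\<^sup>+y. indicator A (U x - y) * indicator B (U x) \<partial>?L \<partial>?L)"
    by (rule lborel_pair.Fubini') measurable
  also have "\<dots> = (\<integral>\<^sup>+x. emeasure ?L A * indicator B (U x) \<partial>?L)"
  proof (intro nn_integral_cong)
    fix x
    have "(\<integral>\<^sup>+y. indicator A (U x - y) * indicator B (U x) \<partial>?L)
        = (\<integral>\<^sup>+y. indicator {y. U x - y \<in> A} y \<partial>?L) * indicator B (U x)"
      by (subst nn_integral_multc[symmetric]) (auto simp: indicator_def intro!: nn_integral_cong)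
    also have "(\<integral>\<^sup>+y. indicator {y. U x - y \<in> A} y \<partial>?L) = emeasure ?L {y. U x - y \<in> A}"
      by (rule nn_integral_indicator) measurable
    finally show "(\<integral>\<^sup>+y. indicator A (U x - y) * indicator B (U x) \<partial>?L) = emeasure ?L A * indicator B (U x)"
      by (simp only: emeasure_lborel_reflect[OF A])
  qed
  also have "\<dots> = emeasure ?L A * (\<integral>\<^sup>+x. indicator (U -` B) x \<partial>?L)"
    by (subst nn_integral_cmult[symmetric]) (auto simp: indicator_def intro!: nn_integral_cong)
  \<comment> \<open>The unit ball is its own preimage under \<open>U\<close>; its positive finite
    volume cancels in the end.\<close>
  also have "\<dots> = emeasure ?L A * emeasure ?L B" by (simp add: UB)
  finally have "emeasure ?L (U -` A) * emeasure ?L B = emeasure ?L A * emeasure ?L B" using 1 by simp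
  then show ?thesis using B_pos mult_divide_eq_ennreal by (metis infinity_ennreal_def)
qed

lemma sets_sphere_surface_measure[simp, measurable_cong]: "sets sphere_surface_measure = sets borel"
  by (simp add: sphere_surface_measure_def)

lemma space_sphere_surface_measure[simp]: "space sphere_surface_measure = UNIV"
  by (simp add: sphere_surface_measure_def space_scale_measure)

lemma emeasure_sphere_surface_measure:
  fixes A :: "'a::euclidean_space set"
  assumes [measurable]: "A \<in> sets borel"
  shows "emeasure sphere_surface_measure A =
    of_nat DIM('a) * emeasure lborel {x. x \<in> cball 0 1 \<and> x \<noteq> 0 \<and> x /\<^sub>R norm x \<in> A}"
proof -
  have eq: "{x \<in> space (restrict_space lborel (cball 0 1 - {0})). x /\<^sub>R norm x \<in> A}
     = {x. x \<in> cball 0 1 \<and> x \<noteq> 0 \<and> x /\<^sub>R norm x \<in> A}"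
    by (auto simp: space_restrict_space)
  have m: "(\<lambda>x. x /\<^sub>R norm x) \<in> borel_measurable (restrict_space lborel (cball 0 1 - {0::'a}))"
    by (intro measurable_restrict_space1) measurable
  show ?thesis
    unfolding sphere_surface_measure_def
    by (subst emeasure_scale_measure, subst emeasure_distr[OF m], simp add: assms,
        subst emeasure_restrict_space) (auto simp: vimage_def Int_def space_restrict_space intro!: arg_cong2[where f="(*)"] arg_cong2[where f=emeasure])
qed

lemma finite_sphere_surface_measure: "finite_measure (sphere_surface_measure :: 'a::euclidean_space measure)"
proof
  have "emeasure (lborel :: 'a measure) {x. x \<in> cball 0 1 \<and> x \<noteq> 0 \<and> x /\<^sub>R norm x \<in> UNIV} \<le> emeasure lborel (cball 0 1 :: 'a set)"
    by (intro emeasure_mono) auto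
  also have "\<dots> < \<infinity>" by (simp add: emeasure_cball)
  finally show "emeasure sphere_surface_measure (space (sphere_surface_measure :: 'a measure)) \<noteq> \<infinity>"
    by (simp add: emeasure_sphere_surface_measure ennreal_mult_eq_top_iff)
qed

lemma AE_sphere_surface_measure:
  "AE x in sphere_surface_measure. x \<in> sphere (0::'a::euclidean_space) 1"
proof (rule AE_I')
  have "{x::'a. x \<in> cball 0 1 \<and> x \<noteq> 0 \<and> x /\<^sub>R norm x \<in> - sphere 0 1} = {}" by (auto simp: divide_simps)
  then have "emeasure sphere_surface_measure (- sphere (0::'a) 1) = 0"
    by (subst emeasure_sphere_surface_measure) (simp_all only: borel_comp borel_closed closed_sphere emeasure_empty mult_zero_right)
  then show "- sphere (0::'a) 1 \<in> null_sets sphere_surface_measure"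
    by (simp add: null_sets_def borel_comp)
qed auto

text \<open>\<open>U\<close> preserves norms and commutes with scaling, so the cone over the
  preimage of \<open>A\<close> is the preimage of the cone over \<open>A\<close>. Invariance of
  Lebesgue measure therefore passes to the cone construction.\<close>

lemma distr_sphere_surface_measure:
  fixes U :: "'a::euclidean_space \<Rightarrow> 'a"
  assumes U: "orthogonal_transformation U"
  shows "distr sphere_surface_measure borel U = sphere_surface_measure"
proof (rule measure_eqI)
  fix A :: "'a set" assume "A \<in> sets (distr sphere_surface_measure borel U)"
  then have A[measurable]: "A \<in> sets borel" by simp
  have lin: "linear U" using U by (rule orthogonal_transformation_linear)
  have [measurable]: "U \<in> borel_measurable borel"
    using lin by (intro borel_measurable_continuous_onI linear_continuous_on) (simp add: linear_linear)
  have UA[measurable]: "U -` A \<in> sets borel" using measurable_sets_borel[of U borel A] by simp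
  let ?C = "\<lambda>A. {x::'a. x \<in> cball 0 1 \<and> x \<noteq> 0 \<and> x /\<^sub>R norm x \<in> A}"
  have [measurable]: "?C A \<in> sets borel" by measurable
  have "U x = 0 \<longleftrightarrow> x = 0" for x by (metis U norm_eq_zero orthogonal_transformation_norm)
  then have "?C (U -` A) = U -` (?C A)"
    by (auto simp: orthogonal_transformation_norm[OF U] linear_cmul[OF lin])
  then show "emeasure (distr sphere_surface_measure borel U) A = emeasure sphere_surface_measure A"
    using emeasure_lborel_orthogonal_vimage[OF U \<open>?C A \<in> sets borel\<close>]
    by (simp only: emeasure_distr[of U] emeasure_sphere_surface_measure A UA space_sphere_surface_measure Int_UNIV_right
        \<open>U \<in> borel_measurable borel\<close> measurable_cong_sets[OF sets_sphere_surface_measure refl])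
qed simp

text \<open>The slice at height \<open>y\<close> is a ball of radius \<open>\<tau> * y\<close> in
  one dimension less, and integrating its volume over the heights yields the division by
  \<open>DIM('a)\<close>. Taking \<open>e\<close> in \<open>Basis\<close> allows Lebesgue measure to
  be split into the height coordinate and the others.\<close>

lemma emeasure_lborel_cone:
  fixes e :: "'a::euclidean_space"
  assumes e: "e \<in> Basis" and h: "h \<ge> 0" and \<tau>: "\<tau> > 0"
  shows "emeasure lborel {x. 0 \<le> x \<bullet> e \<and> x \<bullet> e \<le> h \<and> norm (x - (x \<bullet> e) *\<^sub>R e) \<le> \<tau> * (x \<bullet> e)}
    = ennreal (unit_ball_vol (real DIM('a) - 1) * \<tau> ^ (DIM('a) - 1) * h ^ DIM('a) / DIM('a))"
proof -
  interpret product_sigma_finite "\<lambda>_. lborel :: real measure" by standard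
  define B where "B = Basis - {e}"
  have BB: "Basis = insert e B" "e \<notin> B" "finite B" "card B = DIM('a) - 1"
    using e by (auto simp: B_def)
  let ?S = "{x::'a. 0 \<le> x \<bullet> e \<and> x \<bullet> e \<le> h \<and> norm (x - (x \<bullet> e) *\<^sub>R e) \<le> \<tau> * (x \<bullet> e)}"
  let ?v = "\<lambda>f. \<Sum>b\<in>Basis. f b *\<^sub>R b :: 'a"
  let ?P = "Pi\<^sub>M Basis (\<lambda>_. lborel :: real measure) :: ('a \<Rightarrow> real) measure"
  let ?Q = "Pi\<^sub>M B (\<lambda>_. lborel :: real measure) :: ('a \<Rightarrow> real) measure"
  let ?T = "\<lambda>f. 0 \<le> f e \<and> f e \<le> h \<and> sqrt (\<Sum>b\<in>B. (f b)\<^sup>2) \<le> \<tau> * f e"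
  have ve: "?v f \<bullet> e = f e" for f
    using e by (simp add: inner_sum_left inner_Basis if_distrib cong: if_cong)
  have vn: "norm (?v f - f e *\<^sub>R e) = sqrt (\<Sum>b\<in>B. (f b)\<^sup>2)" for f
  proof -
    have "?v f - f e *\<^sub>R e = (\<Sum>b\<in>B. f b *\<^sub>R b)" unfolding BB(1) using BB(2,3) by simp
    then have "norm (?v f - f e *\<^sub>R e) = norm (\<Sum>b\<in>B. f b *\<^sub>R b)" by (simp only:)
    also have "\<dots> = sqrt (\<Sum>b\<in>Basis. ((\<Sum>b\<in>B. f b *\<^sub>R b) \<bullet> b)\<^sup>2)"
      unfolding norm_eq_sqrt_inner by (subst euclidean_inner) (simp add: power2_eq_square[symmetric])
    also have "(\<Sum>b\<in>Basis. ((\<Sum>b\<in>B. f b *\<^sub>R b) \<bullet> b)\<^sup>2) = (\<Sum>b\<in>Basis. if b \<in> B then (f b)\<^sup>2 else 0)"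
      using BB(3) B_def by (intro sum.cong refl) (auto simp: inner_sum_left inner_Basis if_distrib cong: if_cong)
    also have "\<dots> = (\<Sum>b\<in>B. (f b)\<^sup>2)" using BB(3) by (subst sum.If_cases) (auto simp: B_def intro!: sum.cong)
    finally show ?thesis .
  qed
  have Sm[measurable]: "?S \<in> sets borel" by measurable
  have Tm: "{f \<in> space ?P. ?T f} \<in> sets ?P"
  proof -
    have c: "(\<lambda>f. f b) \<in> borel_measurable ?P" if "b \<in> Basis" for b
      using measurable_component_singleton[OF that, of "\<lambda>_. lborel"] by simp
    have c': "(\<lambda>f. f b) \<in> borel_measurable ?P" if "b \<in> B" for b using c that by (auto simp: B_def)
    have cm: "(\<lambda>f. f e) \<in> borel_measurable ?P" by (rule c[OF e])
    have sm: "(\<lambda>f. \<Sum>b\<in>B. (f b)\<^sup>2) \<in> borel_measurable ?P"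
      by (intro borel_measurable_sum borel_measurable_power c')
    show ?thesis
      by (intro sets.sets_Collect_conj borel_measurable_le measurable_compose[OF sm borel_measurable_sqrt]
          borel_measurable_times borel_measurable_const cm)
  qed
  have "emeasure lborel ?S = emeasure (distr ?P borel ?v) ?S" by (simp add: lborel_eq[symmetric])
  also have "\<dots> = emeasure ?P {f \<in> space ?P. ?T f}"
    by (subst emeasure_distr) (auto simp: ve vn intro!: arg_cong2[where f=emeasure])
  also have "\<dots> = (\<integral>\<^sup>+f. indicator {f \<in> space ?P. ?T f} f \<partial>?P)" using Tm by simp
  also have "\<dots> = (\<integral>\<^sup>+y. \<integral>\<^sup>+f. indicator {f \<in> space ?P. ?T f} (f(e := y)) \<partial>?Q \<partial>lborel)"
    using Tm unfolding BB(1) by (intro product_nn_integral_insert_rev BB) auto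
  also have "\<dots> = (\<integral>\<^sup>+y. ennreal (unit_ball_vol (real DIM('a) - 1) * (\<tau> * y) ^ (DIM('a) - 1)) * indicator {0..h} y \<partial>lborel)"
  proof (rule nn_integral_cong_AE)
    \<comment> \<open>Discarding the single height 0 makes the slice radius positive, as the ball
      volume formula requires.\<close>
    have "AE y in lborel. y \<noteq> (0::real)" by (rule AE_lborel_singleton)
    then show "AE y in lborel. (\<integral>\<^sup>+f. indicator {f \<in> space ?P. ?T f} (f(e := y)) \<partial>?Q)
       = ennreal (unit_ball_vol (real DIM('a) - 1) * (\<tau> * y) ^ (DIM('a) - 1)) * indicator {0..h} y"
    proof eventually_elim
      case (elim y)
      show ?case
      proof (cases "y \<in> {0..h}")
        case False
        then have "(\<integral>\<^sup>+f. indicator {f \<in> space ?P. ?T f} (f(e := y)) \<partial>?Q) = (\<integral>\<^sup>+f. 0 \<partial>?Q)"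
          by (intro nn_integral_cong) (auto simp: indicator_def)
        with False show ?thesis by simp
      next
        case True
        with elim \<tau> have pos: "\<tau> * y > 0" by simp
        have sm: "(\<Sum>b\<in>B. (if b = e then y else f b)\<^sup>2) = (\<Sum>b\<in>B. (f b)\<^sup>2)" for f :: "'a \<Rightarrow> real"
          using BB(2) by (intro sum.cong) auto
        have "(\<integral>\<^sup>+f. indicator {f \<in> space ?P. ?T f} (f(e := y)) \<partial>?Q)
           = (\<integral>\<^sup>+f. indicator ({f. sqrt (\<Sum>i\<in>B. (f i)\<^sup>2) \<le> \<tau> * y} \<inter> space ?Q) f \<partial>?Q)"
          using True BB by (intro nn_integral_cong) (auto simp: indicator_def sm space_PiM PiE_def extensional_def)
        also have "\<dots> = emeasure ?Q ({f. sqrt (\<Sum>i\<in>B. (f i)\<^sup>2) \<le> \<tau> * y} \<inter> space ?Q)"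
          by (intro nn_integral_indicator) measurable
        also have "\<dots> = ennreal (unit_ball_vol (real (card B)) * (\<tau> * y) ^ card B)"
          by (rule emeasure_cball_aux[OF BB(3) pos])
        finally show ?thesis using True BB(4) by (simp add: of_nat_diff)
      qed
    qed
  qed
  also have "\<dots> = ennreal (unit_ball_vol (real DIM('a) - 1) * \<tau> ^ (DIM('a) - 1) * h ^ DIM('a) / DIM('a)
       - unit_ball_vol (real DIM('a) - 1) * \<tau> ^ (DIM('a) - 1) * 0 ^ DIM('a) / DIM('a))"
  proof (rule nn_integral_FTC_Icc[where F = "\<lambda>y. unit_ball_vol (real DIM('a) - 1) * \<tau> ^ (DIM('a) - 1) * y ^ DIM('a) / DIM('a)"])
    show "DERIV (\<lambda>y. unit_ball_vol (real DIM('a) - 1) * \<tau> ^ (DIM('a) - 1) * y ^ DIM('a) / DIM('a)) y :> unit_ball_vol (real DIM('a) - 1) * (\<tau> * y) ^ (DIM('a) - 1)" for y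
      by (auto intro!: derivative_eq_intros simp: power_mult_distrib)
    show "0 \<le> unit_ball_vol (real DIM('a) - 1) * (\<tau> * y) ^ (DIM('a) - 1)" if "y \<in> {0..h}" for y
      using that \<tau> by simp
  qed (use h in auto)
  finally show ?thesis by (simp add: zero_power)
qed

section \<open>Spherical caps and their leading asymptotics\<close>

definition cap :: "'a::euclidean_space \<Rightarrow> real \<Rightarrow> 'a set" where
  "cap q t = {x. 1 - q \<bullet> x \<le> t}"

lemma cap_borel[measurable]: "cap q t \<in> sets borel"
  unfolding cap_def by measurable

text \<open>With \<open>c = 1 - t\<close>, membership says that the angle to \<open>e\<close> has
  cosine at least \<open>c\<close>, equivalently tangent at most
  \<open>sqrt (1 - c\<^sup>2) / c\<close>. Since \<open>c\<close> is positive, both conditions can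
  be compared after squaring.\<close>

lemma cap_cone_iff:
  fixes e x :: "'a::euclidean_space"
  assumes "norm e = 1" "0 < t" "t < 1" "x \<noteq> 0"
  shows "x /\<^sub>R norm x \<in> cap e t \<longleftrightarrow>
    0 \<le> x \<bullet> e \<and> norm (x - (x \<bullet> e) *\<^sub>R e) \<le> sqrt (1 - (1 - t)\<^sup>2) / (1 - t) * (x \<bullet> e)"
proof -
  define c s p where "c = 1 - t" and "s = x \<bullet> e" and "p = norm (x - (x \<bullet> e) *\<^sub>R e)"
  have c: "0 < c" "c < 1" using assms by (auto simp: c_def)
  have c2: "c\<^sup>2 < 1" using c by (simp add: power_less_one_iff abs_square_less_1)
  have nx: "norm x > 0" using assms by simp
  have p: "p \<ge> 0" by (simp add: p_def)
  have ee: "e \<bullet> e = 1" using assms(1) by (simp add: norm_eq_1)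
  have "p\<^sup>2 = x \<bullet> x - s\<^sup>2"
    unfolding p_def s_def power2_norm_eq_inner
    by (simp add: inner_diff_left inner_diff_right inner_commute[of e x] ee power2_eq_square)
  then have pyth: "(norm x)\<^sup>2 = s\<^sup>2 + p\<^sup>2" by (simp add: power2_norm_eq_inner)
  have "x /\<^sub>R norm x \<in> cap e t \<longleftrightarrow> c \<le> s / norm x"
    by (auto simp: cap_def c_def s_def inner_commute[of e x] divide_inverse mult.commute)
  also have "\<dots> \<longleftrightarrow> c * norm x \<le> s" using nx by (simp add: le_divide_eq)
  also have "\<dots> \<longleftrightarrow> 0 \<le> s \<and> (c * norm x)\<^sup>2 \<le> s\<^sup>2"
    using c nx by (smt (verit, best) mult_nonneg_nonneg power2_le_imp_le power_mono)
  also have "(c * norm x)\<^sup>2 \<le> s\<^sup>2 \<longleftrightarrow> (c * p)\<^sup>2 \<le> (1 - c\<^sup>2) * s\<^sup>2"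
    by (simp add: power_mult_distrib pyth algebra_simps)
  also have "(1 - c\<^sup>2) * s\<^sup>2 = (sqrt (1 - c\<^sup>2) * s)\<^sup>2" using c2 by (simp add: power_mult_distrib)
  also have "0 \<le> s \<and> (c * p)\<^sup>2 \<le> (sqrt (1 - c\<^sup>2) * s)\<^sup>2 \<longleftrightarrow> 0 \<le> s \<and> c * p \<le> sqrt (1 - c\<^sup>2) * s"
    using c p c2 by (auto intro!: power_mono mult_nonneg_nonneg dest: power2_le_imp_le)
  also have "\<dots> \<longleftrightarrow> 0 \<le> s \<and> p \<le> sqrt (1 - c\<^sup>2) / c * s" using c by (simp add: field_simps)
  finally show ?thesis by (simp add: c_def s_def p_def)
qed

text \<open>The surface measure of the cap is \<open>CARD('n)\<close> times the volume of a cone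
  with a round end inside the unit ball. That cone lies between straight ones of heights
  \<open>1 - t\<close> and \<open>1\<close>, and the factor \<open>CARD('n)\<close> cancels against
  the denominator in the volume of a straight cone.\<close>

lemma measure_cap_bounds:
  fixes q :: "real ^ 'n"
  assumes q: "norm q = 1" and t: "0 < t" "t < 1"
  defines "\<tau> \<equiv> sqrt (1 - (1 - t)\<^sup>2) / (1 - t)"
  defines "\<kappa> \<equiv> unit_ball_vol (real CARD('n) - 1)"
  shows "\<kappa> * \<tau> ^ (CARD('n) - 1) * (1 - t) ^ CARD('n) \<le> measure sphere_surface_measure (cap q t)"
    and "measure sphere_surface_measure (cap q t) \<le> \<kappa> * \<tau> ^ (CARD('n) - 1)"
proof -
  interpret finite_measure "sphere_surface_measure :: (real^'n) measure" by (rule finite_sphere_surface_measure)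
  obtain k :: 'n where True by simp
  define e :: "real^'n" where "e = axis k 1"
  have e: "e \<in> Basis" "norm e = 1" by (auto simp: e_def axis_in_Basis_iff norm_axis_1)
  obtain U :: "real^'n \<Rightarrow> real^'n" where U: "orthogonal_transformation U" "U q = e"
    using orthogonal_transformation_exists_1[OF q e(2)] by blast
  have [measurable]: "U \<in> borel_measurable borel" using orthogonal_transformation_linear[OF U(1)]
    by (intro borel_measurable_continuous_onI linear_continuous_on) (simp add: linear_linear)
  have Uc: "U -` cap e t = cap q t"
    using U by (auto simp: cap_def orthogonal_transformation_def)
  have cap_eq: "emeasure sphere_surface_measure (cap q t) = emeasure sphere_surface_measure (cap e t)"
  proof -
    have "emeasure sphere_surface_measure (cap e t) = emeasure (distr sphere_surface_measure borel U) (cap e t)"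
      by (simp add: distr_sphere_surface_measure[OF U(1)])
    also have "\<dots> = emeasure sphere_surface_measure (cap q t)"
      by (subst emeasure_distr) (auto simp: Uc)
    finally show ?thesis ..
  qed
  have "(1 - t)\<^sup>2 < 1" using t by (simp add: power_less_one_iff abs_square_less_1)
  then have \<tau>: "\<tau> > 0" using t by (simp add: \<tau>_def)
  define D where "D = CARD('n)"
  have D: "D > 0" by (simp add: D_def)
  let ?C = "\<lambda>h. {x. 0 \<le> x \<bullet> e \<and> x \<bullet> e \<le> h \<and> norm (x - (x \<bullet> e) *\<^sub>R e) \<le> \<tau> * (x \<bullet> e)}"
  let ?K = "{x. x \<in> cball 0 1 \<and> x \<noteq> 0 \<and> x /\<^sub>R norm x \<in> cap e t}"
  have Cm[measurable]: "?C h \<in> sets borel" for h by measurable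
  have Km[measurable]: "?K \<in> sets borel" by measurable
  have C: "emeasure lborel (?C h) = ennreal (\<kappa> * \<tau> ^ (D - 1) * h ^ D / D)" if "h \<ge> 0" for h
    using emeasure_lborel_cone[OF e(1) that \<tau>] by (simp add: \<kappa>_def D_def)
  have \<sigma>: "emeasure sphere_surface_measure (cap q t) = of_nat D * emeasure lborel ?K"
    unfolding cap_eq by (subst emeasure_sphere_surface_measure) (auto simp: D_def)
  have eq: "of_nat D * ennreal (y / D) = ennreal y" if "y \<ge> 0" for y
    using D that by (simp add: ennreal_of_nat_eq_real_of_nat ennreal_mult[symmetric])
  have \<kappa>: "\<kappa> \<ge> 0" using D by (simp add: \<kappa>_def D_def)
  have "?K \<subseteq> ?C 1"
  proof
    fix x assume x: "x \<in> ?K"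
    have "x \<bullet> e \<le> norm x * norm e" by (rule norm_cauchy_schwarz)
    with x e have "x \<bullet> e \<le> 1" by simp
    with x show "x \<in> ?C 1" using cap_cone_iff[OF e(2) t, of x] by (simp add: \<tau>_def)
  qed
  then have "emeasure lborel ?K \<le> emeasure lborel (?C 1)" by (intro emeasure_mono) auto
  then have "emeasure sphere_surface_measure (cap q t) \<le> of_nat D * ennreal (\<kappa> * \<tau> ^ (D - 1) * 1 ^ D / D)"
    unfolding \<sigma> using C[of 1] by (simp add: mult_left_mono)
  then have "emeasure sphere_surface_measure (cap q t) \<le> ennreal (\<kappa> * \<tau> ^ (D - 1))"
    using \<kappa> \<tau> by (simp add: eq)
  then show "measure sphere_surface_measure (cap q t) \<le> \<kappa> * \<tau> ^ (CARD('n) - 1)"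
    using \<kappa> \<tau> by (simp add: emeasure_eq_measure D_def)
  have sub: "?C (1 - t) - {0} \<subseteq> ?K"
  proof
    fix x assume x: "x \<in> ?C (1 - t) - {0}"
    then have cx: "x /\<^sub>R norm x \<in> cap e t" using cap_cone_iff[OF e(2) t, of x] by (simp add: \<tau>_def)
    \<comment> \<open>The slope condition bounds \<open>norm x\<close> by the height divided by
      \<open>1 - t\<close>, so a straight cone of height \<open>1 - t\<close> stays inside the
      ball.\<close>
    moreover from cx have "(1 - t) * norm x \<le> x \<bullet> e"
      using x by (auto simp: cap_def field_simps inner_commute)
    then have "(1 - t) * norm x \<le> (1 - t) * 1" using x by simp
    then have "norm x \<le> 1" using t by (simp only: mult_le_cancel_left_pos diff_gt_0_iff_gt)
    ultimately show "x \<in> ?K" using x by simp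
  qed
  have "emeasure lborel (?C (1 - t)) = emeasure lborel (?C (1 - t) - {0})"
    by (intro emeasure_Diff_null_set[symmetric]) (auto intro: finite_imp_null_set_lborel)
  also have "\<dots> \<le> emeasure lborel ?K" using sub by (intro emeasure_mono) auto
  finally have "of_nat D * ennreal (\<kappa> * \<tau> ^ (D - 1) * (1 - t) ^ D / D) \<le> emeasure sphere_surface_measure (cap q t)"
    unfolding \<sigma> using C[of "1 - t"] t by (simp add: mult_left_mono)
  then have "ennreal (\<kappa> * \<tau> ^ (D - 1) * (1 - t) ^ D) \<le> emeasure sphere_surface_measure (cap q t)"
    using \<kappa> \<tau> t by (subst (asm) eq) auto
  then show "\<kappa> * \<tau> ^ (CARD('n) - 1) * (1 - t) ^ CARD('n) \<le> measure sphere_surface_measure (cap q t)"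
    by (simp add: emeasure_eq_measure D_def)
qed

lemma unit_ball_vol_sphere_area:
  assumes "n \<ge> 2"
  shows "unit_ball_vol (real n - 1) = sphere_area (n - 2) / (real n - 1)"
proof -
  have g: "Gamma ((real n - 1) / 2 + 1) = (real n - 1) / 2 * Gamma ((real n - 1) / 2)"
    using assms by (intro Gamma_plus1) (auto dest!: nonpos_Ints_nonpos)
  have r: "real (n - 2) + 1 = real n - 1" using assms by (simp add: of_nat_diff)
  show ?thesis unfolding unit_ball_vol_def sphere_area_def r g by (simp add: mult.commute)
qed

text \<open>The slope satisfies \<open>\<tau>\<^sup>2 = t * (2 - t) / (1 - t)\<^sup>2\<close>, and
  its power \<open>CARD('n) - 1\<close> is \<open>\<tau> powr (2 * \<gamma>)\<close>. Dividing by
  \<open>t powr \<gamma>\<close> leaves in both bounds an expression that tends to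
  \<open>2 powr \<gamma>\<close> times the volume of the unit ball in dimension
  \<open>CARD('n) - 1\<close>. The limit is the constant of \<open>C(q)\<close> without its density
  factor.\<close>

lemma measure_cap_asymp:
  fixes q :: "real ^ 'n"
  assumes q: "norm q = 1" and n2: "CARD('n) \<ge> 2"
  defines "\<gamma> \<equiv> (real CARD('n) - 1) / 2"
  shows "((\<lambda>t. measure sphere_surface_measure (cap q t) / t powr \<gamma>) \<longlongrightarrow>
     2 powr \<gamma> * sphere_area (CARD('n) - 2) / (real CARD('n) - 1)) (at_right 0)"
proof (rule tendsto_sandwich)
  define \<kappa> where "\<kappa> = unit_ball_vol (real CARD('n) - 1)"
  have \<kappa>: "2 powr \<gamma> * sphere_area (CARD('n) - 2) / (real CARD('n) - 1) = \<kappa> * 2 powr \<gamma>"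
    using unit_ball_vol_sphere_area[OF n2] by (simp add: \<kappa>_def)
  have \<tau>: "(sqrt (1 - (1 - t)\<^sup>2) / (1 - t)) ^ (CARD('n) - 1) = ((2 - t) / (1 - t)\<^sup>2) powr \<gamma> * t powr \<gamma>"
    if t: "0 < t" "t < 1" for t :: real
  proof -
    have "(1 - t)\<^sup>2 < 1" using t by (simp add: power_less_one_iff abs_square_less_1)
    then have pos: "sqrt (1 - (1 - t)\<^sup>2) / (1 - t) > 0" using t by simp
    have sq: "(sqrt (1 - (1 - t)\<^sup>2) / (1 - t))\<^sup>2 = (2 - t) / (1 - t)\<^sup>2 * t"
      using \<open>(1 - t)\<^sup>2 < 1\<close> by (simp add: power_divide) (simp add: power2_eq_square algebra_simps)
    have "(sqrt (1 - (1 - t)\<^sup>2) / (1 - t)) ^ (CARD('n) - 1) = (sqrt (1 - (1 - t)\<^sup>2) / (1 - t)) powr (2 * \<gamma>)"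
    proof -
      have "2 * \<gamma> = real (CARD('n) - 1)" using n2 by (simp add: \<gamma>_def of_nat_diff)
      then show ?thesis using pos by (simp only: powr_realpow)
    qed
    also have "\<dots> = ((sqrt (1 - (1 - t)\<^sup>2) / (1 - t)) powr 2) powr \<gamma>" by (simp add: powr_powr)
    also have "\<dots> = ((2 - t) / (1 - t)\<^sup>2 * t) powr \<gamma>" using pos sq by (simp add: powr_numeral)
    also have "\<dots> = ((2 - t) / (1 - t)\<^sup>2) powr \<gamma> * t powr \<gamma>" using t by (subst powr_mult) auto
    finally show ?thesis .
  qed
  have ev: "\<forall>\<^sub>F t::real in at_right 0. 0 < t \<and> t < 1"
    by (rule eventually_at_rightI[of 0 1]) auto
  show "\<forall>\<^sub>F t in at_right 0. \<kappa> * ((2 - t) / (1 - t)\<^sup>2) powr \<gamma> * (1 - t) ^ CARD('n)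
      \<le> measure sphere_surface_measure (cap q t) / t powr \<gamma>"
    using ev
  proof eventually_elim
    case (elim t)
    with measure_cap_bounds(1)[OF q, of t] \<tau>[of t] show ?case
      by (simp add: \<kappa>_def pos_le_divide_eq ac_simps)
  qed
  show "\<forall>\<^sub>F t in at_right 0. measure sphere_surface_measure (cap q t) / t powr \<gamma>
      \<le> \<kappa> * ((2 - t) / (1 - t)\<^sup>2) powr \<gamma>"
    using ev
  proof eventually_elim
    case (elim t)
    with measure_cap_bounds(2)[OF q, of t] \<tau>[of t] show ?case
      by (simp add: \<kappa>_def pos_divide_le_eq ac_simps)
  qed
  have l: "((\<lambda>t::real. ((2 - t) / (1 - t)\<^sup>2) powr \<gamma>) \<longlongrightarrow> ((2 - 0) / (1 - 0)\<^sup>2) powr \<gamma>) (at_right 0)"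
    by (intro tendsto_powr tendsto_divide tendsto_diff tendsto_power tendsto_const tendsto_ident_at) auto
  have l2: "((\<lambda>t::real. (1 - t) ^ CARD('n)) \<longlongrightarrow> (1 - 0) ^ CARD('n)) (at_right 0)"
    by (intro tendsto_intros)
  show "((\<lambda>t. \<kappa> * ((2 - t) / (1 - t)\<^sup>2) powr \<gamma>) \<longlongrightarrow>
     2 powr \<gamma> * sphere_area (CARD('n) - 2) / (real CARD('n) - 1)) (at_right 0)"
    unfolding \<kappa> using tendsto_mult[OF tendsto_const l, of \<kappa>] by simp
  show "((\<lambda>t. \<kappa> * ((2 - t) / (1 - t)\<^sup>2) powr \<gamma> * (1 - t) ^ CARD('n)) \<longlongrightarrow>
     2 powr \<gamma> * sphere_area (CARD('n) - 2) / (real CARD('n) - 1)) (at_right 0)"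
    unfolding \<kappa> using tendsto_mult[OF tendsto_mult[OF tendsto_const l, of \<kappa>] l2] by simp
qed

section \<open>Tangential directions on a belt\<close>

text \<open>For unit \<open>q\<close> and \<open>x\<close> a multiple of \<open>q\<close>, both
  numerator and norm vanish and the value is 0, which is not a tangent direction. The condition
  \<open>0 < 1 - q \<bullet> x < 2\<close> in later statements excludes the two poles.\<close>

definition tdir :: "'a::euclidean_space \<Rightarrow> 'a \<Rightarrow> 'a" where
  "tdir q x = (x - (q \<bullet> x) *\<^sub>R q) /\<^sub>R norm (x - (q \<bullet> x) *\<^sub>R q)"

lemma tdir_borel[measurable]: "tdir q \<in> borel_measurable borel"
  unfolding tdir_def by measurable

lemma norm_tangential_part:
  fixes q x :: "'a::euclidean_space"
  assumes "norm q = 1" "norm x = 1"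
  shows "(norm (x - (q \<bullet> x) *\<^sub>R q))\<^sup>2 = 2 * (1 - q \<bullet> x) - (1 - q \<bullet> x)\<^sup>2"
proof -
  have "q \<bullet> q = 1" "x \<bullet> x = 1" using assms by (auto simp: norm_eq_1)
  then show ?thesis
    by (simp add: power2_norm_eq_inner inner_diff_left inner_diff_right inner_commute[of x q])
       (simp add: power2_eq_square algebra_simps)
qed

lemma tdir_in_tangent_sphere:
  fixes q x :: "'a::euclidean_space"
  assumes "norm q = 1" "norm x = 1" "0 < 1 - q \<bullet> x" "1 - q \<bullet> x < 2"
  shows "tdir q x \<in> tangent_sphere q"
proof -
  have "(norm (x - (q \<bullet> x) *\<^sub>R q))\<^sup>2 = (1 - q \<bullet> x) * (2 - (1 - q \<bullet> x))"
    using norm_tangential_part[OF assms(1,2)] by (simp add: power2_eq_square algebra_simps)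
  also have "\<dots> > 0" using assms by (intro mult_pos_pos) auto
  finally have "x - (q \<bullet> x) *\<^sub>R q \<noteq> 0" by auto
  moreover have "q \<bullet> q = 1" using assms by (simp add: norm_eq_1)
  ultimately show ?thesis
    by (simp add: tangent_sphere_def tdir_def inner_diff_left inner_commute[of x q])
qed

lemma tdir_orthogonal:
  assumes "orthogonal_transformation U" "U q = q"
  shows "tdir q (U x) = U (tdir q x)"
proof -
  have lin: "linear U" using assms(1) by (rule orthogonal_transformation_linear)
  have "q \<bullet> U x = q \<bullet> x" using assms unfolding orthogonal_transformation_def by metis
  then have "U x - (q \<bullet> U x) *\<^sub>R q = U (x - (q \<bullet> x) *\<^sub>R q)"
    by (simp add: linear_diff[OF lin] linear_cmul[OF lin] assms(2))
  then show ?thesis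
    by (simp add: tdir_def orthogonal_transformation_norm[OF assms(1)] linear_cmul[OF lin])
qed

text \<open>Open at the lower height, so that consecutive belts are disjoint and the belt starting
  at height 0 omits \<open>q\<close>.\<close>

definition belt :: "'a::euclidean_space \<Rightarrow> real \<Rightarrow> real \<Rightarrow> 'a set" where
  "belt q s t = {x. s < 1 - q \<bullet> x \<and> 1 - q \<bullet> x \<le> t}"

lemma belt_borel[measurable]: "belt q s t \<in> sets borel"
  unfolding belt_def by measurable

lemma measure_belt:
  assumes "finite_measure \<mu>" "sets \<mu> = sets borel" "s \<le> t"
  shows "measure \<mu> (belt q s t) = measure \<mu> (cap q t) - measure \<mu> (cap q s)"
proof -
  interpret finite_measure \<mu> by fact
  have "belt q s t = cap q t - cap q s" by (auto simp: belt_def cap_def)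
  then show ?thesis using assms by (simp add: finite_measure_Diff cap_def subset_eq cap_borel[unfolded cap_def])
qed

text \<open>Orthogonal maps fixing \<open>q\<close> preserve the belt and commute with
  \<open>tdir q\<close>, so the image of the surface measure on the belt is tangent invariant. Its
  total mass is that of the belt; this is why uniqueness was proved for finite measures of any mass.
  The bounds on \<open>s\<close> and \<open>t\<close> keep the belt away from the poles.\<close>

lemma integral_belt_tdir:
  fixes q :: "'a::euclidean_space" and g :: "'a \<Rightarrow> real"
  assumes q: "norm q = 1" and st: "0 \<le> s" "t < 2"
    and \<nu>: "tangent_invariant q \<nu>" "prob_space \<nu>"
    and g: "continuous_on UNIV g" "bounded (range g)"
  shows "(\<integral>x. indicator (belt q s t) x * g (tdir q x) \<partial>sphere_surface_measure)
    = measure sphere_surface_measure (belt q s t) * integral\<^sup>L \<nu> g"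
proof -
  let ?\<sigma> = "sphere_surface_measure :: 'a measure"
  interpret \<sigma>: finite_measure ?\<sigma> by (rule finite_sphere_surface_measure)
  define D where "D = density ?\<sigma> (indicator (belt q s t))"
  define \<mu> where "\<mu> = distr D borel (tdir q)"
  have [simp, measurable_cong]: "sets D = sets borel" by (simp add: D_def)
  have [simp]: "space D = UNIV" by (simp add: D_def)
  have gm[measurable]: "g \<in> borel_measurable borel"
    using g(1) by (rule borel_measurable_continuous_onI)
  have D: "emeasure D A = emeasure ?\<sigma> (belt q s t \<inter> A)" if "A \<in> sets borel" for A
    using that by (simp add: D_def emeasure_density nn_integral_indicator' indicator_inter_arith[symmetric])
  have fin: "finite_measure D" by standard (simp add: D)
  have DU: "distr D borel U = D" if U: "orthogonal_transformation U" "U q = q" for U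
  proof (rule measure_eqI)
    fix A :: "'a set" assume "A \<in> sets (distr D borel U)"
    then have A[measurable]: "A \<in> sets borel" by simp
    note Um[measurable] = orthogonal_transformation_borel_measurable[OF U(1)]
    have UA: "U -` A \<in> sets borel" using measurable_sets_borel[OF Um A] by simp
    have "q \<bullet> U x = q \<bullet> x" for x using U unfolding orthogonal_transformation_def by metis
    then have "belt q s t \<inter> U -` A = U -` (belt q s t \<inter> A)" by (auto simp: belt_def)
    then have "emeasure (distr D borel U) A = emeasure ?\<sigma> (U -` (belt q s t \<inter> A))"
      using UA by (subst emeasure_distr) (auto simp: D)
    also have "\<dots> = emeasure (distr ?\<sigma> borel U) (belt q s t \<inter> A)"
      by (subst emeasure_distr) auto
    finally show "emeasure (distr D borel U) A = emeasure D A"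
      by (simp add: distr_sphere_surface_measure[OF U(1)] D)
  qed simp
  have "tangent_invariant q \<mu>"
    unfolding tangent_invariant_def
  proof (intro conjI allI impI)
    show "sets \<mu> = sets borel" by (simp add: \<mu>_def)
    have "closed (tangent_sphere q)" by (intro compact_imp_closed compact_tangent_sphere)
    then have T: "{\<theta> \<in> space borel. \<theta> \<in> tangent_sphere q} \<in> sets borel" by simp
    have "AE x in ?\<sigma>. x \<in> belt q s t \<longrightarrow> tdir q x \<in> tangent_sphere q"
      using AE_sphere_surface_measure
    proof eventually_elim
      case (elim x)
      then show ?case using st q by (auto simp: belt_def intro!: tdir_in_tangent_sphere)
    qed
    then have "AE x in D. tdir q x \<in> tangent_sphere q"
      unfolding D_def by (subst AE_density) (auto elim!: eventually_mono simp: indicator_def split: if_splits)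
    then show "AE \<theta> in \<mu>. \<theta> \<in> tangent_sphere q"
      unfolding \<mu>_def using T by (subst AE_distr_iff) auto
    fix U assume U: "orthogonal_transformation U \<and> U q = q"
    note Um[measurable] = orthogonal_transformation_borel_measurable[OF conjunct1[OF U]]
    have "distr \<mu> borel U = distr D borel (U \<circ> tdir q)"
      unfolding \<mu>_def by (rule distr_distr) auto
    also have "U \<circ> tdir q = tdir q \<circ> U" using U by (auto simp: tdir_orthogonal)
    also have "distr D borel (tdir q \<circ> U) = distr (distr D borel U) borel (tdir q)"
      by (rule distr_distr[symmetric]) auto
    also have "\<dots> = \<mu>" using U by (simp add: DU \<mu>_def)
    finally show "distr \<mu> borel U = \<mu>" .
  qed
  moreover have "finite_measure \<mu>"
    unfolding \<mu>_def by (intro finite_measure.finite_measure_distr[OF fin]) auto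
  ultimately have "integral\<^sup>L \<mu> g = measure \<mu> UNIV * integral\<^sup>L \<nu> g"
    using tangent_invariant_integral_unique \<nu> g by blast
  moreover have "measure \<mu> UNIV = measure ?\<sigma> (belt q s t)"
    unfolding \<mu>_def by (subst measure_distr) (auto simp: measure_def D)
  moreover have "integral\<^sup>L \<mu> g = (\<integral>x. g (tdir q x) \<partial>D)"
    unfolding \<mu>_def by (rule integral_distr) auto
  moreover have "(\<integral>x. g (tdir q x) \<partial>D) = (\<integral>x. indicator (belt q s t) x * g (tdir q x) \<partial>?\<sigma>)"
  proof -
    have "D = density ?\<sigma> (\<lambda>x. ennreal (indicator (belt q s t) x))"
      unfolding D_def by (simp add: ennreal_indicator)
    then show ?thesis by (simp add: integral_density)
  qed
  ultimately show ?thesis by simp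
qed

text \<open>Write \<open>p\<close> as \<open>p q\<close> plus the deviation from it, which is at
  most \<open>\<epsilon>\<close> on the part of the sphere in a low cap. The threshold
  \<open>t0\<close> depends neither on \<open>h\<close> nor on \<open>B\<close>, so it serves
  integrands that change with \<open>n\<close>.\<close>

lemma density_cap_approx:
  fixes q :: "'a::euclidean_space"
  assumes p[measurable]: "p \<in> borel_measurable borel" and p0: "\<And>x. p x \<ge> 0"
    and cont: "\<And>\<epsilon>. \<epsilon> > 0 \<Longrightarrow> \<exists>t>0. \<forall>x\<in>sphere 0 1. 1 - q \<bullet> x \<le> t \<longrightarrow> \<bar>p x - p q\<bar> \<le> \<epsilon>"
    and \<epsilon>: "\<epsilon> > 0"
  obtains t0 where "t0 > 0"
    "\<And>t h B. t \<le> t0 \<Longrightarrow> h \<in> borel_measurable borel \<Longrightarrow> (\<And>x. \<bar>h x\<bar> \<le> B * indicator (cap q t) x) \<Longrightarrow> B \<ge> 0 \<Longrightarrow>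
      \<bar>(\<integral>x. h x \<partial>density sphere_surface_measure (\<lambda>x. ennreal (p x))) - p q * (\<integral>x. h x \<partial>sphere_surface_measure)\<bar>
      \<le> \<epsilon> * B * measure sphere_surface_measure (cap q t)"
proof -
  let ?\<sigma> = "sphere_surface_measure :: 'a measure"
  interpret \<sigma>: finite_measure ?\<sigma> by (rule finite_sphere_surface_measure)
  obtain t0 where t0: "t0 > 0" and near: "\<And>x. norm x = 1 \<Longrightarrow> 1 - q \<bullet> x \<le> t0 \<Longrightarrow> \<bar>p x - p q\<bar> \<le> \<epsilon>"
    using cont[OF \<epsilon>] by auto
  show ?thesis
  proof (rule that[OF t0])
    fix t B :: real and h :: "'a \<Rightarrow> real"
    assume t: "t \<le> t0" and h[measurable]: "h \<in> borel_measurable borel"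
      and hB: "\<And>x. \<bar>h x\<bar> \<le> B * indicator (cap q t) x" and B: "B \<ge> 0"
    have hB': "\<bar>h x\<bar> \<le> B" for x using hB[of x] B by (cases "x \<in> cap q t") auto
    have ih: "integrable ?\<sigma> h"
      by (rule \<sigma>.integrable_const_bound[of _ B]) (use hB' in auto)
    have ic: "integrable ?\<sigma> (\<lambda>x. \<epsilon> * B * indicator (cap q t) x)"
      by (intro integrable_mult_right) (simp add: integrable_indicator_iff \<sigma>.emeasure_finite less_top[symmetric])
    have bd: "AE x in ?\<sigma>. \<bar>(p x - p q) * h x\<bar> \<le> \<epsilon> * B * indicator (cap q t) x"
      using AE_sphere_surface_measure
    proof eventually_elim
      case (elim x)
      show ?case
      proof (cases "x \<in> cap q t")
        case True
        then have "\<bar>p x - p q\<bar> \<le> \<epsilon>" using near[of x] elim t by (auto simp: cap_def)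
        then show ?thesis using hB[of x] True \<epsilon> by (auto simp: abs_mult intro: mult_mono)
      next
        case False
        then show ?thesis using hB[of x] by auto
      qed
    qed
    have id: "integrable ?\<sigma> (\<lambda>x. (p x - p q) * h x)"
      by (rule Bochner_Integration.integrable_bound[OF ic]) (use bd \<epsilon> B in \<open>auto simp: abs_mult elim: eventually_mono\<close>)
    have "(\<integral>x. h x \<partial>density ?\<sigma> (\<lambda>x. ennreal (p x))) = (\<integral>x. p x * h x \<partial>?\<sigma>)"
      by (subst integral_density) (auto simp: p0)
    also have "\<dots> = (\<integral>x. (p x - p q) * h x + p q * h x \<partial>?\<sigma>)"
      by (intro Bochner_Integration.integral_cong) (auto simp: algebra_simps)
    also have "\<dots> = (\<integral>x. (p x - p q) * h x \<partial>?\<sigma>) + p q * (\<integral>x. h x \<partial>?\<sigma>)"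
      using id ih by simp
    finally have "\<bar>(\<integral>x. h x \<partial>density ?\<sigma> (\<lambda>x. ennreal (p x))) - p q * (\<integral>x. h x \<partial>?\<sigma>)\<bar> = \<bar>\<integral>x. (p x - p q) * h x \<partial>?\<sigma>\<bar>"
      by simp
    also have "\<dots> \<le> (\<integral>x. \<bar>(p x - p q) * h x\<bar> \<partial>?\<sigma>)" by (rule integral_abs_bound)
    also have "\<dots> \<le> (\<integral>x. \<epsilon> * B * indicator (cap q t) x \<partial>?\<sigma>)"
      using id ic bd by (intro integral_mono_AE) auto
    also have "\<dots> = \<epsilon> * B * measure ?\<sigma> (cap q t)" by simp
    finally show "\<bar>(\<integral>x. h x \<partial>density ?\<sigma> (\<lambda>x. ennreal (p x))) - p q * (\<integral>x. h x \<partial>?\<sigma>)\<bar> \<le> \<epsilon> * B * measure ?\<sigma> (cap q t)" .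
  qed
qed

text \<open>The scale is tuned so that the scaled height raised to \<open>\<gamma>\<close> equals
  \<open>s powr \<gamma> / (C * real n)\<close>; the prefactor \<open>n\<close> then cancels
  exactly.\<close>

lemma scaled_limit:
  fixes f :: "real \<Rightarrow> real"
  assumes f: "((\<lambda>t. f t / t powr \<gamma>) \<longlongrightarrow> c) (at_right 0)" and \<gamma>: "\<gamma> > 0" and C: "C > 0" and s: "s > 0"
  shows "(\<lambda>n. real n * f (s / (C * real n) powr (1 / \<gamma>))) \<longlonglongrightarrow> c * s powr \<gamma> / C"
proof -
  let ?a = "\<lambda>n. (C * real n) powr (1 / \<gamma>)"
  have ev: "\<forall>\<^sub>F n in sequentially. n > (0::nat)" by (rule eventually_gt_at_top)
  have "filterlim (\<lambda>n. C * real n) at_top sequentially"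
    by (rule filterlim_tendsto_pos_mult_at_top[OF tendsto_const C filterlim_real_sequentially])
  then have "filterlim ?a at_top sequentially"
    using \<gamma> by (intro filterlim_compose[OF real_powr_at_top]) auto
  then have z: "(\<lambda>n. s / ?a n) \<longlonglongrightarrow> 0"
    by (intro real_tendsto_divide_at_top[OF tendsto_const])
  have "filterlim (\<lambda>n. s / ?a n) (at_right 0) sequentially"
  proof -
    have "\<forall>\<^sub>F n in sequentially. s / ?a n \<in> {0<..} \<and> s / ?a n \<noteq> 0"
      using ev by eventually_elim (use s C in simp)
    with z show ?thesis by (simp add: filterlim_at)
  qed
  then have l: "(\<lambda>n. f (s / ?a n) / (s / ?a n) powr \<gamma>) \<longlonglongrightarrow> c"
    using f by (rule filterlim_compose[rotated])
  have "(\<lambda>n. f (s / ?a n) / (s / ?a n) powr \<gamma> * (s powr \<gamma> / C)) \<longlonglongrightarrow> c * (s powr \<gamma> / C)"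
    by (intro tendsto_mult l tendsto_const)
  moreover have "\<forall>\<^sub>F n in sequentially. f (s / ?a n) / (s / ?a n) powr \<gamma> * (s powr \<gamma> / C) = real n * f (s / ?a n)"
    using ev
  proof eventually_elim
    case (elim n)
    then have "(s / ?a n) powr \<gamma> = s powr \<gamma> / (C * real n)"
      using C s \<gamma> by (simp add: powr_divide powr_powr)
    then show ?case using C s elim by simp
  qed
  ultimately show ?thesis by (simp add: tendsto_cong)
qed

section \<open>Attention concentrates on the nearest point\<close>

lemma norm_diff_unit:
  fixes q x :: "'a::real_inner"
  assumes "norm q = 1" "norm x = 1"
  shows "norm (x - q) = sqrt (2 * (1 - q \<bullet> x))"
proof -
  have "q \<bullet> q = 1" "x \<bullet> x = 1" using assms by (auto simp: norm_eq_1)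
  then show ?thesis
    by (simp add: norm_eq_sqrt_inner inner_diff_left inner_diff_right inner_commute[of x q])
qed

lemma inner_unit_bounds:
  fixes q x :: "'a::real_inner"
  assumes "norm q = 1" "norm x = 1"
  shows "0 \<le> 1 - q \<bullet> x" "1 - q \<bullet> x \<le> 2"
  using Cauchy_Schwarz_ineq2[of q x] assms by (auto simp: abs_le_iff)

text \<open>With \<open>T = 1 - q \<bullet> x\<close> and
  \<open>r = sqrt (2 * T - T\<^sup>2)\<close>, the displacement \<open>x - q\<close> is
  \<open>r\<close> times the tangential direction minus \<open>T\<close> times \<open>q\<close>.
  Dropping the radial part and replacing \<open>r\<close> by \<open>sqrt (2 * T)\<close> each cost
  at most \<open>T\<close>. After scaling, the error is small as soon as \<open>a * T\<close> is
  bounded and \<open>a\<close> is large.\<close>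

lemma tdir_approx:
  fixes q x :: "'a::euclidean_space"
  assumes n: "norm q = 1" "norm x = 1" and T: "0 < 1 - q \<bullet> x" "1 - q \<bullet> x < 2" and a: "a > 0"
  shows "norm (sqrt a *\<^sub>R (x - q) - sqrt (2 * (a * (1 - q \<bullet> x))) *\<^sub>R tdir q x) \<le> 2 * (a * (1 - q \<bullet> x)) / sqrt a"
proof -
  define T r where "T = 1 - q \<bullet> x" and "r = norm (x - (q \<bullet> x) *\<^sub>R q)"
  have T01: "0 < T" "T < 2" using T by (auto simp: T_def)
  have r: "r = sqrt (2 * T - T\<^sup>2)"
    using norm_tangential_part[OF n] unfolding r_def T_def by (metis norm_ge_zero real_sqrt_unique)
  have T2: "T\<^sup>2 \<le> 2 * T" using T01 by (simp add: power2_eq_square mult_right_mono)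
  have "0 < T * (2 - T)" using T01 by simp
  then have rpos: "r > 0" unfolding r by (simp add: power2_eq_square algebra_simps)
  have dec: "x - q = r *\<^sub>R tdir q x - T *\<^sub>R q"
    using rpos by (simp add: tdir_def r_def[symmetric] T_def algebra_simps)
  have td: "norm (tdir q x) = 1"
    using tdir_in_tangent_sphere[OF n T] by (simp add: tangent_sphere_def)
  have "sqrt a *\<^sub>R (x - q) - sqrt (2 * (a * T)) *\<^sub>R tdir q x
      = (sqrt a * r - sqrt (2 * (a * T))) *\<^sub>R tdir q x - (sqrt a * T) *\<^sub>R q"
    unfolding dec by (simp add: algebra_simps)
  then have "norm (sqrt a *\<^sub>R (x - q) - sqrt (2 * (a * T)) *\<^sub>R tdir q x)
      \<le> \<bar>sqrt a * r - sqrt (2 * (a * T))\<bar> + sqrt a * T"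
    using norm_triangle_ineq4[of "(sqrt a * r - sqrt (2 * (a * T))) *\<^sub>R tdir q x" "(sqrt a * T) *\<^sub>R q"] td n T01 a
    by (simp add: abs_mult)
  also have "\<bar>sqrt a * r - sqrt (2 * (a * T))\<bar> \<le> sqrt a * T"
  proof -
    have "2 * (a * T) = a * (2 * T)" by simp
    then have e: "sqrt (2 * (a * T)) = sqrt a * sqrt (2 * T)" by (simp only: real_sqrt_mult)
    have "sqrt (2 * T) \<le> sqrt (2 * T - T\<^sup>2) + sqrt (T\<^sup>2)"
      using sqrt_add_le_add_sqrt[of "2 * T - T\<^sup>2" "T\<^sup>2"] T2 by simp
    then have "sqrt (2 * T) - r \<le> T" using T01 by (simp add: r)
    moreover have "r \<le> sqrt (2 * T)" unfolding r by simp
    ultimately have "\<bar>r - sqrt (2 * T)\<bar> \<le> T" by simp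
    moreover have "sqrt a * r - sqrt (2 * (a * T)) = sqrt a * (r - sqrt (2 * T))" by (simp only: e right_diff_distrib)
    ultimately show ?thesis using a by (simp add: abs_mult)
  qed
  also have "sqrt a * T + sqrt a * T = 2 * (a * T) / sqrt a"
    using a by (simp add: field_simps)
  finally show ?thesis by (simp add: T_def)
qed

text \<open>Every competitor lies at least \<open>\<delta>\<close> above the minimiser on the scale \<open>a (1 - q \<bullet> x)\<close>; half of the
  exponential decay absorbs the length of the displacement.\<close>
lemma softmax_argmin_approx:
  fixes x :: "nat \<Rightarrow> 'a::real_inner"
  assumes i: "i < n" and q: "norm q = 1" and x: "\<And>j. j < n \<Longrightarrow> norm (x j) = 1"
    and a: "a > 0" and \<beta>: "\<beta> \<ge> a" and \<delta>: "\<delta> \<ge> 0"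
    and K: "a * (1 - q \<bullet> x i) \<le> K"
    and gap: "\<And>j. j < n \<Longrightarrow> j \<noteq> i \<Longrightarrow> a * (1 - q \<bullet> x i) + \<delta> \<le> a * (1 - q \<bullet> x j)"
  defines "w \<equiv> \<lambda>j. exp (- \<beta> * (1 - q \<bullet> x j)) / (\<Sum>l<n. exp (- \<beta> * (1 - q \<bullet> x l)))"
  shows "norm (sqrt a *\<^sub>R (\<Sum>j<n. w j *\<^sub>R (x j - q)) - sqrt a *\<^sub>R (x i - q))
    \<le> 4 * exp (K - (\<beta> / a - 1) * \<delta>) * (\<Sum>j<n. exp (- (a * (1 - q \<bullet> x j)) / 2))"
proof -
  define Z where "Z = (\<Sum>l<n. exp (- \<beta> * (1 - q \<bullet> x l)))"
  have Zi: "exp (- \<beta> * (1 - q \<bullet> x i)) \<le> Z" unfolding Z_def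
    using i by (intro member_le_sum) auto
  then have Zpos: "Z > 0" using exp_gt_zero order_less_le_trans by blast
  have w0: "w j \<ge> 0" for j using Zpos by (simp add: w_def Z_def)
  have w1: "(\<Sum>j<n. w j) = 1"
    using Zpos unfolding w_def Z_def[symmetric] by (simp add: sum_divide_distrib[symmetric]) (simp add: Z_def)
  \<comment> \<open>As the weights sum to 1, the difference is an average of
    \<open>x j - x i\<close>, to which \<open>j = i\<close> contributes nothing.\<close>
  have "sqrt a *\<^sub>R (\<Sum>j<n. w j *\<^sub>R (x j - q)) - sqrt a *\<^sub>R (x i - q)
      = sqrt a *\<^sub>R ((\<Sum>j<n. w j *\<^sub>R (x j - q)) - (\<Sum>j<n. w j) *\<^sub>R (x i - q))"
    by (simp add: w1 scaleR_diff_right)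
  also have "\<dots> = (\<Sum>j<n. (sqrt a * w j) *\<^sub>R (x j - x i))"
    by (simp add: scaleR_sum_left scaleR_sum_right sum_subtractf[symmetric] scaleR_diff_right[symmetric])
  finally have "norm (sqrt a *\<^sub>R (\<Sum>j<n. w j *\<^sub>R (x j - q)) - sqrt a *\<^sub>R (x i - q))
     \<le> (\<Sum>j<n. norm ((sqrt a * w j) *\<^sub>R (x j - x i)))" by (simp only: norm_sum)
  also have "\<dots> \<le> (\<Sum>j<n. 4 * exp (K - (\<beta> / a - 1) * \<delta>) * exp (- (a * (1 - q \<bullet> x j)) / 2))"
  proof (intro sum_mono)
    fix j assume "j \<in> {..<n}"
    then have j: "j < n" by simp
    show "norm ((sqrt a * w j) *\<^sub>R (x j - x i)) \<le> 4 * exp (K - (\<beta> / a - 1) * \<delta>) * exp (- (a * (1 - q \<bullet> x j)) / 2)"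
    proof (cases "j = i")
      case True
      then show ?thesis by simp
    next
      case False
      define s t where "s = a * (1 - q \<bullet> x j)" and "t = a * (1 - q \<bullet> x i)"
      have st: "t + \<delta> \<le> s" using gap[OF j False] by (simp add: s_def t_def)
      have t0: "0 \<le> t" using inner_unit_bounds(1)[OF q x[OF i]] a by (simp add: t_def)
      have s0: "0 \<le> s" using st t0 \<delta> by simp
      have b1: "\<beta> / a \<ge> 1" using \<beta> a by (simp add: le_divide_eq)
      have wj: "w j \<le> exp (- (\<beta> / a) * (s - t))"
      proof -
        have "w j \<le> exp (- \<beta> * (1 - q \<bullet> x j)) / exp (- \<beta> * (1 - q \<bullet> x i))"
          unfolding w_def Z_def[symmetric] using Zi by (intro divide_left_mono) (auto simp: Zpos)
        also have "\<dots> = exp (- (\<beta> / a) * (s - t))"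
          unfolding exp_diff[symmetric] using a by (simp add: s_def t_def field_simps)
        finally show ?thesis .
      qed
      \<comment> \<open>One unit of the rate \<open>\<beta> / a\<close> is set aside to retain the
        decay \<open>exp (- s)\<close>. The remaining rate meets a height difference of at least
        \<open>\<delta>\<close> and produces the prefactor that vanishes when
        \<open>\<beta> / a\<close> grows.\<close>
      have "- (\<beta> / a) * (s - t) = - (\<beta> / a - 1) * (s - t) - (s - t)" by (simp add: algebra_simps)
      also have "\<dots> \<le> - (\<beta> / a - 1) * \<delta> - (s - K)"
      proof -
        have "(\<beta> / a - 1) * \<delta> \<le> (\<beta> / a - 1) * (s - t)" using b1 st by (intro mult_left_mono) auto
        then show ?thesis using K unfolding mult_minus_left t_def[symmetric] by linarith
      qed
      finally have ex: "w j \<le> exp (K - (\<beta> / a - 1) * \<delta>) * exp (- s)"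
        using wj unfolding exp_add[symmetric] by (smt (verit) exp_le_cancel_iff mult_minus_left)
      have sq: "sqrt (2 * s) \<le> 2 * exp (s / 2)"
      proof (rule real_le_lsqrt)
        have "2 * s \<le> 4 * exp s" using exp_ge_add_one_self[of s] s0 by linarith
        also have "4 * exp s = (2 * exp (s / 2))\<^sup>2" by (simp add: power_mult_distrib exp_double[symmetric])
        finally show "2 * s \<le> (2 * exp (s / 2))\<^sup>2" .
      qed (use s0 in auto)
      have "sqrt a * norm (x j - x i) \<le> sqrt a * (norm (x j - q) + norm (x i - q))"
        using a norm_triangle_ineq4[of "x j - q" "x i - q"] by (intro mult_left_mono) auto
      also have "\<dots> = sqrt (2 * s) + sqrt (2 * t)"
        by (simp only: norm_diff_unit[OF q] x i j s_def t_def distrib_left real_sqrt_mult[symmetric])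
           (simp add: algebra_simps)
      also have "\<dots> \<le> 4 * exp (s / 2)"
      proof -
        have "sqrt (2 * t) \<le> sqrt (2 * s)" using st \<delta> by simp
        with sq show ?thesis by linarith
      qed
      finally have len: "sqrt a * norm (x j - x i) \<le> 4 * exp (s / 2)" .
      have "norm ((sqrt a * w j) *\<^sub>R (x j - x i)) = w j * (sqrt a * norm (x j - x i))"
        using w0 a by (simp add: abs_mult)
      also have "\<dots> \<le> (exp (K - (\<beta> / a - 1) * \<delta>) * exp (- s)) * (4 * exp (s / 2))"
        using a by (intro mult_mono ex len) auto
      also have "\<dots> = 4 * exp (K - (\<beta> / a - 1) * \<delta>) * exp (- s / 2)"
        by (simp add: exp_add[symmetric] mult_exp_exp)
      finally show ?thesis by (simp add: s_def)
    qed
  qed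
  finally show ?thesis by (simp add: sum_distrib_left)
qed

section \<open>Elementary limits and inequalities\<close>

lemma one_minus_power_tendsto:
  fixes x :: "nat \<Rightarrow> real"
  assumes x0: "\<And>n. x n \<ge> 0" and lim: "(\<lambda>n. real n * x n) \<longlonglongrightarrow> L"
  shows "(\<lambda>n. (1 - x n) ^ (n - 1)) \<longlonglongrightarrow> exp (- L)"
proof -
  have "(\<lambda>n. (real n * x n) * (1 / real n)) \<longlonglongrightarrow> L * 0"
    by (intro tendsto_mult lim lim_1_over_n)
  then have "(\<lambda>n. (real n * x n) * (1 / real n)) \<longlonglongrightarrow> 0" by simp
  then have xz: "x \<longlonglongrightarrow> 0"
    by (rule Lim_transform_eventually) (rule eventually_mono[OF eventually_gt_at_top[of 0]], simp)
  have l1: "(\<lambda>n. real (n - 1) * x n) \<longlonglongrightarrow> L"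
  proof -
    have "(\<lambda>n. real n * x n - x n) \<longlonglongrightarrow> L - 0" by (intro tendsto_diff lim xz)
    then have "(\<lambda>n. real n * x n - x n) \<longlonglongrightarrow> L" by simp
    then show ?thesis
      by (rule Lim_transform_eventually)
         (rule eventually_mono[OF eventually_gt_at_top[of 0]], simp add: of_nat_diff algebra_simps)
  qed
  \<comment> \<open>The logarithm of \<open>1 - x\<close> lies between
    \<open>- x - 2 * x\<^sup>2\<close> and \<open>- x\<close> for small \<open>x\<close>. The
    quadratic term is harmless because \<open>n * x n\<close> converges while \<open>x n\<close>
    tends to 0.\<close>
  have l2: "(\<lambda>n. real (n - 1) * (- x n - 2 * (x n)\<^sup>2)) \<longlonglongrightarrow> - L"
  proof -
    have "(\<lambda>n. - (real (n - 1) * x n) - 2 * (real (n - 1) * x n) * x n) \<longlonglongrightarrow> - L - 2 * L * 0"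
      by (intro tendsto_intros l1 xz)
    then show ?thesis by (simp add: power2_eq_square algebra_simps)
  qed
  have ev: "\<forall>\<^sub>F n in sequentially. x n < 1/2" using order_tendstoD(2)[OF xz, of "1/2"] by simp
  have "(\<lambda>n. real (n - 1) * ln (1 - x n)) \<longlonglongrightarrow> - L"
  proof (rule tendsto_sandwich[OF _ _ l2])
    show "\<forall>\<^sub>F n in sequentially. real (n - 1) * (- x n - 2 * (x n)\<^sup>2) \<le> real (n - 1) * ln (1 - x n)"
      using ev by eventually_elim (use x0 in \<open>auto intro!: mult_left_mono ln_one_minus_pos_lower_bound simp: less_imp_le\<close>)
    show "\<forall>\<^sub>F n in sequentially. real (n - 1) * ln (1 - x n) \<le> - (real (n - 1) * x n)"
      using ev
    proof eventually_elim
      case (elim n)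
      have "ln (1 - x n) \<le> - x n" using ln_le_minus_one[of "1 - x n"] elim by simp
      then have "real (n - 1) * ln (1 - x n) \<le> real (n - 1) * (- x n)" by (intro mult_left_mono) auto
      then show ?case by simp
    qed
    show "(\<lambda>n. - (real (n - 1) * x n)) \<longlonglongrightarrow> - L" by (intro tendsto_minus l1)
  qed
  then have "(\<lambda>n. exp (real (n - 1) * ln (1 - x n))) \<longlonglongrightarrow> exp (- L)" by (rule tendsto_exp)
  then show ?thesis
  proof (rule Lim_transform_eventually)
    show "\<forall>\<^sub>F n in sequentially. exp (real (n - 1) * ln (1 - x n)) = (1 - x n) ^ (n - 1)"
      using ev by eventually_elim (simp add: exp_of_nat_mult)
  qed
qed

lemma sqrt_diff_le:
  assumes "0 \<le> s" "s \<le> t" shows "\<bar>sqrt t - sqrt s\<bar> \<le> sqrt (t - s)"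
  using sqrt_add_le_add_sqrt[of s "t - s"] assms by simp

lemma grid_cell_exists:
  fixes r \<delta> :: real
  assumes "0 < r" "r \<le> real m * \<delta>" "\<delta> > 0"
  obtains k where "k < m" "real k * \<delta> < r" "r \<le> (real k + 1) * \<delta>"
proof -
  \<comment> \<open>The ceiling minus one fits cells that are open below and closed above;
    \<open>r > 0\<close> makes the ceiling at least 1.\<close>
  define k where "k = nat (\<lceil>r / \<delta>\<rceil> - 1)"
  have "r / \<delta> > 0" using assms by simp
  then have c: "\<lceil>r / \<delta>\<rceil> \<ge> 1" by linarith
  then have k: "real k = of_int \<lceil>r / \<delta>\<rceil> - 1" by (simp add: k_def)
  have "r / \<delta> \<le> real m" using assms by (simp add: divide_le_eq)
  then have "real k < real m" unfolding k by linarith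
  then have "k < m" by simp
  moreover have "real k < r / \<delta>" "r / \<delta> \<le> real k + 1" unfolding k by linarith+
  then have "real k * \<delta> < r" "r \<le> (real k + 1) * \<delta>" using assms by (auto simp: field_simps)
  ultimately show ?thesis by (rule that)
qed

text \<open>\<open>R\<close> is real and \<open>\<Theta>\<close> is a vector, so their independence
  is stated through generated sigma-algebras. Composition with functions into a common type leads
  back to \<open>indep_var\<close> and its product rule, because it only shrinks these
  sigma-algebras.\<close>

lemma (in prob_space) indep_var_compose_distinct_types:
  assumes ind: "indep_set
      (sigma_sets (space M) {X -` A \<inter> space M | A. A \<in> sets K})
      (sigma_sets (space M) {Y -` A \<inter> space M | A. A \<in> sets L})"
    and m: "X \<in> measurable M K" "Y \<in> measurable M L" "f \<in> measurable K S" "g \<in> measurable L T"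
  shows "indep_var S (\<lambda>\<omega>. f (X \<omega>)) T (\<lambda>\<omega>. g (Y \<omega>))"
proof -
  have sub: "sigma_sets (space M) {(\<lambda>\<omega>. f (X \<omega>)) -` A \<inter> space M | A. A \<in> sets S}
      \<subseteq> sigma_sets (space M) {X -` A \<inter> space M | A. A \<in> sets K}"
    if m: "X \<in> measurable M K" "f \<in> measurable K S" for X :: "'a \<Rightarrow> 'x" and f :: "'x \<Rightarrow> 'y" and K S
  proof (rule sigma_sets_mono', safe)
    fix A assume A: "A \<in> sets S"
    have "(\<lambda>\<omega>. f (X \<omega>)) -` A \<inter> space M = X -` (f -` A \<inter> space K) \<inter> space M"
      using measurable_space[OF m(1)] by auto
    then show "\<exists>B. (\<lambda>\<omega>. f (X \<omega>)) -` A \<inter> space M = X -` B \<inter> space M \<and> B \<in> sets K"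
      using measurable_sets[OF m(2) A] by blast
  qed
  have "indep_set (sigma_sets (space M) {(\<lambda>\<omega>. f (X \<omega>)) -` A \<inter> space M | A. A \<in> sets S})
      (sigma_sets (space M) {(\<lambda>\<omega>. g (Y \<omega>)) -` A \<inter> space M | A. A \<in> sets T})"
    using ind unfolding indep_set_def
    by (rule indep_sets_mono_sets) (auto split: bool.split intro: subsetD[OF sub[OF m(1,3)]] subsetD[OF sub[OF m(2,4)]])
  then show ?thesis
    using m by (auto simp: indep_var_eq intro: measurable_compose)
qed

text \<open>A Riemann sum for the limit law: inside a cell the radius is frozen at the left end
  point, at the cost \<open>\<epsilon>\<close>; values of \<open>R\<close> beyond the last cell cost
  \<open>B\<close> times the tail; independence factors each cell term.\<close>

lemma limit_law_upper_bound:
  fixes R :: "'t \<Rightarrow> real" and \<Theta> :: "'t \<Rightarrow> 'a::euclidean_space" and f :: "'a \<Rightarrow> real"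
  assumes "prob_space N" and Rm[measurable]: "R \<in> borel_measurable N" and \<Theta>m[measurable]: "\<Theta> \<in> borel_measurable N"
    and ind: "prob_space.indep_set N
      (sigma_sets (space N) {R -` A \<inter> space N | A. A \<in> sets borel})
      (sigma_sets (space N) {\<Theta> -` A \<inter> space N | A. A \<in> sets borel})"
    and tail: "\<And>r. r \<ge> 0 \<Longrightarrow> measure N {\<omega>\<in>space N. R \<omega> > r} = exp (- (r powr \<gamma>))"
    and \<Theta>1: "AE \<omega> in N. norm (\<Theta> \<omega>) = 1"
    and f: "continuous_on UNIV f" "\<And>x. 0 \<le> f x" "\<And>x. f x \<le> B"
    and \<delta>: "\<delta> > 0" "sqrt (2 * \<delta>) < \<eta>" and \<epsilon>: "\<epsilon> \<ge> 0"
    and uc: "\<And>u v. norm u \<le> sqrt (2 * (real m * \<delta>)) \<Longrightarrow> dist u v < \<eta> \<Longrightarrow> \<bar>f u - f v\<bar> \<le> \<epsilon>"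
  shows "(\<integral>\<omega>. f (sqrt (2 * R \<omega>) *\<^sub>R \<Theta> \<omega>) \<partial>N)
    \<le> (\<Sum>k<m. (exp (- ((real k * \<delta>) powr \<gamma>)) - exp (- (((real k + 1) * \<delta>) powr \<gamma>)))
        * (\<integral>\<theta>. f (sqrt (2 * (real k * \<delta>)) *\<^sub>R \<theta>) \<partial>distr N borel \<Theta>))
      + \<epsilon> + B * exp (- ((real m * \<delta>) powr \<gamma>))"
proof -
  interpret prob_space N by fact
  have fm[measurable]: "f \<in> borel_measurable borel" using f(1) by (rule borel_measurable_continuous_onI)
  have B: "B \<ge> 0" using f(2,3)[of 0] by linarith
  let ?I = "\<lambda>k::nat. {real k * \<delta> <.. (real k + 1) * \<delta>}"
  define g where "g k \<theta> = f (sqrt (2 * (real k * \<delta>)) *\<^sub>R \<theta>)" for k :: nat and \<theta>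
  have gm[measurable]: "g k \<in> borel_measurable borel" for k unfolding g_def by measurable
  have gB: "0 \<le> g k \<theta>" "g k \<theta> \<le> B" for k \<theta> using f by (auto simp: g_def)
  \<comment> \<open>The cells do not contain 0. The tail formula at \<open>r = 0\<close> gives
    probability 1 because \<open>0 powr \<gamma>\<close> is 0.\<close>
  have posR: "AE \<omega> in N. R \<omega> > 0"
  proof -
    have "prob {\<omega>\<in>space N. R \<omega> > 0} = 1" using tail[of 0] by simp
    then show ?thesis by (subst (asm) prob_Collect_eq_1) auto
  qed
  have ig: "integrable N (\<lambda>\<omega>. g k (\<Theta> \<omega>))" for k
    by (rule integrable_const_bound[of _ B]) (use gB in auto)
  have iI: "integrable N (\<lambda>\<omega>. indicator A (R \<omega>) :: real)" if [measurable]: "A \<in> sets borel" for A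
    by (rule integrable_const_bound[of _ 1]) (auto simp: indicator_def)
  have iIg: "integrable N (\<lambda>\<omega>. indicator (?I k) (R \<omega>) * g k (\<Theta> \<omega>))" for k
    by (rule integrable_const_bound[of _ B]) (use gB B in \<open>auto simp: indicator_def\<close>)
  have prI: "(\<integral>\<omega>. indicator {r<..} (R \<omega>) \<partial>N) = exp (- (r powr \<gamma>))" if "r \<ge> 0" for r
  proof -
    have "(\<integral>\<omega>. indicator {r<..} (R \<omega>) \<partial>N) = (\<integral>\<omega>. indicator {\<omega>\<in>space N. R \<omega> > r} \<omega> \<partial>N :: real)"
      by (intro Bochner_Integration.integral_cong) (auto simp: indicator_def)
    then show ?thesis using tail[OF that] by simp
  qed
  have EI: "(\<integral>\<omega>. indicator (?I k) (R \<omega>) \<partial>N) = exp (- ((real k * \<delta>) powr \<gamma>)) - exp (- (((real k + 1) * \<delta>) powr \<gamma>))" for k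
  proof -
    have "(\<integral>\<omega>. indicator (?I k) (R \<omega>) \<partial>N) = (\<integral>\<omega>. indicator {real k * \<delta><..} (R \<omega>) - indicator {(real k + 1) * \<delta><..} (R \<omega>) \<partial>N :: real)"
      using \<delta> by (intro Bochner_Integration.integral_cong) (auto simp: indicator_def algebra_simps)
    also have "\<dots> = exp (- ((real k * \<delta>) powr \<gamma>)) - exp (- (((real k + 1) * \<delta>) powr \<gamma>))"
      using \<delta> by (subst Bochner_Integration.integral_diff) (auto simp: iI prI)
    finally show ?thesis .
  qed
  have EIg: "(\<integral>\<omega>. indicator (?I k) (R \<omega>) * g k (\<Theta> \<omega>) \<partial>N)
     = (exp (- ((real k * \<delta>) powr \<gamma>)) - exp (- (((real k + 1) * \<delta>) powr \<gamma>))) * (\<integral>\<theta>. g k \<theta> \<partial>distr N borel \<Theta>)" for k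
  proof -
    have iv: "indep_var borel (\<lambda>\<omega>. indicator (?I k) (R \<omega>) :: real) borel (\<lambda>\<omega>. g k (\<Theta> \<omega>))"
      by (rule indep_var_compose_distinct_types[OF ind]) auto
    have "(\<integral>\<omega>. indicator (?I k) (R \<omega>) * g k (\<Theta> \<omega>) \<partial>N) = (\<integral>\<omega>. indicator (?I k) (R \<omega>) \<partial>N) * (\<integral>\<omega>. g k (\<Theta> \<omega>) \<partial>N)"
      by (rule indep_var_lebesgue_integral[OF iv]) (auto simp: iI ig)
    then show ?thesis by (simp add: EI integral_distr)
  qed
  define h where "h k \<omega> = indicator (?I k) (R \<omega>) * g k (\<Theta> \<omega>)" for k \<omega>
  have ih: "integrable N (h k)" for k unfolding h_def by (rule iIg)
  note Eh = EIg[folded h_def]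
  have "(\<integral>\<omega>. f (sqrt (2 * R \<omega>) *\<^sub>R \<Theta> \<omega>) \<partial>N)
     \<le> (\<integral>\<omega>. (\<Sum>k<m. h k \<omega>) + \<epsilon> + B * indicator {real m * \<delta><..} (R \<omega>) \<partial>N)"
  proof (rule integral_mono_AE)
    show "integrable N (\<lambda>\<omega>. f (sqrt (2 * R \<omega>) *\<^sub>R \<Theta> \<omega>))"
      by (rule integrable_const_bound[of _ B]) (use f in auto)
    show "integrable N (\<lambda>\<omega>. (\<Sum>k<m. h k \<omega>) + \<epsilon> + B * indicator {real m * \<delta><..} (R \<omega>))"
      by (intro Bochner_Integration.integrable_add Bochner_Integration.integrable_sum integrable_mult_right ih iI) auto
    show "AE \<omega> in N. f (sqrt (2 * R \<omega>) *\<^sub>R \<Theta> \<omega>)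
        \<le> (\<Sum>k<m. h k \<omega>) + \<epsilon> + B * indicator {real m * \<delta><..} (R \<omega>)"
      using posR \<Theta>1
    proof eventually_elim
      case (elim \<omega>)
      have nn: "(\<Sum>k<m. h k \<omega>) \<ge> 0"
        by (intro sum_nonneg) (auto simp: gB h_def)
      show ?case
      proof (cases "R \<omega> \<le> real m * \<delta>")
        case False
        then show ?thesis using nn \<epsilon> f(3)[of "sqrt (2 * R \<omega>) *\<^sub>R \<Theta> \<omega>"] by simp
      next
        case True
        obtain k where k: "k < m" "real k * \<delta> < R \<omega>" "R \<omega> \<le> (real k + 1) * \<delta>"
          using grid_cell_exists[OF elim(1) True \<delta>(1)] by blast
        have "g k (\<Theta> \<omega>) = h k \<omega>" using k by (simp add: h_def)
        also have "\<dots> \<le> (\<Sum>k<m. h k \<omega>)"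
          using k(1) by (intro member_le_sum) (auto simp: gB h_def)
        finally have 1: "g k (\<Theta> \<omega>) \<le> (\<Sum>k<m. h k \<omega>)" .
        have k0: "0 \<le> real k * \<delta>" using \<delta> by simp
        have "dist (sqrt (2 * R \<omega>) *\<^sub>R \<Theta> \<omega>) (sqrt (2 * (real k * \<delta>)) *\<^sub>R \<Theta> \<omega>)
            = \<bar>sqrt (2 * R \<omega>) - sqrt (2 * (real k * \<delta>))\<bar>"
          using elim by (simp add: dist_norm scaleR_diff_left[symmetric])
        also have "\<dots> \<le> sqrt (2 * R \<omega> - 2 * (real k * \<delta>))"
          using k k0 by (intro sqrt_diff_le) auto
        also have "\<dots> \<le> sqrt (2 * \<delta>)" using k by (simp add: algebra_simps)
        also note \<delta>(2)
        finally have "\<bar>f (sqrt (2 * R \<omega>) *\<^sub>R \<Theta> \<omega>) - g k (\<Theta> \<omega>)\<bar> \<le> \<epsilon>"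
          unfolding g_def using True elim by (intro uc) auto
        with 1 True show ?thesis by simp
      qed
    qed
  qed
  also have "\<dots> = (\<Sum>k<m. \<integral>\<omega>. h k \<omega> \<partial>N) + \<epsilon> + B * exp (- ((real m * \<delta>) powr \<gamma>))"
    using prI[of "real m * \<delta>"] \<delta> by (simp add: ih iI prob_space)
  finally show ?thesis by (simp add: Eh g_def)
qed

section \<open>The cell decomposition for a fixed configuration of points\<close>

lemma belt_scaled_iff: "a > 0 \<Longrightarrow> x \<in> belt q (u / a) (v / a) \<longleftrightarrow> u < a * (1 - q \<bullet> x) \<and> a * (1 - q \<bullet> x) \<le> v"
  by (simp add: belt_def field_simps)

lemma cap_scaled_iff: "a > 0 \<Longrightarrow> x \<in> cap q (u / a) \<longleftrightarrow> a * (1 - q \<bullet> x) \<le> u"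
  by (simp add: cap_def field_simps)

lemma prod_indicator_Compl:
  "finite J \<Longrightarrow> (\<Prod>j\<in>J. indicator (- S) (x j)) = (if \<forall>j\<in>J. x j \<notin> S then 1 else 0 :: real)"
  by (auto intro!: prod.neutral simp: prod_zero_iff intro: bexI[rotated])

text \<open>At most one summand is non-zero. For it, the distance to the scaled displacement is made
  of the attention error \<open>E\<close>, the curvature error of \<open>tdir_approx\<close> and the
  cell width, each with a budget of \<open>\<eta> / 3\<close>. If \<open>E\<close> exceeds its
  budget, the subtracted term is at least \<open>B\<close> and the bound is trivial, as in Markov's
  inequality; if no cell event occurs, \<open>f \<ge> 0\<close> suffices.\<close>

lemma softmax_cell_lower_bound:
  fixes x :: "nat \<Rightarrow> 'a::euclidean_space" and f :: "'a \<Rightarrow> real"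
  assumes q: "norm q = 1" and x: "\<And>j. j < n \<Longrightarrow> norm (x j) = 1"
    and a: "a > 0" and \<beta>: "\<beta> \<ge> a" and \<delta>: "\<delta> > 0" "sqrt (2 * \<delta>) < \<eta> / 3"
    and K: "2 * (real m * \<delta>) / sqrt a < \<eta> / 3" "real m * \<delta> / a < 2"
    and f: "\<And>x. 0 \<le> f x" "\<And>x. f x \<le> B" and \<epsilon>: "\<epsilon> \<ge> 0"
    and uc: "\<And>u v. norm u \<le> sqrt (2 * (real m * \<delta>)) \<Longrightarrow> dist u v < \<eta> \<Longrightarrow> \<bar>f u - f v\<bar> \<le> \<epsilon>"
  defines "w \<equiv> \<lambda>j. exp (- \<beta> * (1 - q \<bullet> x j)) / (\<Sum>l<n. exp (- \<beta> * (1 - q \<bullet> x l)))"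
  defines "E \<equiv> 4 * exp (real m * \<delta> - (\<beta> / a - 1) * \<delta>) * (\<Sum>j<n. exp (- (a * (1 - q \<bullet> x j)) / 2))"
  shows "(\<Sum>i<n. \<Sum>k<m. f (sqrt (2 * (real k * \<delta>)) *\<^sub>R tdir q (x i))
        * indicator (belt q (real k * \<delta> / a) ((real k + 1) * \<delta> / a)) (x i)
        * (\<Prod>j\<in>{..<n} - {i}. indicator (- cap q ((real k + 2) * \<delta> / a)) (x j)))
      - \<epsilon> - B * (E / (\<eta> / 3)) \<le> f (sqrt a *\<^sub>R (\<Sum>j<n. w j *\<^sub>R (x j - q)))" (is "?S - \<epsilon> - _ \<le> f ?W")
proof -
  define s where "s j = a * (1 - q \<bullet> x j)" for j
  define P where "P i k \<longleftrightarrow> real k * \<delta> < s i \<and> s i \<le> (real k + 1) * \<delta> \<and> (\<forall>j\<in>{..<n} - {i}. (real k + 2) * \<delta> < s j)" for i and k :: nat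
  define v where "v i k = sqrt (2 * (real k * \<delta>)) *\<^sub>R tdir q (x i)" for i and k :: nat
  have B: "B \<ge> 0" using f[of 0] by linarith
  have "sqrt (2 * \<delta>) > 0" using \<delta> by simp
  then have \<eta>: "\<eta> > 0" using \<delta>(2) by linarith
  have E: "E \<ge> 0" unfolding E_def by (intro mult_nonneg_nonneg sum_nonneg) auto
  have BE: "B * (E / (\<eta> / 3)) \<ge> 0" using B E \<eta> by simp
  have cell: "f (sqrt (2 * (real k * \<delta>)) *\<^sub>R tdir q (x i))
        * indicator (belt q (real k * \<delta> / a) ((real k + 1) * \<delta> / a)) (x i)
        * (\<Prod>j\<in>{..<n} - {i}. indicator (- cap q ((real k + 2) * \<delta> / a)) (x j)) = (if P i k then f (v i k) else 0)" for i k
    by (subst prod_indicator_Compl)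
       (auto simp: P_def v_def s_def belt_scaled_iff[OF a] cap_scaled_iff[OF a] not_le indicator_def)
  have S: "?S = (\<Sum>i<n. \<Sum>k<m. if P i k then f (v i k) else 0)" by (simp only: cell)
  have uniq: "i' = i \<and> k' = k" if P: "P i k" "P i' k'" and i: "i < n" "i' < n" for i i' k k'
  proof (rule ccontr)
    assume ne: "\<not> (i' = i \<and> k' = k)"
    show False
    proof (cases "i' = i")
      case True
      from P True have "real k * \<delta> < (real k' + 1) * \<delta>" "real k' * \<delta> < (real k + 1) * \<delta>"
        unfolding P_def by (auto intro: less_le_trans)
      then have "real k < real k' + 1" "real k' < real k + 1" using \<delta>(1) by simp_all
      then show False using ne True by simp
    next
      case False
      \<comment> \<open>Two different isolated points would each have to lie more than
        \<open>\<delta>\<close> above the other.\<close>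
      then have "(real k + 2) * \<delta> < s i'" "(real k' + 2) * \<delta> < s i" using P i unfolding P_def by auto
      moreover have "s i \<le> (real k + 1) * \<delta>" "s i' \<le> (real k' + 1) * \<delta>" using P unfolding P_def by auto
      ultimately have "(real k + 2) * \<delta> < (real k' + 1) * \<delta>" "(real k' + 2) * \<delta> < (real k + 1) * \<delta>" by linarith+
      then have "real k + 2 < real k' + 1" "real k' + 2 < real k + 1" using \<delta>(1) by simp_all
      then show False by simp
    qed
  qed
  show ?thesis
  proof (cases "\<exists>i<n. \<exists>k<m. P i k")
    case False
    then have "?S = 0" unfolding S by (auto intro!: sum.neutral)
    then show ?thesis using BE \<epsilon> f(1)[of ?W] by linarith
  next
    case True
    then obtain i k where ik: "i < n" "k < m" "P i k" by blast
    have "?S = (\<Sum>i'<n. if i' = i then f (v i k) else 0)"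
      unfolding S
    proof (intro sum.cong refl)
      fix i' assume "i' \<in> {..<n}"
      then have i': "i' < n" by simp
      show "(\<Sum>k'<m. if P i' k' then f (v i' k') else 0) = (if i' = i then f (v i k) else 0)"
      proof (cases "i' = i")
        case True
        have "P i k' \<longleftrightarrow> k' = k" for k' using uniq[OF ik(3) _ ik(1) ik(1)] ik(3) by blast
        then have "(\<Sum>k'<m. if P i' k' then f (v i' k') else 0) = (\<Sum>k'<m. if k' = k then f (v i k') else 0)"
          unfolding True by simp
        then show ?thesis using True ik(2) by simp
      next
        case False
        then have "\<not> P i' k'" for k' using uniq[OF ik(3) _ ik(1) i'] by blast
        then show ?thesis using False by simp
      qed
    qed
    then have S1: "?S = f (v i k)" using ik(1) by simp
    show ?thesis
    proof (cases "E < \<eta> / 3")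
      case False
      then have "1 \<le> E / (\<eta> / 3)" using \<eta> by (simp add: le_divide_eq)
      then have "B * 1 \<le> B * (E / (\<eta> / 3))" using B by (intro mult_left_mono)
      then show ?thesis using S1 f(2)[of "v i k"] f(1)[of ?W] \<epsilon> by linarith
    next
      case True
      have Pik: "real k * \<delta> < s i" "s i \<le> (real k + 1) * \<delta>" "\<And>j. j < n \<Longrightarrow> j \<noteq> i \<Longrightarrow> (real k + 2) * \<delta> < s j"
        using ik(3) by (auto simp: P_def)
      have kd: "0 \<le> real k * \<delta>" using \<delta> by simp
      have km: "(real k + 1) * \<delta> \<le> real m * \<delta>" using ik(2) \<delta> by (intro mult_right_mono) auto
      then have sm: "s i \<le> real m * \<delta>" using Pik by linarith
      have s0: "s i > 0" using Pik(1) kd by linarith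
      have T: "0 < 1 - q \<bullet> x i" "1 - q \<bullet> x i < 2"
      proof -
        show "0 < 1 - q \<bullet> x i" using s0 a unfolding s_def by (simp add: zero_less_mult_iff)
        have "1 - q \<bullet> x i \<le> real m * \<delta> / a" using sm a by (simp add: s_def field_simps)
        then show "1 - q \<bullet> x i < 2" using K by linarith
      qed
      have td: "norm (tdir q (x i)) = 1"
        using tdir_in_tangent_sphere[OF q x[OF ik(1)] T] by (simp add: tangent_sphere_def)
      have d1: "norm (?W - sqrt a *\<^sub>R (x i - q)) \<le> E"
        unfolding w_def E_def
      proof (rule softmax_argmin_approx[OF ik(1) q x a \<beta>])
        show "a * (1 - q \<bullet> x i) \<le> real m * \<delta>" using sm by (simp add: s_def)
        fix j assume "j < n" "j \<noteq> i"
        then have "(real k + 2) * \<delta> < s j" by (rule Pik(3))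
        \<comment> \<open>The empty layer between \<open>(k + 1) * \<delta>\<close> and
          \<open>(k + 2) * \<delta>\<close> is exactly the gap that the attention estimate asks
          for.\<close>
        then show "a * (1 - q \<bullet> x i) + \<delta> \<le> a * (1 - q \<bullet> x j)"
          using Pik(2) unfolding s_def by (simp add: algebra_simps)
      qed (use \<delta> in auto)
      have d2: "norm (sqrt a *\<^sub>R (x i - q) - sqrt (2 * s i) *\<^sub>R tdir q (x i)) < \<eta> / 3"
      proof -
        have "norm (sqrt a *\<^sub>R (x i - q) - sqrt (2 * s i) *\<^sub>R tdir q (x i)) \<le> 2 * s i / sqrt a"
          using tdir_approx[OF q x[OF ik(1)] T a] by (simp add: s_def)
        also have "\<dots> \<le> 2 * (real m * \<delta>) / sqrt a" using sm a by (intro divide_right_mono) auto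
        finally show ?thesis using K(1) by linarith
      qed
      have d3: "norm (sqrt (2 * s i) *\<^sub>R tdir q (x i) - v i k) < \<eta> / 3"
      proof -
        have "norm (sqrt (2 * s i) *\<^sub>R tdir q (x i) - v i k) = \<bar>sqrt (2 * s i) - sqrt (2 * (real k * \<delta>))\<bar>"
          unfolding v_def by (simp add: scaleR_diff_left[symmetric] td)
        also have "\<dots> \<le> sqrt (2 * s i - 2 * (real k * \<delta>))" using kd Pik(1) by (intro sqrt_diff_le) auto
        also have "\<dots> \<le> sqrt (2 * \<delta>)" using Pik(2) by (simp add: algebra_simps)
        finally show ?thesis using \<delta>(2) by linarith
      qed
      have "dist ?W (v i k) < \<eta>"
        using d1 d2 d3 True norm_triangle_ineq[of "?W - sqrt a *\<^sub>R (x i - q)" "sqrt a *\<^sub>R (x i - q) - v i k"]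
          norm_triangle_ineq[of "sqrt a *\<^sub>R (x i - q) - sqrt (2 * s i) *\<^sub>R tdir q (x i)" "sqrt (2 * s i) *\<^sub>R tdir q (x i) - v i k"]
        by (simp add: dist_norm)
      moreover have "norm (v i k) \<le> sqrt (2 * (real m * \<delta>))"
      proof -
        have "real k * \<delta> \<le> real m * \<delta>" using ik(2) \<delta> by (intro mult_right_mono) auto
        then show ?thesis unfolding v_def using td kd by simp
      qed
      ultimately have "\<bar>f (v i k) - f ?W\<bar> \<le> \<epsilon>" by (intro uc) (auto simp: dist_commute)
      then show ?thesis using S1 BE by linarith
    qed
  qed
qed

section \<open>Limits for samples on the sphere\<close>

text \<open>\<open>p\<close> stands for the density extended by 0 off the sphere, which makes sign
  and measurability global. \<open>p_cont\<close> is continuity at \<open>q\<close> along the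
  sphere, measured by the height, in the form that integrals over caps use.\<close>

locale sphere_sample = prob_space M for M :: "'s measure" +
  fixes X :: "nat \<Rightarrow> 's \<Rightarrow> real ^ 'n" and q :: "real ^ 'n" and p :: "real ^ 'n \<Rightarrow> real"
  assumes dim: "CARD('n) \<ge> 2" and q1: "norm q = 1"
    and p_borel: "p \<in> borel_measurable borel" and p_nonneg: "\<And>x. p x \<ge> 0" and p_pos: "p q > 0"
    and p_cont: "\<And>\<epsilon>. \<epsilon> > 0 \<Longrightarrow> \<exists>t>0. \<forall>x\<in>sphere 0 1. 1 - q \<bullet> x \<le> t \<longrightarrow> \<bar>p x - p q\<bar> \<le> \<epsilon>"
    and indep: "indep_vars (\<lambda>_. borel) X UNIV"
    and distr_X: "\<And>i. distr M borel (X i) = density sphere_surface_measure (\<lambda>x. ennreal (p x))"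
begin

declare p_borel[measurable]

abbreviation "\<sigma> \<equiv> sphere_surface_measure :: (real ^ 'n) measure"

definition law :: "(real ^ 'n) measure" where
  "law = density \<sigma> (\<lambda>x. ennreal (p x))"

text \<open>In the notation of the theorem, \<open>\<gamma>\<close> is \<open>1 / \<alpha>\<close>,
  the product \<open>c\<^sub>0 * p q\<close> is \<open>C(q)\<close>, and \<open>zoom n\<close> is
  \<open>a\<^sub>n\<close>.\<close>

definition "\<gamma> = (real CARD('n) - 1) / 2"

definition "c\<^sub>0 = 2 powr \<gamma> * sphere_area (CARD('n) - 2) / (real CARD('n) - 1)"

definition zoom :: "nat \<Rightarrow> real" where "zoom n = (c\<^sub>0 * p q * real n) powr (1 / \<gamma>)"

lemma X_borel[measurable]: "X i \<in> borel_measurable M"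
  using indep by (auto simp: indep_vars_def)

lemma law_eq: "distr M borel (X i) = law"
  by (simp add: law_def distr_X)

lemma sets_law[simp, measurable_cong]: "sets law = sets borel"
  by (simp add: law_def)

lemma space_law[simp]: "space law = UNIV"
  by (simp add: law_def)

sublocale law: prob_space law
  using prob_space_distr[OF X_borel[of 0]] by (simp add: law_eq)

sublocale \<sigma>: finite_measure \<sigma>
  by (rule finite_sphere_surface_measure)

lemma \<gamma>_pos: "\<gamma> > 0"
  using dim by (simp add: \<gamma>_def)

lemma c\<^sub>0_pos: "c\<^sub>0 > 0"
  using dim unfolding c\<^sub>0_def sphere_area_def
  by (intro divide_pos_pos mult_pos_pos Gamma_real_pos) auto

lemma zoom_pos: "n > 0 \<Longrightarrow> zoom n > 0"
  using c\<^sub>0_pos p_pos by (simp add: zoom_def)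

lemma zoom_powr: "zoom n powr \<gamma> = c\<^sub>0 * p q * real n"
  using c\<^sub>0_pos p_pos \<gamma>_pos by (simp add: zoom_def powr_powr)

lemma zoom_at_top: "filterlim zoom at_top sequentially"
proof -
  have "filterlim (\<lambda>n. (c\<^sub>0 * p q) * real n) at_top sequentially"
    using c\<^sub>0_pos p_pos by (intro filterlim_tendsto_pos_mult_at_top[OF tendsto_const _ filterlim_real_sequentially]) auto
  then show ?thesis
    unfolding zoom_def[abs_def] using \<gamma>_pos by (intro filterlim_compose[OF real_powr_at_top]) auto
qed

lemma AE_law: "AE x in law. norm x = 1"
  unfolding law_def using AE_sphere_surface_measure
  by (subst AE_density) (auto simp: p_borel elim!: eventually_mono)

lemma AE_unit: "AE \<omega> in M. \<forall>j. norm (X j \<omega>) = 1"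
proof (subst AE_all_countable, intro allI)
  fix j
  have "AE x in distr M borel (X j). norm x = 1" unfolding law_eq by (rule AE_law)
  then show "AE \<omega> in M. norm (X j \<omega>) = 1" by (subst (asm) AE_distr_iff) auto
qed

lemma expectation_X:
  "h \<in> borel_measurable borel \<Longrightarrow> expectation (\<lambda>\<omega>. h (X i \<omega>)) = (\<integral>x. h x \<partial>law)" for h :: "_ \<Rightarrow> real"
  by (subst law_eq[symmetric, of i]) (simp add: integral_distr)

section \<open>Mean counts of sample points near the query\<close>

lemma \<sigma>_cap_asymp: "((\<lambda>t. measure \<sigma> (cap q t) / t powr \<gamma>) \<longlongrightarrow> c\<^sub>0) (at_right 0)"
  unfolding c\<^sub>0_def \<gamma>_def by (rule measure_cap_asymp[OF q1 dim])

text \<open>The cap of height 0 lies in every cap of positive height, and their measures tend to 0.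
  The case matters because the lowest cell starts at height 0.\<close>

lemma \<sigma>_cap_0: "measure \<sigma> (cap q 0) = 0"
proof -
  have "((\<lambda>t. measure \<sigma> (cap q t) / t powr \<gamma> * t powr \<gamma>) \<longlongrightarrow> c\<^sub>0 * 0) (at_right 0)"
    using \<gamma>_pos by (intro tendsto_mult \<sigma>_cap_asymp) real_asymp
  moreover have "\<forall>\<^sub>F t in at_right 0. measure \<sigma> (cap q 0) \<le> measure \<sigma> (cap q t) / t powr \<gamma> * t powr \<gamma>"
    using eventually_at_right_less[of 0]
    by eventually_elim (auto simp: cap_def intro!: \<sigma>.finite_measure_mono cap_borel[unfolded cap_def])
  ultimately have "measure \<sigma> (cap q 0) \<le> c\<^sub>0 * 0" by (rule tendsto_lowerbound) simp
  then show ?thesis using measure_nonneg[of \<sigma> "cap q 0"] by simp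
qed

lemma law_cap_0: "measure law (cap q 0) = 0"
proof -
  obtain t0 where "t0 > 0" and t0: "\<And>t h B. t \<le> t0 \<Longrightarrow> h \<in> borel_measurable borel \<Longrightarrow> (\<And>x. \<bar>h x\<bar> \<le> B * indicator (cap q t) x) \<Longrightarrow> B \<ge> 0 \<Longrightarrow>
      \<bar>(\<integral>x. h x \<partial>law) - p q * (\<integral>x. h x \<partial>\<sigma>)\<bar> \<le> 1 * B * measure \<sigma> (cap q t)"
    using density_cap_approx[OF p_borel p_nonneg p_cont, of 1] unfolding law_def by auto
  from t0[of 0 "indicator (cap q 0)" 1] \<open>t0 > 0\<close> have "measure law (cap q 0) \<le> 0" by (simp add: \<sigma>_cap_0)
  then show ?thesis using measure_nonneg[of law "cap q 0"] by linarith
qed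

lemma \<sigma>_cap_limit:
  assumes "s \<ge> 0" shows "(\<lambda>n. real n * measure \<sigma> (cap q (s / zoom n))) \<longlonglongrightarrow> s powr \<gamma> / p q"
proof (cases "s = 0")
  case True
  then show ?thesis by (simp add: \<sigma>_cap_0)
next
  case False
  then have "(\<lambda>n. real n * measure \<sigma> (cap q (s / zoom n))) \<longlonglongrightarrow> c\<^sub>0 * s powr \<gamma> / (c\<^sub>0 * p q)"
    unfolding zoom_def using assms c\<^sub>0_pos p_pos by (intro scaled_limit[OF \<sigma>_cap_asymp \<gamma>_pos]) auto
  then show ?thesis using c\<^sub>0_pos by simp
qed

text \<open>After multiplication by \<open>n\<close>, the error of \<open>density_cap_approx\<close>
  is \<open>\<epsilon> * B\<close> times a convergent sequence, and \<open>\<epsilon>\<close> is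
  free.\<close>

lemma law_compare_limit:
  assumes h: "\<And>n. h n \<in> borel_measurable borel" "\<And>n x. \<bar>h n x\<bar> \<le> B * indicator (cap q (s / zoom n)) x"
    and B: "B \<ge> 0" and s: "s > 0"
  shows "(\<lambda>n. real n * (\<integral>x. h n x \<partial>law) - p q * (real n * (\<integral>x. h n x \<partial>\<sigma>))) \<longlonglongrightarrow> 0"
proof (rule LIMSEQ_I)
  fix r :: real assume r: "r > 0"
  define L where "L = s powr \<gamma> / p q + 1"
  have L: "L > 0" using p_pos by (simp add: L_def add_nonneg_pos)
  \<comment> \<open>Chosen so that \<open>\<epsilon> * (B + 1) * L = r\<close>; using
    \<open>B + 1\<close> covers \<open>B = 0\<close> and makes the final inequality strict.\<close>
  define \<epsilon> where "\<epsilon> = r / ((B + 1) * L)"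
  have \<epsilon>: "\<epsilon> > 0" using r B L by (simp add: \<epsilon>_def)
  obtain t0 where "t0 > 0" and t0: "\<And>t h B. t \<le> t0 \<Longrightarrow> h \<in> borel_measurable borel \<Longrightarrow> (\<And>x. \<bar>h x\<bar> \<le> B * indicator (cap q t) x) \<Longrightarrow> B \<ge> 0 \<Longrightarrow>
      \<bar>(\<integral>x. h x \<partial>law) - p q * (\<integral>x. h x \<partial>\<sigma>)\<bar> \<le> \<epsilon> * B * measure \<sigma> (cap q t)"
    using density_cap_approx[OF p_borel p_nonneg p_cont \<epsilon>] unfolding law_def by auto
  have e1: "\<forall>\<^sub>F n in sequentially. s / zoom n \<le> t0"
  proof -
    have "(\<lambda>n. s / zoom n) \<longlonglongrightarrow> 0" by (intro real_tendsto_divide_at_top[OF tendsto_const] zoom_at_top)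
    from order_tendstoD(2)[OF this \<open>t0 > 0\<close>] show ?thesis by (auto elim: eventually_mono)
  qed
  have e2: "\<forall>\<^sub>F n in sequentially. real n * measure \<sigma> (cap q (s / zoom n)) < L"
    using order_tendstoD(2)[OF \<sigma>_cap_limit[of s], of L] s by (simp add: L_def)
  have "\<forall>\<^sub>F n in sequentially. norm (real n * (\<integral>x. h n x \<partial>law) - p q * (real n * (\<integral>x. h n x \<partial>\<sigma>)) - 0) < r"
    using e1 e2
  proof eventually_elim
    case (elim n)
    have "norm (real n * (\<integral>x. h n x \<partial>law) - p q * (real n * (\<integral>x. h n x \<partial>\<sigma>)) - 0)
        = real n * \<bar>(\<integral>x. h n x \<partial>law) - p q * (\<integral>x. h n x \<partial>\<sigma>)\<bar>"
    proof -
      have "real n * (\<integral>x. h n x \<partial>law) - p q * (real n * (\<integral>x. h n x \<partial>\<sigma>))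
          = real n * ((\<integral>x. h n x \<partial>law) - p q * (\<integral>x. h n x \<partial>\<sigma>))" by (simp add: algebra_simps)
      then show ?thesis by (simp add: abs_mult)
    qed
    also have "\<dots> \<le> real n * (\<epsilon> * B * measure \<sigma> (cap q (s / zoom n)))"
      by (intro mult_left_mono t0 elim h B) auto
    also have "\<dots> = \<epsilon> * B * (real n * measure \<sigma> (cap q (s / zoom n)))" by simp
    also have "\<dots> \<le> \<epsilon> * B * L" using \<epsilon> B elim by (intro mult_left_mono) auto
    also have "\<dots> < \<epsilon> * (B + 1) * L" using \<epsilon> L by simp
    also have "\<dots> = r" using B L by (simp add: \<epsilon>_def)
    finally show ?case .
  qed
  then show "\<exists>N. \<forall>n\<ge>N. norm (real n * (\<integral>x. h n x \<partial>law) - p q * (real n * (\<integral>x. h n x \<partial>\<sigma>)) - 0) < r"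
    by (simp add: eventually_sequentially)
qed

text \<open>The density at \<open>q\<close> cancels the denominator in
  \<open>\<sigma>_cap_limit\<close>. The limit is the mean number of points below the scaled height
  \<open>s\<close>, hence the exponent in the tail of \<open>R\<close>.\<close>

lemma law_cap_limit:
  assumes "s \<ge> 0" shows "(\<lambda>n. real n * measure law (cap q (s / zoom n))) \<longlonglongrightarrow> s powr \<gamma>"
proof (cases "s = 0")
  case True
  then show ?thesis by (simp add: law_cap_0)
next
  case False
  with assms have "(\<lambda>n. real n * (\<integral>x. indicator (cap q (s / zoom n)) x \<partial>law)
      - p q * (real n * (\<integral>x. indicator (cap q (s / zoom n)) x \<partial>\<sigma>))) \<longlonglongrightarrow> 0"
    by (intro law_compare_limit[of _ 1]) auto
  moreover have "(\<lambda>n. p q * (real n * measure \<sigma> (cap q (s / zoom n)))) \<longlonglongrightarrow> p q * (s powr \<gamma> / p q)"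
    by (intro tendsto_mult tendsto_const \<sigma>_cap_limit assms)
  ultimately have "(\<lambda>n. real n * (\<integral>x. indicator (cap q (s / zoom n)) x \<partial>law)
      - p q * (real n * (\<integral>x. indicator (cap q (s / zoom n)) x \<partial>\<sigma>))
      + p q * (real n * measure \<sigma> (cap q (s / zoom n)))) \<longlonglongrightarrow> 0 + p q * (s powr \<gamma> / p q)"
    by (rule tendsto_add)
  then show ?thesis using p_pos by simp
qed

text \<open>Under the surface measure the integral is exactly the belt mass times the directional
  mean, once the belt is below the antipode. Passing to the sample law multiplies it by
  \<open>p q\<close> up to a vanishing error.\<close>

lemma law_belt_limit:
  assumes st: "0 \<le> s" "s < t" and \<nu>: "tangent_invariant q \<nu>" "prob_space \<nu>"
    and g: "continuous_on UNIV g" "\<And>x. \<bar>g x\<bar> \<le> B"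
  shows "(\<lambda>n. real n * (\<integral>x. g (tdir q x) * indicator (belt q (s / zoom n) (t / zoom n)) x \<partial>law))
    \<longlonglongrightarrow> (t powr \<gamma> - s powr \<gamma>) * integral\<^sup>L \<nu> g"
proof -
  have gm[measurable]: "g \<in> borel_measurable borel" using g(1) by (rule borel_measurable_continuous_onI)
  have B: "B \<ge> 0" using g(2)[of 0] by linarith
  have bg: "bounded (range g)" using g(2) by (auto simp: bounded_iff)
  let ?h = "\<lambda>n x. g (tdir q x) * indicator (belt q (s / zoom n) (t / zoom n)) x"
  have cmp: "(\<lambda>n. real n * (\<integral>x. ?h n x \<partial>law) - p q * (real n * (\<integral>x. ?h n x \<partial>\<sigma>))) \<longlonglongrightarrow> 0"
  proof (rule law_compare_limit[of _ B t])
    show "\<bar>?h n x\<bar> \<le> B * indicator (cap q (t / zoom n)) x" for n x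
      using g(2)[of "tdir q x"] B by (auto simp: indicator_def belt_def cap_def)
  qed (use st B in auto)
  have "(\<lambda>n. p q * ((real n * measure \<sigma> (cap q (t / zoom n)) - real n * measure \<sigma> (cap q (s / zoom n))) * integral\<^sup>L \<nu> g))
      \<longlonglongrightarrow> p q * ((t powr \<gamma> / p q - s powr \<gamma> / p q) * integral\<^sup>L \<nu> g)"
    using st by (intro tendsto_intros \<sigma>_cap_limit) auto
  also have "p q * ((t powr \<gamma> / p q - s powr \<gamma> / p q) * integral\<^sup>L \<nu> g) = (t powr \<gamma> - s powr \<gamma>) * integral\<^sup>L \<nu> g"
    using p_pos by (simp add: field_simps)
  finally have lim: "(\<lambda>n. p q * ((real n * measure \<sigma> (cap q (t / zoom n)) - real n * measure \<sigma> (cap q (s / zoom n))) * integral\<^sup>L \<nu> g))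
      \<longlonglongrightarrow> (t powr \<gamma> - s powr \<gamma>) * integral\<^sup>L \<nu> g" .
  have ev: "\<forall>\<^sub>F n in sequentially. t / zoom n < 2"
  proof -
    have "(\<lambda>n. t / zoom n) \<longlonglongrightarrow> 0" by (intro real_tendsto_divide_at_top[OF tendsto_const] zoom_at_top)
    from order_tendstoD(2)[OF this, of 2] show ?thesis by simp
  qed
  have "(\<lambda>n. p q * (real n * (\<integral>x. ?h n x \<partial>\<sigma>))) \<longlonglongrightarrow> (t powr \<gamma> - s powr \<gamma>) * integral\<^sup>L \<nu> g"
  proof (rule Lim_transform_eventually[OF lim])
    show "\<forall>\<^sub>F n in sequentially. p q * ((real n * measure \<sigma> (cap q (t / zoom n)) - real n * measure \<sigma> (cap q (s / zoom n))) * integral\<^sup>L \<nu> g)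
       = p q * (real n * (\<integral>x. ?h n x \<partial>\<sigma>))"
      using ev eventually_gt_at_top[of 0]
    proof eventually_elim
      case (elim n)
      have sc: "zoom n > 0" by (rule zoom_pos[OF elim(2)])
      have "(\<integral>x. ?h n x \<partial>\<sigma>) = measure \<sigma> (belt q (s / zoom n) (t / zoom n)) * integral\<^sup>L \<nu> g"
        using integral_belt_tdir[OF q1 _ elim(1) \<nu> g(1) bg, of "s / zoom n"] st sc by (simp add: mult.commute)
      also have "measure \<sigma> (belt q (s / zoom n) (t / zoom n)) = measure \<sigma> (cap q (t / zoom n)) - measure \<sigma> (cap q (s / zoom n))"
        using st sc by (intro measure_belt \<sigma>.finite_measure_axioms divide_right_mono) auto
      finally have eq: "(\<integral>x. ?h n x \<partial>\<sigma>) = (measure \<sigma> (cap q (t / zoom n)) - measure \<sigma> (cap q (s / zoom n))) * integral\<^sup>L \<nu> g" .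
      show ?case unfolding eq by (simp add: algebra_simps)
    qed
  qed
  from tendsto_add[OF cmp this] show ?thesis by simp
qed

text \<open>The asymptotics give the bound for low caps. For the others the mass is at most 1, and
  the summand \<open>1 / t2 powr \<gamma>\<close> of the constant absorbs it. Uniformity in
  \<open>t\<close> is needed to sum over all heights.\<close>

lemma law_cap_bound:
  obtains D where "D \<ge> 0" "\<And>t. t > 0 \<Longrightarrow> measure law (cap q t) \<le> D * t powr \<gamma>"
proof -
  obtain t0 where t00: "t0 > 0" and t0: "\<And>t h B. t \<le> t0 \<Longrightarrow> h \<in> borel_measurable borel \<Longrightarrow> (\<And>x. \<bar>h x\<bar> \<le> B * indicator (cap q t) x) \<Longrightarrow> B \<ge> 0 \<Longrightarrow>
      \<bar>(\<integral>x. h x \<partial>law) - p q * (\<integral>x. h x \<partial>\<sigma>)\<bar> \<le> 1 * B * measure \<sigma> (cap q t)"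
    using density_cap_approx[OF p_borel p_nonneg p_cont, of 1] unfolding law_def by auto
  have "\<forall>\<^sub>F t in at_right 0. measure \<sigma> (cap q t) / t powr \<gamma> < c\<^sub>0 + 1"
    using order_tendstoD(2)[OF \<sigma>_cap_asymp] by simp
  then obtain t1 where t1: "t1 > 0" "\<And>t. 0 < t \<Longrightarrow> t < t1 \<Longrightarrow> measure \<sigma> (cap q t) / t powr \<gamma> < c\<^sub>0 + 1"
    by (auto simp: eventually_at_right_field)
  define t2 where "t2 = min t0 t1"
  have t2: "t2 > 0" using t00 t1 by (simp add: t2_def)
  define D where "D = (p q + 1) * (c\<^sub>0 + 1) + 1 / t2 powr \<gamma>"
  show ?thesis
  proof (rule that[of D])
    show "D \<ge> 0" using p_pos c\<^sub>0_pos by (simp add: D_def)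
    fix t :: real assume t: "t > 0"
    show "measure law (cap q t) \<le> D * t powr \<gamma>"
    proof (cases "t < t2")
      case True
      have "\<bar>measure law (cap q t) - p q * measure \<sigma> (cap q t)\<bar> \<le> 1 * 1 * measure \<sigma> (cap q t)"
        using t0[of t "indicator (cap q t)" 1] True by (simp add: t2_def)
      then have "measure law (cap q t) \<le> (p q + 1) * measure \<sigma> (cap q t)" by (simp add: algebra_simps)
      also have "measure \<sigma> (cap q t) \<le> (c\<^sub>0 + 1) * t powr \<gamma>"
        using t1(2)[of t] True t by (simp add: t2_def divide_less_eq)
      then have "(p q + 1) * measure \<sigma> (cap q t) \<le> (p q + 1) * ((c\<^sub>0 + 1) * t powr \<gamma>)"
        using p_pos by (intro mult_left_mono) auto
      also have "\<dots> \<le> D * t powr \<gamma>" by (simp add: D_def algebra_simps)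
      finally show ?thesis .
    next
      case False
      have "t2 powr \<gamma> \<le> t powr \<gamma>" using False t2 \<gamma>_pos by (intro powr_mono2) auto
      then have "1 \<le> 1 / t2 powr \<gamma> * t powr \<gamma>" using t2 by simp
      also have "\<dots> \<le> D * t powr \<gamma>" using p_pos c\<^sub>0_pos by (intro mult_right_mono) (auto simp: D_def)
      finally show ?thesis using law.prob_le_1[of "cap q t"] by linarith
    qed
  qed
qed

text \<open>This bounds the mean of the sum in the attention error. Unit layers of scaled height
  turn the integral into a sum of \<open>exp (- real k / 2)\<close> times cap masses. Since
  \<open>zoom n powr \<gamma>\<close> is proportional to \<open>n\<close>, the prefactor cancels and
  a convergent series remains.\<close>

lemma law_laplace_bound:
  obtains D where "\<And>n. n > 0 \<Longrightarrow> real n * (\<integral>x. exp (- (zoom n * (1 - q \<bullet> x)) / 2) \<partial>law) \<le> D"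
proof -
  obtain D where D: "D \<ge> 0" "\<And>t. t > 0 \<Longrightarrow> measure law (cap q t) \<le> D * t powr \<gamma>" using law_cap_bound by blast
  let ?u = "\<lambda>k::nat. exp (- real k / 2) * (real k + 1) powr \<gamma>"
  have sum: "summable ?u"
  proof (rule summable_comparison_test_bigo)
    show "summable (\<lambda>n::nat. norm (1 / real n ^ 2))" using inverse_power_summable[of 2] by (simp add: divide_inverse)
    show "?u \<in> O(\<lambda>n. 1 / real n ^ 2)" by real_asymp
  qed
  show ?thesis
  proof (rule that)
    fix n :: nat assume n: "n > 0"
    have sc: "zoom n > 0" by (rule zoom_pos[OF n])
    \<comment> \<open>Heights on the sphere are at most 2, so \<open>N\<close> layers reach every
      scaled height.\<close>
    define N where "N = nat \<lceil>2 * zoom n\<rceil> + 1"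
    have N: "2 * zoom n < real N" unfolding N_def by linarith
    have "(\<integral>x. exp (- (zoom n * (1 - q \<bullet> x)) / 2) \<partial>law)
       \<le> (\<integral>x. (\<Sum>k<N. exp (- real k / 2) * indicator (cap q ((real k + 1) / zoom n)) x) \<partial>law)"
    proof (rule integral_mono_AE)
      have "AE x in law. norm (exp (- (zoom n * (1 - q \<bullet> x)) / 2)) \<le> 1"
        using AE_law
      proof eventually_elim
        case (elim x)
        show ?case using inner_unit_bounds(1)[OF q1 elim] sc by simp
      qed
      then show "integrable law (\<lambda>x. exp (- (zoom n * (1 - q \<bullet> x)) / 2))"
        by (rule law.integrable_const_bound) measurable
      show "integrable law (\<lambda>x. \<Sum>k<N. exp (- real k / 2) * indicator (cap q ((real k + 1) / zoom n)) x)"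
        by (intro Bochner_Integration.integrable_sum integrable_mult_right)
           (simp add: integrable_indicator_iff law.emeasure_finite less_top[symmetric])
      show "AE x in law. exp (- (zoom n * (1 - q \<bullet> x)) / 2)
          \<le> (\<Sum>k<N. exp (- real k / 2) * indicator (cap q ((real k + 1) / zoom n)) x)"
        using AE_law
      proof eventually_elim
        case (elim x)
        define s where "s = zoom n * (1 - q \<bullet> x)"
        have s: "0 \<le> s" "s \<le> 2 * zoom n" using inner_unit_bounds[OF q1 elim] sc by (auto simp: s_def)
        define k where "k = nat \<lfloor>s\<rfloor>"
        have k: "real k \<le> s" "s \<le> real k + 1" using s unfolding k_def by linarith+
        have kN: "k < N" using k s N by linarith
        have "exp (- s / 2) \<le> exp (- real k / 2) * indicator (cap q ((real k + 1) / zoom n)) x"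
          using k cap_scaled_iff[OF sc, of x q "real k + 1"] by (simp add: s_def)
        also have "\<dots> \<le> (\<Sum>k<N. exp (- real k / 2) * indicator (cap q ((real k + 1) / zoom n)) x)"
          using kN by (intro member_le_sum[where f = "\<lambda>k. exp (- real k / 2) * indicator (cap q ((real k + 1) / zoom n)) x"]) auto
        finally show ?case by (simp add: s_def)
      qed
    qed
    also have "\<dots> = (\<Sum>k<N. exp (- real k / 2) * measure law (cap q ((real k + 1) / zoom n)))"
      by (subst Bochner_Integration.integral_sum)
         (auto simp: integrable_indicator_iff law.emeasure_finite less_top[symmetric])
    also have "\<dots> \<le> (\<Sum>k<N. exp (- real k / 2) * (D * ((real k + 1) / zoom n) powr \<gamma>))"
      using sc by (intro sum_mono mult_left_mono D) auto
    also have "\<dots> = (\<Sum>k<N. D / (c\<^sub>0 * p q * real n) * ?u k)"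
      using sc by (intro sum.cong refl) (simp add: powr_divide zoom_powr)
    also have "\<dots> = D / (c\<^sub>0 * p q * real n) * (\<Sum>k<N. ?u k)" by (simp add: sum_distrib_left)
    also have "\<dots> \<le> D / (c\<^sub>0 * p q * real n) * suminf ?u"
      using D c\<^sub>0_pos p_pos by (intro mult_left_mono sum_le_suminf sum) auto
    finally have "real n * (\<integral>x. exp (- (zoom n * (1 - q \<bullet> x)) / 2) \<partial>law) \<le> real n * (D / (c\<^sub>0 * p q * real n) * suminf ?u)"
      by (intro mult_left_mono) auto
    also have "\<dots> = D / (c\<^sub>0 * p q) * suminf ?u" using n by simp
    finally show "real n * (\<integral>x. exp (- (zoom n * (1 - q \<bullet> x)) / 2) \<partial>law) \<le> D / (c\<^sub>0 * p q) * suminf ?u" .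
  qed
qed

lemma expectation_prod:
  fixes h :: "real ^ 'n \<Rightarrow> real"
  assumes i: "i < n" and h[measurable]: "h \<in> borel_measurable borel" and hB: "\<And>x. \<bar>h x\<bar> \<le> B"
  shows "expectation (\<lambda>\<omega>. h (X i \<omega>) * (\<Prod>j\<in>{..<n} - {i}. indicator (- cap q c) (X j \<omega>)))
    = (\<integral>x. h x \<partial>law) * (1 - measure law (cap q c)) ^ (n - 1)"
proof -
  \<comment> \<open>The distinguished point and the excluded ones become a single indexed family, to
    which the product rule for independent variables applies at once.\<close>
  define F where "F j = (if j = i then h else indicator (- cap q c))" for j
  have Fm[measurable]: "F j \<in> borel_measurable borel" for j unfolding F_def by auto
  have cc: "measure law (- cap q c) = 1 - measure law (cap q c)"
    using law.prob_compl[of "cap q c"] by (simp add: Compl_eq_Diff_UNIV)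
  have iv: "indep_vars (\<lambda>_. borel) (\<lambda>j \<omega>. F j (X j \<omega>)) {..<n}"
    using indep_vars_compose2[OF indep_vars_subset[OF indep, of "{..<n}"], of F "\<lambda>_. borel"] by auto
  have "\<bar>F j x\<bar> \<le> max B 1" for j x using hB[of x] by (auto simp: F_def indicator_def)
  then have int: "integrable M (\<lambda>\<omega>. F j (X j \<omega>))" for j
    by (intro integrable_const_bound[of _ "max B 1"]) auto
  have "expectation (\<lambda>\<omega>. h (X i \<omega>) * (\<Prod>j\<in>{..<n} - {i}. indicator (- cap q c) (X j \<omega>)))
      = expectation (\<lambda>\<omega>. \<Prod>j<n. F j (X j \<omega>))"
    using i by (intro Bochner_Integration.integral_cong refl)
      (subst prod.remove[of "{..<n}" i], auto simp: F_def intro!: prod.cong)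
  also have "\<dots> = (\<Prod>j<n. expectation (\<lambda>\<omega>. F j (X j \<omega>)))"
    by (rule indep_vars_lebesgue_integral[OF _ iv int]) auto
  also have "\<dots> = (\<Prod>j<n. \<integral>x. F j x \<partial>law)" by (simp add: expectation_X)
  also have "\<dots> = (\<integral>x. h x \<partial>law) * (\<Prod>j\<in>{..<n} - {i}. 1 - measure law (cap q c))"
    using i by (subst prod.remove[of "{..<n}" i]) (auto simp: F_def cc intro!: prod.cong)
  also have "\<dots> = (\<integral>x. h x \<partial>law) * (1 - measure law (cap q c)) ^ (n - 1)" using i by simp
  finally show ?thesis .
qed

end

text \<open>A coarse estimate for convergence in probability that assumes no gap below the
  competitors. Points up to height \<open>2 * t\<close> are within \<open>sqrt (4 * t)\<close> of
  \<open>q\<close>; any higher one is more than \<open>t\<close> above \<open>x i\<close>, so its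
  weight is at most \<open>exp (- \<beta> * t)\<close>, and its distance to \<open>q\<close> is at
  most 2.\<close>

lemma softmax_displacement_bound:
  fixes x :: "nat \<Rightarrow> 'a::real_inner"
  assumes i: "i < n" and q: "norm q = 1" and x: "\<And>j. j < n \<Longrightarrow> norm (x j) = 1"
    and \<beta>: "\<beta> \<ge> 0" and t: "1 - q \<bullet> x i \<le> t" "t \<ge> 0"
  defines "w \<equiv> \<lambda>j. exp (- \<beta> * (1 - q \<bullet> x j)) / (\<Sum>l<n. exp (- \<beta> * (1 - q \<bullet> x l)))"
  shows "norm (\<Sum>j<n. w j *\<^sub>R (x j - q)) \<le> sqrt (4 * t) + 2 * real n * exp (- \<beta> * t)"
proof -
  define Z where "Z = (\<Sum>l<n. exp (- \<beta> * (1 - q \<bullet> x l)))"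
  have Zi: "exp (- \<beta> * (1 - q \<bullet> x i)) \<le> Z" unfolding Z_def
    using i by (intro member_le_sum) auto
  then have Zpos: "Z > 0" using exp_gt_zero order_less_le_trans by blast
  have w0: "w j \<ge> 0" for j using Zpos by (simp add: w_def Z_def)
  have w1: "(\<Sum>j<n. w j) = 1"
    using Zpos unfolding w_def Z_def[symmetric] by (simp add: sum_divide_distrib[symmetric]) (simp add: Z_def)
  have "norm (\<Sum>j<n. w j *\<^sub>R (x j - q)) \<le> (\<Sum>j<n. norm (w j *\<^sub>R (x j - q)))" by (rule norm_sum)
  also have "\<dots> \<le> (\<Sum>j<n. w j * sqrt (4 * t) + 2 * exp (- \<beta> * t))"
  proof (intro sum_mono)
    fix j assume "j \<in> {..<n}"
    then have j: "j < n" by simp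
    have e: "norm (w j *\<^sub>R (x j - q)) = w j * sqrt (2 * (1 - q \<bullet> x j))"
      using w0 norm_diff_unit[OF q x[OF j]] by simp
    show "norm (w j *\<^sub>R (x j - q)) \<le> w j * sqrt (4 * t) + 2 * exp (- \<beta> * t)"
    proof (cases "1 - q \<bullet> x j \<le> 2 * t")
      case True
      then have "w j * sqrt (2 * (1 - q \<bullet> x j)) \<le> w j * sqrt (4 * t)" using w0 by (intro mult_left_mono) auto
      then show ?thesis unfolding e using exp_ge_zero[of "- \<beta> * t"] by linarith
    next
      case False
      have "w j \<le> exp (- \<beta> * (1 - q \<bullet> x j)) / exp (- \<beta> * (1 - q \<bullet> x i))"
        unfolding w_def Z_def[symmetric] using Zi by (intro divide_left_mono) (auto simp: Zpos)
      also have "\<dots> = exp (- (\<beta> * ((1 - q \<bullet> x j) - (1 - q \<bullet> x i))))"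
        unfolding exp_diff[symmetric] by (simp add: algebra_simps)
      also have "\<dots> \<le> exp (- \<beta> * t)"
      proof -
        have "\<beta> * t \<le> \<beta> * ((1 - q \<bullet> x j) - (1 - q \<bullet> x i))" using False t \<beta> by (intro mult_left_mono) auto
        then show ?thesis by simp
      qed
      finally have wj: "w j \<le> exp (- \<beta> * t)" .
      have "sqrt (2 * (1 - q \<bullet> x j)) \<le> sqrt 4"
        using inner_unit_bounds(2)[OF q x[OF j]] by (intro real_sqrt_le_mono) auto
      then have "sqrt (2 * (1 - q \<bullet> x j)) \<le> 2" by simp
      then have "w j * sqrt (2 * (1 - q \<bullet> x j)) \<le> exp (- \<beta> * t) * 2"
        using wj w0 inner_unit_bounds(1)[OF q x[OF j]] by (intro mult_mono) auto
      moreover have "0 \<le> w j * sqrt (4 * t)" using w0 t by simp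
      ultimately show ?thesis unfolding e by linarith
    qed
  qed
  also have "\<dots> = sqrt (4 * t) + 2 * real n * exp (- \<beta> * t)"
    by (simp add: sum.distrib sum_distrib_right[symmetric] w1)
  finally show ?thesis .
qed

section \<open>Attention of the random sample\<close>

context sphere_sample
begin

definition attn :: "real \<Rightarrow> nat \<Rightarrow> nat \<Rightarrow> 's \<Rightarrow> real" where
  "attn b n j \<omega> = exp (- b * (1 - q \<bullet> X j \<omega>)) / (\<Sum>l<n. exp (- b * (1 - q \<bullet> X l \<omega>)))"

definition disp :: "real \<Rightarrow> nat \<Rightarrow> 's \<Rightarrow> real ^ 'n" where
  "disp b n \<omega> = (\<Sum>j<n. attn b n j \<omega> *\<^sub>R (X j \<omega> - q))"

lemma disp_borel[measurable]: "disp b n \<in> borel_measurable M"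
  unfolding disp_def[abs_def] attn_def by measurable

lemma sum_attn: "n > 0 \<Longrightarrow> (\<Sum>j<n. attn b n j \<omega>) = 1"
proof -
  assume "n > 0"
  then have "(\<Sum>l<n. exp (- b * (1 - q \<bullet> X l \<omega>))) > 0" by (intro sum_pos) auto
  then show ?thesis unfolding attn_def by (simp add: sum_divide_distrib[symmetric])
qed

text \<open>This integrates \<open>softmax_cell_lower_bound\<close>. Each cell term factors by
  \<open>expectation_prod\<close>; the \<open>n\<close> equal terms supply the factor
  \<open>n\<close> of \<open>law_belt_limit\<close>, and the power \<open>n - 1\<close> yields the
  exponential. The mean error is the vanishing \<open>co n\<close> times the quantity bounded by
  \<open>law_laplace_bound\<close>, and \<open>\<epsilon>'\<close> pays for passing from the limit
  to large \<open>n\<close>.\<close>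

lemma expectation_lower_bound:
  fixes f :: "real ^ 'n \<Rightarrow> real"
  assumes \<beta>: "filterlim (\<lambda>n. \<beta> n / zoom n) at_top sequentially"
    and \<nu>: "tangent_invariant q \<nu>" "prob_space \<nu>"
    and f: "continuous_on UNIV f" "\<And>x. 0 \<le> f x" "\<And>x. f x \<le> B"
    and \<delta>: "\<delta> > 0" "sqrt (2 * \<delta>) < \<eta> / 3" and \<epsilon>: "\<epsilon> \<ge> 0" "\<epsilon>' > 0"
    and uc: "\<And>u v. norm u \<le> sqrt (2 * (real m * \<delta>)) \<Longrightarrow> dist u v < \<eta> \<Longrightarrow> \<bar>f u - f v\<bar> \<le> \<epsilon>"
  shows "\<forall>\<^sub>F n in sequentially.
    (\<Sum>k<m. (((real k + 1) * \<delta>) powr \<gamma> - (real k * \<delta>) powr \<gamma>)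
        * (\<integral>\<theta>. f (sqrt (2 * (real k * \<delta>)) *\<^sub>R \<theta>) \<partial>\<nu>) * exp (- (((real k + 2) * \<delta>) powr \<gamma>))) - \<epsilon> - \<epsilon>'
    \<le> expectation (\<lambda>\<omega>. f (sqrt (zoom n) *\<^sub>R disp (\<beta> n) n \<omega>))"
proof -
  have fm[measurable]: "f \<in> borel_measurable borel" using f(1) by (rule borel_measurable_continuous_onI)
  have B: "B \<ge> 0" using f(2,3)[of 0] by linarith
  have "sqrt (2 * \<delta>) > 0" using \<delta> by simp
  then have \<eta>: "\<eta> > 0" using \<delta>(2) by linarith
  define g where "g k \<theta> = f (sqrt (2 * (real k * \<delta>)) *\<^sub>R \<theta>)" for k :: nat and \<theta>
  have gc: "continuous_on UNIV (g k)" for k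
    unfolding g_def by (intro continuous_on_compose2[OF f(1)] continuous_intros) auto
  have gm[measurable]: "g k \<in> borel_measurable borel" for k using gc by (rule borel_measurable_continuous_onI)
  have gB: "0 \<le> g k \<theta>" "g k \<theta> \<le> B" for k \<theta> using f by (auto simp: g_def)
  have gB': "\<bar>g k \<theta>\<bar> \<le> B" for k \<theta> using gB[of k \<theta>] by simp
  define h where "h n k x = g k (tdir q x) * indicator (belt q (real k * \<delta> / zoom n) ((real k + 1) * \<delta> / zoom n)) x" for n k x
  have hm[measurable]: "h n k \<in> borel_measurable borel" for n k unfolding h_def by measurable
  have hB: "\<bar>h n k x\<bar> \<le> B" for n k x using gB[of k "tdir q x"] B by (auto simp: h_def indicator_def)
  define Pr where "Pr n k i \<omega> = (\<Prod>j\<in>{..<n} - {i}. indicator (- cap q ((real k + 2) * \<delta> / zoom n)) (X j \<omega>) :: real)" for n k i \<omega>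
  have Prm[measurable]: "Pr n k i \<in> borel_measurable M" for n k i unfolding Pr_def by measurable
  have Pr01: "0 \<le> Pr n k i \<omega>" "Pr n k i \<omega> \<le> 1" for n k i \<omega>
    unfolding Pr_def by (auto intro!: prod_nonneg prod_le_1 simp: indicator_def)
  define ex where "ex n x = exp (- (zoom n * (1 - q \<bullet> x)) / 2)" for n x
  have exm[measurable]: "ex n \<in> borel_measurable borel" for n unfolding ex_def by measurable
  define co where "co n = 4 * exp (real m * \<delta> - (\<beta> n / zoom n - 1) * \<delta>)" for n
  define Er where "Er n \<omega> = co n * (\<Sum>j<n. ex n (X j \<omega>))" for n \<omega>
  define L where "L n = (\<Sum>k<m. (real n * (\<integral>x. h n k x \<partial>law)) * (1 - measure law (cap q ((real k + 2) * \<delta> / zoom n))) ^ (n - 1))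
      - \<epsilon> - B * (co n * (real n * (\<integral>x. ex n x \<partial>law)) / (\<eta> / 3))" for n
  have lim: "L \<longlonglongrightarrow> (\<Sum>k<m. (((real k + 1) * \<delta>) powr \<gamma> - (real k * \<delta>) powr \<gamma>) * (\<integral>\<theta>. g k \<theta> \<partial>\<nu>)
      * exp (- (((real k + 2) * \<delta>) powr \<gamma>))) - \<epsilon> - B * (0 / (\<eta> / 3))"
  proof -
    have "(\<lambda>n. (real n * (\<integral>x. h n k x \<partial>law)) * (1 - measure law (cap q ((real k + 2) * \<delta> / zoom n))) ^ (n - 1))
      \<longlonglongrightarrow> (((real k + 1) * \<delta>) powr \<gamma> - (real k * \<delta>) powr \<gamma>) * (\<integral>\<theta>. g k \<theta> \<partial>\<nu>) * exp (- (((real k + 2) * \<delta>) powr \<gamma>))" for k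
    proof (rule tendsto_mult)
    show "(\<lambda>n. real n * (\<integral>x. h n k x \<partial>law)) \<longlonglongrightarrow> (((real k + 1) * \<delta>) powr \<gamma> - (real k * \<delta>) powr \<gamma>) * (\<integral>\<theta>. g k \<theta> \<partial>\<nu>)"
      unfolding h_def using \<delta> by (intro law_belt_limit[OF _ _ \<nu> gc gB']) auto
    show "(\<lambda>n. (1 - measure law (cap q ((real k + 2) * \<delta> / zoom n))) ^ (n - 1)) \<longlonglongrightarrow> exp (- (((real k + 2) * \<delta>) powr \<gamma>))"
      using \<delta> by (intro one_minus_power_tendsto law_cap_limit) auto
    qed
    moreover
    obtain D where D: "\<And>n. n > 0 \<Longrightarrow> real n * (\<integral>x. ex n x \<partial>law) \<le> D"
      using law_laplace_bound unfolding ex_def by blast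
    \<comment> \<open>Here the growth of \<open>\<beta> n / zoom n\<close> enters: for fixed
      \<open>\<delta> > 0\<close> it defeats the constant
      \<open>exp (real m * \<delta> + \<delta>)\<close>.\<close>
    have co0: "co \<longlonglongrightarrow> 0"
    proof -
      have "filterlim (\<lambda>n. \<delta> * (\<beta> n / zoom n)) at_top sequentially"
        by (rule filterlim_tendsto_pos_mult_at_top[OF tendsto_const \<delta>(1) \<beta>])
      then have "(\<lambda>n. exp (- (\<delta> * (\<beta> n / zoom n)))) \<longlonglongrightarrow> 0"
        by (intro filterlim_compose[OF exp_at_bot]) (simp add: filterlim_uminus_at_top[symmetric])
      then have "(\<lambda>n. 4 * exp (real m * \<delta> + \<delta>) * exp (- (\<delta> * (\<beta> n / zoom n)))) \<longlonglongrightarrow> 4 * exp (real m * \<delta> + \<delta>) * 0"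
        by (intro tendsto_mult tendsto_const)
      moreover have "co = (\<lambda>n. 4 * exp (real m * \<delta> + \<delta>) * exp (- (\<delta> * (\<beta> n / zoom n))))"
        unfolding co_def[abs_def] mult.assoc exp_add[symmetric] by (simp add: algebra_simps)
      ultimately show ?thesis by (simp only: mult_zero_right)
    qed
    have "(\<lambda>n. co n * (real n * (\<integral>x. ex n x \<partial>law))) \<longlonglongrightarrow> 0"
    proof (rule tendsto_sandwich)
      have "0 \<le> co n * (real n * (\<integral>x. ex n x \<partial>law))" for n
        by (intro mult_nonneg_nonneg integral_nonneg_AE) (auto simp: co_def ex_def)
      then show "\<forall>\<^sub>F n in sequentially. 0 \<le> co n * (real n * (\<integral>x. ex n x \<partial>law))" by simp
      show "\<forall>\<^sub>F n in sequentially. co n * (real n * (\<integral>x. ex n x \<partial>law)) \<le> co n * D"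
        using eventually_gt_at_top[of 0] by eventually_elim (auto intro!: mult_left_mono D simp: co_def)
      show "(\<lambda>n. co n * D) \<longlonglongrightarrow> 0" using tendsto_mult[OF co0 tendsto_const, of D] by simp
    qed simp
    ultimately show ?thesis
      unfolding L_def using \<eta> by (intro tendsto_diff tendsto_sum tendsto_const tendsto_mult_left tendsto_divide) auto
  qed
  have "\<forall>\<^sub>F n in sequentially. (\<Sum>k<m. (((real k + 1) * \<delta>) powr \<gamma> - (real k * \<delta>) powr \<gamma>) * (\<integral>\<theta>. g k \<theta> \<partial>\<nu>)
      * exp (- (((real k + 2) * \<delta>) powr \<gamma>))) - \<epsilon> - \<epsilon>' < L n"
    using order_tendstoD(1)[OF lim] \<epsilon>(2) by simp
  moreover have "\<forall>\<^sub>F n in sequentially. \<beta> n / zoom n \<ge> 1"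
    using \<beta> by (simp add: filterlim_at_top)
  moreover have "\<forall>\<^sub>F n in sequentially. real m * \<delta> / zoom n < 2"
  proof -
    have "(\<lambda>n. real m * \<delta> / zoom n) \<longlonglongrightarrow> 0" by (intro real_tendsto_divide_at_top[OF tendsto_const] zoom_at_top)
    from order_tendstoD(2)[OF this, of 2] show ?thesis by simp
  qed
  moreover have "\<forall>\<^sub>F n in sequentially. 2 * (real m * \<delta>) / sqrt (zoom n) < \<eta> / 3"
  proof -
    have "(\<lambda>n. 2 * (real m * \<delta>) / sqrt (zoom n)) \<longlonglongrightarrow> 0"
      by (intro real_tendsto_divide_at_top[OF tendsto_const] filterlim_compose[OF sqrt_at_top zoom_at_top])
    from order_tendstoD(2)[OF this, of "\<eta> / 3"] \<eta> show ?thesis by simp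
  qed
  ultimately show ?thesis using eventually_gt_at_top[of 0]
  proof eventually_elim
    case (elim n)
    have z: "zoom n > 0" by (rule zoom_pos[OF elim(5)])
    have \<beta>n: "\<beta> n \<ge> zoom n" using elim(2) z by (simp add: le_divide_eq)
    have iterm: "integrable M (\<lambda>\<omega>. h n k (X i \<omega>) * Pr n k i \<omega>)" for k i
    proof (rule integrable_const_bound[of _ B])
      have "\<bar>h n k (X i \<omega>)\<bar> * Pr n k i \<omega> \<le> B * 1" for \<omega> using hB Pr01 B by (intro mult_mono) auto
      then show "AE \<omega> in M. norm (h n k (X i \<omega>) * Pr n k i \<omega>) \<le> B" using Pr01 by (simp add: abs_mult)
    qed measurable
    have iex: "integrable M (\<lambda>\<omega>. ex n (X j \<omega>))" for j
    proof (rule integrable_const_bound[of _ 1])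
      show "AE \<omega> in M. norm (ex n (X j \<omega>)) \<le> 1" using AE_unit
      proof eventually_elim
        case (elim \<omega>)
        then show ?case using inner_unit_bounds(1)[OF q1, of "X j \<omega>"] z by (simp add: ex_def)
      qed
    qed measurable
    have iEr: "integrable M (\<lambda>\<omega>. B * (Er n \<omega> / (\<eta> / 3)))"
      unfolding Er_def by (intro integrable_mult_right integrable_divide_zero Bochner_Integration.integrable_sum iex)
    have EEr: "expectation (Er n) = co n * (real n * (\<integral>x. ex n x \<partial>law))"
      unfolding Er_def by (simp add: iex expectation_X)
    have "L n = (\<Sum>i<n. \<Sum>k<m. expectation (\<lambda>\<omega>. h n k (X i \<omega>) * Pr n k i \<omega>)) - \<epsilon> - B * (expectation (Er n) / (\<eta> / 3))"
    proof -
      have "(\<Sum>i<n. \<Sum>k<m. expectation (\<lambda>\<omega>. h n k (X i \<omega>) * Pr n k i \<omega>))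
         = (\<Sum>i<n. \<Sum>k<m. (\<integral>x. h n k x \<partial>law) * (1 - measure law (cap q ((real k + 2) * \<delta> / zoom n))) ^ (n - 1))"
        unfolding Pr_def by (intro sum.cong refl expectation_prod[OF _ hm hB]) auto
      also have "\<dots> = (\<Sum>k<m. (real n * (\<integral>x. h n k x \<partial>law)) * (1 - measure law (cap q ((real k + 2) * \<delta> / zoom n))) ^ (n - 1))"
        by (simp add: sum_distrib_left mult.assoc)
      finally show ?thesis by (simp add: L_def EEr)
    qed
    also have "\<dots> = expectation (\<lambda>\<omega>. (\<Sum>i<n. \<Sum>k<m. h n k (X i \<omega>) * Pr n k i \<omega>) - \<epsilon> - B * (Er n \<omega> / (\<eta> / 3)))"
    proof -
      have i1: "integrable M (\<lambda>\<omega>. \<Sum>i<n. \<Sum>k<m. h n k (X i \<omega>) * Pr n k i \<omega>)"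
        by (intro Bochner_Integration.integrable_sum iterm)
      have e1: "expectation (\<lambda>\<omega>. \<Sum>i<n. \<Sum>k<m. h n k (X i \<omega>) * Pr n k i \<omega>)
          = (\<Sum>i<n. \<Sum>k<m. expectation (\<lambda>\<omega>. h n k (X i \<omega>) * Pr n k i \<omega>))"
        by (simp add: Bochner_Integration.integral_sum Bochner_Integration.integrable_sum iterm)
      have "expectation (\<lambda>\<omega>. (\<Sum>i<n. \<Sum>k<m. h n k (X i \<omega>) * Pr n k i \<omega>) - \<epsilon> - B * (Er n \<omega> / (\<eta> / 3)))
         = expectation (\<lambda>\<omega>. (\<Sum>i<n. \<Sum>k<m. h n k (X i \<omega>) * Pr n k i \<omega>) - \<epsilon>) - expectation (\<lambda>\<omega>. B * (Er n \<omega> / (\<eta> / 3)))"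
        using i1 iEr by (intro Bochner_Integration.integral_diff) auto
      also have "expectation (\<lambda>\<omega>. (\<Sum>i<n. \<Sum>k<m. h n k (X i \<omega>) * Pr n k i \<omega>) - \<epsilon>)
         = expectation (\<lambda>\<omega>. \<Sum>i<n. \<Sum>k<m. h n k (X i \<omega>) * Pr n k i \<omega>) - \<epsilon>"
        using i1 by (subst Bochner_Integration.integral_diff) (auto simp: prob_space)
      also have "expectation (\<lambda>\<omega>. B * (Er n \<omega> / (\<eta> / 3))) = B * (expectation (Er n) / (\<eta> / 3))" by simp
      finally show ?thesis by (simp only: e1)
    qed
    also have "\<dots> \<le> expectation (\<lambda>\<omega>. f (sqrt (zoom n) *\<^sub>R disp (\<beta> n) n \<omega>))"
    proof (rule integral_mono_AE)
      show "integrable M (\<lambda>\<omega>. (\<Sum>i<n. \<Sum>k<m. h n k (X i \<omega>) * Pr n k i \<omega>) - \<epsilon> - B * (Er n \<omega> / (\<eta> / 3)))"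
        by (intro Bochner_Integration.integrable_diff Bochner_Integration.integrable_sum iterm iEr) auto
      show "integrable M (\<lambda>\<omega>. f (sqrt (zoom n) *\<^sub>R disp (\<beta> n) n \<omega>))"
        by (rule integrable_const_bound[of _ B]) (use f in auto)
      show "AE \<omega> in M. (\<Sum>i<n. \<Sum>k<m. h n k (X i \<omega>) * Pr n k i \<omega>) - \<epsilon> - B * (Er n \<omega> / (\<eta> / 3))
          \<le> f (sqrt (zoom n) *\<^sub>R disp (\<beta> n) n \<omega>)"
        using AE_unit
      proof eventually_elim
        case unit: (elim \<omega>)
        show ?case
          unfolding h_def g_def Pr_def Er_def co_def ex_def disp_def attn_def
          by (rule softmax_cell_lower_bound[OF q1 _ z \<beta>n \<delta> elim(4,3) f(2,3) \<epsilon>(1) uc]) (use unit in auto)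
      qed
    qed
    finally show ?case using elim(1) unfolding g_def by linarith
  qed
qed

text \<open>The limit of the scaled masses is positive, so arbitrarily low caps have positive mass,
  and the given cap contains one of them.\<close>

lemma law_cap_pos:
  assumes "t > 0" shows "measure law (cap q t) > 0"
proof -
  have "(\<lambda>n. real n * measure law (cap q (1 / zoom n))) \<longlonglongrightarrow> 1 powr \<gamma>" by (rule law_cap_limit) simp
  then have e1: "\<forall>\<^sub>F n in sequentially. 0 < real n * measure law (cap q (1 / zoom n))"
    by (rule order_tendstoD(1)) simp
  have "(\<lambda>n. 1 / zoom n) \<longlonglongrightarrow> 0" by (intro real_tendsto_divide_at_top[OF tendsto_const] zoom_at_top)
  from order_tendstoD(2)[OF this \<open>t > 0\<close>] e1
  have "\<forall>\<^sub>F n in sequentially. 0 < measure law (cap q t)"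
  proof eventually_elim
    case (elim n)
    then have "0 < measure law (cap q (1 / zoom n))" by (simp add: zero_less_mult_iff)
    also have "\<dots> \<le> measure law (cap q t)"
      using elim by (intro law.finite_measure_mono) (auto simp: cap_def cap_borel[unfolded cap_def])
    finally show ?case .
  qed
  then show ?thesis by simp
qed

text \<open>As soon as one point lies in a fixed low cap, the displacement is at most
  \<open>e / 2\<close> plus a term that vanishes as \<open>n\<close> grows. The probability that the
  cap is missed decays geometrically.\<close>

lemma disp_conv_in_prob:
  assumes \<beta>: "filterlim (\<lambda>n. \<beta> n / zoom n) at_top sequentially" and e: "e > 0"
  shows "(\<lambda>n. prob {\<omega>\<in>space M. norm (disp (\<beta> n) n \<omega>) > e}) \<longlonglongrightarrow> 0"
proof -
  define t where "t = e\<^sup>2 / 16"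
  have t: "t > 0" using e by (simp add: t_def)
  have st: "sqrt (4 * t) = e / 2" using e by (simp add: t_def real_sqrt_divide)
  define F where "F = measure law (cap q t)"
  have F: "F > 0" "F \<le> 1" using law_cap_pos[OF t] by (auto simp: F_def)
  \<comment> \<open>Index 0 is left out so that \<open>expectation_prod\<close> applies with
    \<open>i = 0\<close> and a constant function; ignoring one point only enlarges the event that
    the cap is missed.\<close>
  define A where "A n = (\<lambda>\<omega>. \<Prod>j\<in>{..<n} - {0}. indicator (- cap q t) (X j \<omega>) :: real)" for n
  have Am[measurable]: "A n \<in> borel_measurable M" for n unfolding A_def by measurable
  have A01: "0 \<le> A n \<omega>" "A n \<omega> \<le> 1" for n \<omega>
    unfolding A_def by (auto intro!: prod_nonneg prod_le_1 simp: indicator_def)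
  have iA: "integrable M (A n)" for n by (rule integrable_const_bound[of _ 1]) (use A01 in auto)
  have ca: "c\<^sub>0 * p q > 0" "1 / \<gamma> > 0" using c\<^sub>0_pos p_pos \<gamma>_pos by auto
  have "(\<lambda>n. 2 * real n * exp (- ((c * real n) powr a) * t)) \<longlonglongrightarrow> 0" if "c > 0" "a > 0" for a c :: real
    using that t by real_asymp
  from this[OF ca] have small: "(\<lambda>n. 2 * real n * exp (- zoom n * t)) \<longlonglongrightarrow> 0" by (simp add: zoom_def)
  have ev: "\<forall>\<^sub>F n in sequentially. prob {\<omega>\<in>space M. norm (disp (\<beta> n) n \<omega>) > e} \<le> (1 - F) ^ (n - 1)"
  proof -
    have "\<forall>\<^sub>F n in sequentially. 2 * real n * exp (- zoom n * t) < e / 2"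
      using order_tendstoD(2)[OF small, of "e / 2"] e by simp
    moreover have "\<forall>\<^sub>F n in sequentially. \<beta> n / zoom n \<ge> 1"
      using \<beta> by (simp add: filterlim_at_top)
    ultimately show ?thesis using eventually_gt_at_top[of 0]
    proof eventually_elim
      case (elim n)
      have z: "zoom n > 0" by (rule zoom_pos[OF elim(3)])
      have \<beta>n: "\<beta> n \<ge> zoom n" using elim(2) z by (simp add: le_divide_eq)
      have "prob {\<omega>\<in>space M. norm (disp (\<beta> n) n \<omega>) > e} = expectation (indicator {\<omega>\<in>space M. norm (disp (\<beta> n) n \<omega>) > e})"
        by simp
      also have "\<dots> \<le> expectation (A n)"
      proof (rule integral_mono_AE)
        show "integrable M (indicator {\<omega>\<in>space M. norm (disp (\<beta> n) n \<omega>) > e} :: 's \<Rightarrow> real)"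
          by (intro integrable_const_bound[of _ 1]) (auto simp: indicator_def)
        show "AE \<omega> in M. indicator {\<omega>\<in>space M. norm (disp (\<beta> n) n \<omega>) > e} \<omega> \<le> A n \<omega>"
          using AE_unit
        proof eventually_elim
          case unit: (elim \<omega>)
          show ?case
          proof (cases "\<forall>j\<in>{..<n} - {0}. X j \<omega> \<notin> cap q t")
            case True
            then have "A n \<omega> = 1" unfolding A_def by (subst prod_indicator_Compl) auto
            then show ?thesis by (simp add: indicator_def)
          next
            case False
            then obtain i where i: "i < n" "1 - q \<bullet> X i \<omega> \<le> t" by (auto simp: cap_def)
            have "norm (disp (\<beta> n) n \<omega>) \<le> sqrt (4 * t) + 2 * real n * exp (- \<beta> n * t)"
              unfolding disp_def attn_def
              using softmax_displacement_bound[of i n q "\<lambda>j. X j \<omega>" "\<beta> n" t] i q1 unit \<beta>n z t by simp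
            also have "\<dots> \<le> e / 2 + 2 * real n * exp (- zoom n * t)"
            proof -
              have "exp (- \<beta> n * t) \<le> exp (- zoom n * t)" using \<beta>n t by simp
              then show ?thesis unfolding st by (intro add_left_mono mult_left_mono) auto
            qed
            also have "\<dots> \<le> e" using elim(1) by linarith
            finally show ?thesis using A01[of n \<omega>] by (simp add: indicator_def)
          qed
        qed
      qed (rule iA)
      also have "expectation (A n) = (\<integral>x. 1 \<partial>law) * (1 - F) ^ (n - 1)"
        using expectation_prod[of 0 n "\<lambda>_. 1" 1 t] elim(3) unfolding A_def F_def by simp
      finally show ?case using law.prob_space by simp
    qed
  qed
  have pow: "(\<lambda>n. (1 - F) ^ (n - 1)) \<longlonglongrightarrow> 0"
  proof (rule filterlim_compose[OF LIMSEQ_power_zero])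
    show "norm (1 - F) < 1" using F by simp
    show "filterlim (\<lambda>n. n - 1) sequentially sequentially" by (rule filterlim_minus_const_nat_at_top)
  qed
  show ?thesis
    by (rule tendsto_sandwich[OF _ ev tendsto_const pow]) simp
qed

end

section \<open>Weak convergence\<close>

context sphere_sample
begin

text \<open>The Riemann sum for the limit law has cell weights \<open>G k - G (Suc k)\<close>, while
  the samples give \<open>\<Delta> k * G (Suc (Suc k))\<close>. The bound
  \<open>1 - exp (- x) \<le> x\<close> makes the former at most \<open>G k * \<Delta> k\<close>, and
  on a fine mesh \<open>G\<close> changes little across two cells. The cut-off \<open>K\<close> is
  fixed before the tolerance \<open>\<eta>\<close>, and the mesh comes last.\<close>

lemma expectation_liminf:
  fixes f :: "real ^ 'n \<Rightarrow> real" and R :: "'t \<Rightarrow> real" and \<Theta> :: "'t \<Rightarrow> real ^ 'n"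
  assumes \<beta>: "filterlim (\<lambda>n. \<beta> n / zoom n) at_top sequentially"
    and N: "prob_space N" "R \<in> borel_measurable N" "\<Theta> \<in> borel_measurable N"
      "prob_space.indep_set N
      (sigma_sets (space N) {R -` A \<inter> space N | A. A \<in> sets borel})
      (sigma_sets (space N) {\<Theta> -` A \<inter> space N | A. A \<in> sets borel})"
    and tail: "\<And>r. r \<ge> 0 \<Longrightarrow> measure N {\<omega>\<in>space N. R \<omega> > r} = exp (- (r powr \<gamma>))"
    and inv: "tangent_invariant q (distr N borel \<Theta>)"
    and f: "continuous_on UNIV f" "\<And>x. 0 \<le> f x" "\<And>x. f x \<le> B" and \<epsilon>: "\<epsilon> > 0"
  shows "\<forall>\<^sub>F n in sequentially. (\<integral>\<omega>. f (sqrt (2 * R \<omega>) *\<^sub>R \<Theta> \<omega>) \<partial>N) - \<epsilon>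
    \<le> expectation (\<lambda>\<omega>. f (sqrt (zoom n) *\<^sub>R disp (\<beta> n) n \<omega>))"
proof -
  interpret N: prob_space N by fact
  define \<nu> where "\<nu> = distr N borel \<Theta>"
  have \<nu>p: "prob_space \<nu>" unfolding \<nu>_def by (rule N.prob_space_distr[OF N(3)])
  interpret \<nu>: prob_space \<nu> by (rule \<nu>p)
  have B: "B \<ge> 0" using f(2,3)[of 0] by linarith
  \<comment> \<open>Five losses: frozen radius, tail and mesh in the upper bound for the limit law,
    then \<open>\<epsilon>\<close> and \<open>\<epsilon>'\<close> in the lower bound for the
    samples.\<close>
  define e where "e = \<epsilon> / 5"
  have e: "e > 0" using \<epsilon> by (simp add: e_def)
  have "((\<lambda>K. B * exp (- (K powr \<gamma>))) \<longlongrightarrow> B * 0) at_top"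
    by (intro tendsto_mult tendsto_const) (use \<gamma>_pos in real_asymp)
  then have "\<forall>\<^sub>F K in at_top. B * exp (- (K powr \<gamma>)) < e" using e by (intro order_tendstoD(2)) auto
  then obtain K where K: "K > 0" "B * exp (- (K powr \<gamma>)) < e"
    using eventually_happens'[OF _ eventually_conj[OF eventually_gt_at_top[of "0::real"]]] trivial_limit_at_top_linorder by blast
  define r where "r = sqrt (2 * K)"
  \<comment> \<open>The radius exceeds \<open>r\<close> by 1 because \<open>\<eta>\<close> will be
    at most 1, so a perturbed point stays in the ball.\<close>
  have "uniformly_continuous_on (cball 0 (r + 1)) f"
    by (intro compact_uniformly_continuous continuous_on_subset[OF f(1)]) auto
  then obtain \<eta>0 where \<eta>0: "\<eta>0 > 0" and uc0: "\<And>u v. u \<in> cball 0 (r + 1) \<Longrightarrow> v \<in> cball 0 (r + 1) \<Longrightarrow> dist v u < \<eta>0 \<Longrightarrow> dist (f v) (f u) < e"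
    unfolding uniformly_continuous_on_def using e by meson
  define \<eta> where "\<eta> = min \<eta>0 1"
  have \<eta>: "\<eta> > 0" using \<eta>0 by (simp add: \<eta>_def)
  have uc: "\<bar>f u - f v\<bar> \<le> e" if "norm u \<le> r" "dist u v < \<eta>" for u v
  proof -
    have "norm v \<le> norm u + dist u v" by (metis dist_norm norm_minus_commute norm_triangle_sub add.commute)
    then have "dist (f u) (f v) < e" using that by (intro uc0) (auto simp: \<eta>_def)
    then show ?thesis by (simp add: dist_real_def)
  qed
  \<comment> \<open>The increments \<open>\<Delta> k\<close> add up to
    \<open>K powr \<gamma>\<close>, so a mesh error \<open>e2\<close> costs
    \<open>e2 * B * K powr \<gamma>\<close> in total. Adding 1 to the denominator covers
    \<open>B = 0\<close>.\<close>
  define e2 where "e2 = e / (B * K powr \<gamma> + 1)"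
  have BK: "B * K powr \<gamma> + 1 > 0" using B by (simp add: add_nonneg_pos)
  have e2: "e2 > 0" using e BK by (simp add: e2_def)
  have e2B: "e2 * B * K powr \<gamma> \<le> e"
  proof -
    have "e2 * (B * K powr \<gamma>) \<le> e2 * (B * K powr \<gamma> + 1)" using e2 by (intro mult_left_mono) auto
    also have "\<dots> = e" using BK by (simp add: e2_def)
    finally show ?thesis by (simp add: mult.assoc)
  qed
  \<comment> \<open>The interval extends past \<open>K\<close> because
    \<open>(k + 2) * \<delta>\<close> can reach \<open>K + \<delta>\<close>.\<close>
  have "uniformly_continuous_on {0..2*K} (\<lambda>s. exp (- (s powr \<gamma>)))"
    using \<gamma>_pos by (intro compact_uniformly_continuous continuous_on_exp continuous_on_minus continuous_on_powr' continuous_intros) auto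
  then obtain \<eta>2 where \<eta>2: "\<eta>2 > 0" and uc2: "\<And>s t. s \<in> {0..2*K} \<Longrightarrow> t \<in> {0..2*K} \<Longrightarrow> dist t s < \<eta>2 \<Longrightarrow> dist (exp (- (t powr \<gamma>))) (exp (- (s powr \<gamma>))) < e2"
    unfolding uniformly_continuous_on_def using e2 by meson
  have z: "(\<lambda>m. 2 * (K / real m)) \<longlonglongrightarrow> 2 * 0"
    by (intro tendsto_mult tendsto_const real_tendsto_divide_at_top[OF tendsto_const filterlim_real_sequentially])
  have "(\<lambda>m. sqrt (2 * (K / real m))) \<longlonglongrightarrow> sqrt (2 * 0)" by (intro tendsto_real_sqrt z)
  then have "\<forall>\<^sub>F m in sequentially. sqrt (2 * (K / real m)) < \<eta> / 3" using \<eta> by (intro order_tendstoD(2)) auto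
  moreover have "\<forall>\<^sub>F m in sequentially. 2 * (K / real m) < \<eta>2" using order_tendstoD(2)[OF z] \<eta>2 by simp
  ultimately have "\<forall>\<^sub>F m in sequentially. sqrt (2 * (K / real m)) < \<eta> / 3 \<and> 2 * (K / real m) < \<eta>2 \<and> m > 0"
    using eventually_gt_at_top[of 0] by eventually_elim simp
  then obtain m where m: "sqrt (2 * (K / real m)) < \<eta> / 3" "2 * (K / real m) < \<eta>2" "m > 0"
    using eventually_happens'[OF sequentially_bot] by blast
  define \<delta> where "\<delta> = K / real m"
  have \<delta>: "\<delta> > 0" "sqrt (2 * \<delta>) < \<eta> / 3" "2 * \<delta> < \<eta>2" and mK: "real m * \<delta> = K"
    using m K by (auto simp: \<delta>_def)
  define I where "I k = (\<integral>\<theta>. f (sqrt (2 * (real k * \<delta>)) *\<^sub>R \<theta>) \<partial>\<nu>)" for k :: nat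
  have [measurable]: "f \<in> borel_measurable borel" using f(1) by (rule borel_measurable_continuous_onI)
  have [measurable_cong]: "sets \<nu> = sets borel" by (simp add: \<nu>_def)
  have I: "0 \<le> I k" "I k \<le> B" for k
  proof -
    show "0 \<le> I k" unfolding I_def by (intro integral_nonneg_AE) (simp add: f)
    have "I k \<le> (\<integral>\<theta>. B \<partial>\<nu>)" unfolding I_def
      by (intro integral_mono_AE \<nu>.integrable_const_bound[of _ B]) (use f B in auto)
    then show "I k \<le> B" by (simp add: \<nu>.prob_space)
  qed
  define G where "G k = exp (- ((real k * \<delta>) powr \<gamma>))" for k :: nat
  define \<Delta> where "\<Delta> k = (real (Suc k) * \<delta>) powr \<gamma> - (real k * \<delta>) powr \<gamma>" for k :: nat
  have \<Delta>0: "\<Delta> k \<ge> 0" for k unfolding \<Delta>_def using \<delta> \<gamma>_pos by (auto intro!: powr_mono2 mult_right_mono)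
  have AE1: "AE \<omega> in N. norm (\<Theta> \<omega>) = 1"
  proof -
    have "AE \<theta> in distr N borel \<Theta>. norm \<theta> = 1"
      using inv by (auto simp: tangent_invariant_def tangent_sphere_def elim: eventually_mono)
    then show ?thesis using N(3) by (subst (asm) AE_distr_iff) auto
  qed
  have uc': "\<bar>f u - f v\<bar> \<le> e" if "norm u \<le> sqrt (2 * (real m * \<delta>))" "dist u v < \<eta>" for u v
    using uc that unfolding mK r_def by blast
  have "(\<integral>\<omega>. f (sqrt (2 * R \<omega>) *\<^sub>R \<Theta> \<omega>) \<partial>N)
      \<le> (\<Sum>k<m. (exp (- ((real k * \<delta>) powr \<gamma>)) - exp (- (((real k + 1) * \<delta>) powr \<gamma>)))
        * (\<integral>\<theta>. f (sqrt (2 * (real k * \<delta>)) *\<^sub>R \<theta>) \<partial>distr N borel \<Theta>)) + e + B * exp (- ((real m * \<delta>) powr \<gamma>))"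
    using \<delta> \<eta> e by (intro limit_law_upper_bound[OF N tail AE1 f _ _ _ uc']) auto
  also have "\<dots> = (\<Sum>k<m. (G k - G (Suc k)) * I k) + e + B * exp (- (K powr \<gamma>))"
    by (simp add: G_def I_def \<nu>_def mK add.commute)
  also have "(\<Sum>k<m. (G k - G (Suc k)) * I k) \<le> (\<Sum>k<m. \<Delta> k * I k * G (Suc (Suc k)) + e2 * B * \<Delta> k)"
  proof (rule sum_mono)
    fix k assume "k \<in> {..<m}"
    then have k: "k < m" by simp
    have kd: "(real k + 2) * \<delta> \<le> 2 * K"
    proof -
      have "(real k + 2) * \<delta> \<le> (2 * real m) * \<delta>" using k \<delta> by (intro mult_right_mono) auto
      then show ?thesis using mK by simp
    qed
    have "dist (exp (- ((real k * \<delta>) powr \<gamma>))) (exp (- (((real k + 2) * \<delta>) powr \<gamma>))) < e2"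
      using kd \<delta> by (intro uc2) (auto simp: dist_real_def algebra_simps)
    then have GG: "G k \<le> G (Suc (Suc k)) + e2" by (simp add: G_def dist_real_def add.commute)
    have "G k - G (Suc k) = G k * (1 - exp (- \<Delta> k))"
      unfolding G_def \<Delta>_def right_diff_distrib exp_add[symmetric] by simp
    also have "\<dots> \<le> G k * \<Delta> k"
      using exp_ge_add_one_self[of "- \<Delta> k"] by (intro mult_left_mono) (auto simp: G_def)
    also have "\<dots> \<le> (G (Suc (Suc k)) + e2) * \<Delta> k" using GG \<Delta>0 by (intro mult_right_mono)
    finally have "(G k - G (Suc k)) * I k \<le> ((G (Suc (Suc k)) + e2) * \<Delta> k) * I k" using I by (intro mult_right_mono)
    also have "\<dots> = \<Delta> k * I k * G (Suc (Suc k)) + e2 * \<Delta> k * I k" by (simp add: algebra_simps)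
    also have "e2 * \<Delta> k * I k \<le> e2 * \<Delta> k * B" using e2 \<Delta>0 I by (intro mult_left_mono) auto
    finally show "(G k - G (Suc k)) * I k \<le> \<Delta> k * I k * G (Suc (Suc k)) + e2 * B * \<Delta> k" by (simp add: mult.commute mult.left_commute)
  qed
  also have "\<dots> = (\<Sum>k<m. \<Delta> k * I k * G (Suc (Suc k))) + e2 * B * K powr \<gamma>"
  proof -
    have "(\<Sum>k<m. \<Delta> k) = K powr \<gamma>"
      unfolding \<Delta>_def using sum_lessThan_telescope[of "\<lambda>k. (real k * \<delta>) powr \<gamma>" m] \<gamma>_pos by (simp add: mK)
    then show ?thesis by (simp add: sum.distrib sum_distrib_left[symmetric])
  qed
  finally have up: "(\<integral>\<omega>. f (sqrt (2 * R \<omega>) *\<^sub>R \<Theta> \<omega>) \<partial>N) \<le> (\<Sum>k<m. \<Delta> k * I k * G (Suc (Suc k))) + 3 * e"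
    using e2B K(2) by linarith
  have "\<forall>\<^sub>F n in sequentially.
    (\<Sum>k<m. (((real k + 1) * \<delta>) powr \<gamma> - (real k * \<delta>) powr \<gamma>)
        * (\<integral>\<theta>. f (sqrt (2 * (real k * \<delta>)) *\<^sub>R \<theta>) \<partial>\<nu>) * exp (- (((real k + 2) * \<delta>) powr \<gamma>))) - e - e
    \<le> expectation (\<lambda>\<omega>. f (sqrt (zoom n) *\<^sub>R disp (\<beta> n) n \<omega>))"
    using e by (intro expectation_lower_bound[OF \<beta> inv[folded \<nu>_def] \<nu>p f \<delta>(1,2) _ _ uc']) auto
  moreover have "(\<Sum>k<m. (((real k + 1) * \<delta>) powr \<gamma> - (real k * \<delta>) powr \<gamma>)
        * (\<integral>\<theta>. f (sqrt (2 * (real k * \<delta>)) *\<^sub>R \<theta>) \<partial>\<nu>) * exp (- (((real k + 2) * \<delta>) powr \<gamma>)))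
      = (\<Sum>k<m. \<Delta> k * I k * G (Suc (Suc k)))"
    by (simp add: \<Delta>_def I_def G_def add.commute)
  ultimately show ?thesis
    by (auto elim!: eventually_mono) (use up in \<open>simp add: e_def\<close>)
qed

lemma expectation_tendsto:
  fixes f :: "real ^ 'n \<Rightarrow> real" and R :: "'t \<Rightarrow> real" and \<Theta> :: "'t \<Rightarrow> real ^ 'n"
  assumes \<beta>: "filterlim (\<lambda>n. \<beta> n / zoom n) at_top sequentially"
    and N: "prob_space N" "R \<in> borel_measurable N" "\<Theta> \<in> borel_measurable N"
      "prob_space.indep_set N
      (sigma_sets (space N) {R -` A \<inter> space N | A. A \<in> sets borel})
      (sigma_sets (space N) {\<Theta> -` A \<inter> space N | A. A \<in> sets borel})"
    and tail: "\<And>r. r \<ge> 0 \<Longrightarrow> measure N {\<omega>\<in>space N. R \<omega> > r} = exp (- (r powr \<gamma>))"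
    and inv: "tangent_invariant q (distr N borel \<Theta>)"
    and f: "continuous_on UNIV f" "\<And>x. \<bar>f x\<bar> \<le> B"
  shows "(\<lambda>n. expectation (\<lambda>\<omega>. f (sqrt (zoom n) *\<^sub>R disp (\<beta> n) n \<omega>)))
    \<longlonglongrightarrow> (\<integral>\<omega>. f (sqrt (2 * R \<omega>) *\<^sub>R \<Theta> \<omega>) \<partial>N)"
proof (rule LIMSEQ_I)
  fix r :: real assume r: "r > 0"
  interpret N: prob_space N by fact
  have [measurable]: "f \<in> borel_measurable borel" using f(1) by (rule borel_measurable_continuous_onI)
  note [measurable] = N(2,3)
  have fB: "- B \<le> f x" "f x \<le> B" for x using f(2)[of x] by (auto simp: abs_le_iff)
  have iN: "integrable N (\<lambda>\<omega>. f (sqrt (2 * R \<omega>) *\<^sub>R \<Theta> \<omega>))"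
    by (rule N.integrable_const_bound[of _ B]) (use f in auto)
  have iM: "integrable M (\<lambda>\<omega>. f (sqrt (zoom n) *\<^sub>R disp (\<beta> n) n \<omega>))" for n
    by (rule integrable_const_bound[of _ B]) (use f in auto)
  have 1: "0 \<le> f x + B" "f x + B \<le> 2 * B" and 2: "0 \<le> B - f x" "B - f x \<le> 2 * B" for x
    using fB[of x] by linarith+
  have "\<forall>\<^sub>F n in sequentially. (\<integral>\<omega>. f (sqrt (2 * R \<omega>) *\<^sub>R \<Theta> \<omega>) + B \<partial>N) - r / 2
    \<le> expectation (\<lambda>\<omega>. f (sqrt (zoom n) *\<^sub>R disp (\<beta> n) n \<omega>) + B)"
    using r 1 by (intro expectation_liminf[OF \<beta> N tail inv, of "\<lambda>x. f x + B" "2 * B"] continuous_intros f(1)) auto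
  moreover have "\<forall>\<^sub>F n in sequentially. (\<integral>\<omega>. B - f (sqrt (2 * R \<omega>) *\<^sub>R \<Theta> \<omega>) \<partial>N) - r / 2
    \<le> expectation (\<lambda>\<omega>. B - f (sqrt (zoom n) *\<^sub>R disp (\<beta> n) n \<omega>))"
    using r 2 by (intro expectation_liminf[OF \<beta> N tail inv, of "\<lambda>x. B - f x" "2 * B"] continuous_intros f(1)) auto
  ultimately have "\<forall>\<^sub>F n in sequentially. norm (expectation (\<lambda>\<omega>. f (sqrt (zoom n) *\<^sub>R disp (\<beta> n) n \<omega>))
      - (\<integral>\<omega>. f (sqrt (2 * R \<omega>) *\<^sub>R \<Theta> \<omega>) \<partial>N)) < r"
  proof eventually_elim
    case (elim n)
    then show ?case using r iN iM by (simp add: prob_space N.prob_space abs_less_iff)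
  qed
  then show "\<exists>no. \<forall>n\<ge>no. norm (expectation (\<lambda>\<omega>. f (sqrt (zoom n) *\<^sub>R disp (\<beta> n) n \<omega>))
      - (\<integral>\<omega>. f (sqrt (2 * R \<omega>) *\<^sub>R \<Theta> \<omega>) \<partial>N)) < r"
    by (simp add: eventually_sequentially)
qed

end

lemma uniform_on_tangent_sphere_invariant:
  assumes "uniform_on_tangent_sphere q N \<Theta>"
  shows "tangent_invariant q (distr N borel \<Theta>)"
proof -
  have [measurable]: "\<Theta> \<in> borel_measurable N" and AE: "AE \<omega> in N. \<Theta> \<omega> \<in> tangent_sphere q"
    and U: "\<And>U. orthogonal_transformation U \<Longrightarrow> U q = q \<Longrightarrow> distr N borel (U \<circ> \<Theta>) = distr N borel \<Theta>"
    using assms by (auto simp: uniform_on_tangent_sphere_def)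
  have "closed (tangent_sphere q)" by (intro compact_imp_closed compact_tangent_sphere)
  then have T: "{\<theta> \<in> space borel. \<theta> \<in> tangent_sphere q} \<in> sets borel" by simp
  show ?thesis
    unfolding tangent_invariant_def
  proof (intro conjI allI impI)
    show "AE \<theta> in distr N borel \<Theta>. \<theta> \<in> tangent_sphere q"
      using T AE by (subst AE_distr_iff) auto
    fix V assume V: "orthogonal_transformation V \<and> V q = q"
    then have [measurable]: "V \<in> borel_measurable borel" by (simp add: orthogonal_transformation_borel_measurable)
    show "distr (distr N borel \<Theta>) borel V = distr N borel \<Theta>"
      using V U by (subst distr_distr) auto
  qed simp
qed

theorem mainTheorem4:
  fixes M :: "'s measure"
    and X :: "nat \<Rightarrow> 's \<Rightarrow> real ^ 'n"
    and q :: "real ^ 'n"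
    and \<rho> :: "real ^ 'n \<Rightarrow> real"
    and \<beta> :: "nat \<Rightarrow> real"
    and V :: "real ^ 'n ^ 'n"
    and S :: "(real ^ 'n) set"
  defines "d \<equiv> CARD('n)"
  defines "\<alpha> \<equiv> 2 / (real d - 1)"
  defines "Z \<equiv> (\<lambda>n \<omega>. \<Sum>j<n. exp (- \<beta> n * (1 - q \<bullet> X j \<omega>)))"
  defines "A \<equiv> (\<lambda>n i \<omega>. exp (- \<beta> n * (1 - q \<bullet> X i \<omega>)) / Z n \<omega>)"
  defines "ATT \<equiv> (\<lambda>n \<omega>. V *v (\<Sum>i<n. A n i \<omega> *\<^sub>R X i \<omega>))"
  defines "Y \<equiv> (\<lambda>n \<omega>. V *v (\<Sum>i<n. A n i \<omega> *\<^sub>R (X i \<omega> - q)))"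
  defines "Cq \<equiv> 2 powr (1 / \<alpha>) * sphere_area (d - 2) / (real d - 1) * \<rho> q"
  defines "a \<equiv> (\<lambda>n::nat. (Cq * real n) powr \<alpha>)"
  assumes d2: "d \<ge> 2"
    and q: "q \<in> sphere 0 1"
    and S: "sphere 0 1 \<subseteq> S" and \<rho>C2: "C2_on S \<rho>"
    and \<rho>nonneg: "\<forall>x\<in>sphere 0 1. \<rho> x \<ge> 0"
    and \<rho>q: "\<rho> q > 0"
    and M: "prob_space M"
    and indep: "prob_space.indep_vars M (\<lambda>_. borel) X UNIV"
    and law: "\<forall>i. distr M borel (X i) = density sphere_surface_measure (\<lambda>x. ennreal (\<rho> x))"
    and \<beta>pos: "\<forall>n. \<beta> n > 0"
    and \<beta>lim: "filterlim (\<lambda>n. \<beta> n * real n powr (- \<alpha>)) at_top sequentially"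
  shows "(\<forall>(N :: 't measure) (R :: 't \<Rightarrow> real) (\<Theta> :: 't \<Rightarrow> real ^ 'n).
            prob_space N \<and> R \<in> borel_measurable N \<and> (AE \<omega> in N. R \<omega> \<ge> 0) \<and>
            (\<forall>r\<ge>0. measure N {\<omega>\<in>space N. R \<omega> > r} = exp (- (r powr (1 / \<alpha>)))) \<and>
            uniform_on_tangent_sphere q N \<Theta> \<and>
            prob_space.indep_set N
              (sigma_sets (space N) {R -` B \<inter> space N | B. B \<in> sets (borel :: real measure)})
              (sigma_sets (space N) {\<Theta> -` B \<inter> space N | B. B \<in> sets (borel :: (real ^ 'n) measure)})
          \<longrightarrow> weak_conv_vec (\<lambda>n. distr M borel (\<lambda>\<omega>. sqrt (a n) *\<^sub>R Y n \<omega>))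
                (distr N borel (\<lambda>\<omega>. V *v (sqrt (2 * R \<omega>) *\<^sub>R \<Theta> \<omega>))))
     \<and> conv_in_prob M Y 0
     \<and> conv_in_prob M ATT (V *v q)"
proof -
  \<comment> \<open>Off the sphere nothing is known about the sign of \<open>\<rho>\<close>. Cutting
    it off there leaves the density unchanged almost everywhere for the surface measure.\<close>
  define p where "p x = indicator (sphere 0 1) x * \<rho> x" for x
  have q1: "norm q = 1" using q by simp
  have pq: "p q = \<rho> q" using q by (simp add: p_def)
  obtain \<rho>' where d\<rho>: "\<And>x. x \<in> S \<Longrightarrow> (\<rho> has_derivative blinfun_apply (\<rho>' x)) (at x)"
    using \<rho>C2 unfolding C2_on_def by blast
  have cont: "isCont \<rho> x" if "x \<in> S" for x using has_derivative_continuous[OF d\<rho>[OF that]] .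
  have "continuous_on (sphere 0 1) \<rho>"
    using S cont by (intro continuous_at_imp_continuous_on) auto
  then have p_borel: "p \<in> borel_measurable borel"
    unfolding p_def[abs_def]
    using borel_measurable_continuous_on_indicator[of "sphere 0 1" \<rho>] by simp
  have dens: "density sphere_surface_measure (\<lambda>x. ennreal (\<rho> x)) = density sphere_surface_measure (\<lambda>x. ennreal (p x))"
  proof -
    have "(\<integral>\<^sup>+x. ennreal (\<rho> x) * indicator D x \<partial>sphere_surface_measure)
        = (\<integral>\<^sup>+x. ennreal (p x) * indicator D x \<partial>sphere_surface_measure)" for D
      by (rule nn_integral_cong_AE) (use AE_sphere_surface_measure in \<open>eventually_elim, simp add: p_def\<close>)
    then show ?thesis unfolding density_def by simp
  qed
  interpret sphere_sample M X q p
  proof (intro sphere_sample.intro sphere_sample_axioms.intro M)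
    show "CARD('n) \<ge> 2" using d2 by (simp add: d_def)
    show "p x \<ge> 0" for x using \<rho>nonneg by (auto simp: p_def indicator_def)
    fix \<epsilon> :: real assume \<epsilon>: "\<epsilon> > 0"
    have "isCont \<rho> q" using cont S q by blast
    then obtain r where r: "r > 0" "\<And>x. dist x q < r \<Longrightarrow> dist (\<rho> x) (\<rho> q) < \<epsilon>"
      unfolding continuous_at_eps_delta using \<epsilon> by metis
    show "\<exists>t>0. \<forall>x\<in>sphere 0 1. 1 - q \<bullet> x \<le> t \<longrightarrow> \<bar>p x - p q\<bar> \<le> \<epsilon>"
    proof (intro exI[of _ "r\<^sup>2 / 4"] conjI ballI impI)
      show "r\<^sup>2 / 4 > 0" using r by simp
      fix x :: "real ^ 'n" assume x: "x \<in> sphere 0 1" "1 - q \<bullet> x \<le> r\<^sup>2 / 4"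
      \<comment> \<open>The left side is the squared distance from \<open>x\<close> to
        \<open>q\<close>, which explains the choice of \<open>r\<^sup>2 / 4\<close> as height
        bound.\<close>
      have "2 * (1 - q \<bullet> x) \<le> r\<^sup>2 / 2" using x(2) by simp
      also have "\<dots> < r\<^sup>2" using r by simp
      finally have "sqrt (2 * (1 - q \<bullet> x)) < sqrt (r\<^sup>2)" by (rule real_sqrt_less_mono)
      then have "dist x q < r" using norm_diff_unit[OF q1, of x] x(1) r by (simp add: dist_norm)
      moreover have "p x = \<rho> x" using x(1) by (simp add: p_def)
      ultimately show "\<bar>p x - p q\<bar> \<le> \<epsilon>" using r(2)[of x] by (simp add: pq dist_real_def)
    qed
  qed (use q1 p_borel pq \<rho>q indep law dens in auto)
  have \<alpha>: "1 / \<gamma> = \<alpha>" "1 / \<alpha> = \<gamma>" by (simp_all add: \<gamma>_def \<alpha>_def d_def)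
  have Cq: "Cq = c\<^sub>0 * p q" by (simp add: Cq_def c\<^sub>0_def \<alpha>(2) d_def pq)
  then have a: "a n = zoom n" for n by (simp add: a_def zoom_def \<alpha>(1))
  have Y: "Y n \<omega> = V *v disp (\<beta> n) n \<omega>" for n \<omega>
    by (simp add: Y_def A_def Z_def disp_def attn_def)
  have Cq_pos: "Cq > 0" unfolding Cq using c\<^sub>0_pos p_pos by simp
  have \<beta>z: "filterlim (\<lambda>n. \<beta> n / zoom n) at_top sequentially"
  proof (rule filterlim_at_top_mono)
    show "filterlim (\<lambda>n. Cq powr (- \<alpha>) * (\<beta> n * real n powr (- \<alpha>))) at_top sequentially"
      using Cq_pos by (intro filterlim_tendsto_pos_mult_at_top[OF tendsto_const _ \<beta>lim]) simp
    show "\<forall>\<^sub>F n in sequentially. Cq powr (- \<alpha>) * (\<beta> n * real n powr (- \<alpha>)) \<le> \<beta> n / zoom n"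
      using eventually_gt_at_top[of 0]
    proof eventually_elim
      case (elim n)
      have "zoom n = Cq powr \<alpha> * real n powr \<alpha>"
        using Cq_pos by (simp add: a[symmetric] a_def powr_mult)
      then show ?case by (simp add: powr_minus divide_inverse)
    qed
  qed
  obtain c where c: "c > 0" "\<And>x. norm (V *v x) \<le> norm x * c"
    using bounded_linear.pos_bounded[OF matrix_vector_mul_bounded_linear[of V]] by blast
  have V_cont: "continuous_on UNIV ((*v) V)"
    by (rule matrix_vector_mult_linear_continuous_on)
  have [measurable]: "(*v) V \<in> borel_measurable borel"
    using V_cont by (rule borel_measurable_continuous_onI)
  have Y0: "(\<lambda>n. prob {\<omega>\<in>space M. norm (Y n \<omega>) > e}) \<longlonglongrightarrow> 0" if e: "e > 0" for e
  proof (rule tendsto_sandwich[where f = "\<lambda>_. 0" and h = "\<lambda>n. prob {\<omega>\<in>space M. norm (disp (\<beta> n) n \<omega>) > e / c}"])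
    show "(\<lambda>n. prob {\<omega>\<in>space M. norm (disp (\<beta> n) n \<omega>) > e / c}) \<longlonglongrightarrow> 0"
      using e c by (intro disp_conv_in_prob[OF \<beta>z]) simp
    have "{\<omega>\<in>space M. norm (Y n \<omega>) > e} \<subseteq> {\<omega>\<in>space M. norm (disp (\<beta> n) n \<omega>) > e / c}" for n
    proof safe
      fix \<omega> assume "e < norm (Y n \<omega>)"
      also have "\<dots> \<le> norm (disp (\<beta> n) n \<omega>) * c" unfolding Y by (rule c)
      finally show "e / c < norm (disp (\<beta> n) n \<omega>)" using c by (simp add: divide_less_eq)
    qed
    then show "\<forall>\<^sub>F n in sequentially. prob {\<omega>\<in>space M. norm (Y n \<omega>) > e}
        \<le> prob {\<omega>\<in>space M. norm (disp (\<beta> n) n \<omega>) > e / c}"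
      by (intro always_eventually allI finite_measure_mono) auto
  qed auto
  \<comment> \<open>For \<open>n = 0\<close> the empty sum gives attention output 0 and not
    \<open>V *v q\<close>; equality for positive \<open>n\<close> is enough for the limit.\<close>
  have ATT: "ATT n \<omega> - V *v q = Y n \<omega>" if "n > 0" for n \<omega>
  proof -
    have "disp (\<beta> n) n \<omega> = (\<Sum>i<n. attn (\<beta> n) n i \<omega> *\<^sub>R X i \<omega>) - (\<Sum>i<n. attn (\<beta> n) n i \<omega>) *\<^sub>R q"
      by (simp add: disp_def scaleR_diff_right sum_subtractf scaleR_sum_left)
    also have "\<dots> = (\<Sum>i<n. A n i \<omega> *\<^sub>R X i \<omega>) - q"
      by (simp add: sum_attn[OF that]) (simp add: A_def Z_def attn_def)
    finally show ?thesis by (simp add: Y ATT_def matrix_vector_mult_diff_distrib)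
  qed
  show ?thesis
  proof (intro conjI allI impI)
    show "conv_in_prob M Y 0"
      unfolding conv_in_prob_def using Y0 by (simp add: dist_norm)
    show "conv_in_prob M ATT (V *v q)"
      unfolding conv_in_prob_def
    proof (intro allI impI)
      fix e :: real assume "e > 0"
      show "(\<lambda>n. prob {\<omega>\<in>space M. dist (ATT n \<omega>) (V *v q) > e}) \<longlonglongrightarrow> 0"
      proof (rule Lim_transform_eventually[OF Y0[OF \<open>e > 0\<close>]])
        show "\<forall>\<^sub>F n in sequentially. prob {\<omega>\<in>space M. norm (Y n \<omega>) > e}
            = prob {\<omega>\<in>space M. dist (ATT n \<omega>) (V *v q) > e}"
          using eventually_gt_at_top[of 0] by eventually_elim (simp add: dist_norm ATT)
      qed
    qed
  next
    fix N :: "'t measure" and R :: "'t \<Rightarrow> real" and \<Theta> :: "'t \<Rightarrow> real ^ 'n"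
    assume N: "prob_space N \<and> R \<in> borel_measurable N \<and> (AE \<omega> in N. R \<omega> \<ge> 0) \<and>
            (\<forall>r\<ge>0. measure N {\<omega>\<in>space N. R \<omega> > r} = exp (- (r powr (1 / \<alpha>)))) \<and>
            uniform_on_tangent_sphere q N \<Theta> \<and>
            prob_space.indep_set N
              (sigma_sets (space N) {R -` B \<inter> space N | B. B \<in> sets (borel :: real measure)})
              (sigma_sets (space N) {\<Theta> -` B \<inter> space N | B. B \<in> sets (borel :: (real ^ 'n) measure)})"
    then have \<Theta>m: "\<Theta> \<in> borel_measurable N" by (auto simp: uniform_on_tangent_sphere_def)
    have Rm: "R \<in> borel_measurable N" using N by blast
    note [measurable] = \<Theta>m Rm
    show "weak_conv_vec (\<lambda>n. distr M borel (\<lambda>\<omega>. sqrt (a n) *\<^sub>R Y n \<omega>))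
                (distr N borel (\<lambda>\<omega>. V *v (sqrt (2 * R \<omega>) *\<^sub>R \<Theta> \<omega>)))"
      unfolding weak_conv_vec_def
    proof (intro allI impI)
      fix f :: "real ^ 'n \<Rightarrow> real" assume f: "continuous_on UNIV f \<and> bounded (range f)"
      then obtain B where B: "\<And>x. \<bar>f x\<bar> \<le> B" by (auto simp: bounded_iff)
      have [measurable]: "f \<in> borel_measurable borel" using f by (simp add: borel_measurable_continuous_onI)
      \<comment> \<open>The matrix is absorbed into the test function
        \<open>\<lambda>v. f (V *v v)\<close>, which is again bounded and continuous.\<close>
      have "(\<lambda>n. expectation (\<lambda>\<omega>. f (V *v (sqrt (zoom n) *\<^sub>R disp (\<beta> n) n \<omega>))))
          \<longlonglongrightarrow> (\<integral>\<omega>. f (V *v (sqrt (2 * R \<omega>) *\<^sub>R \<Theta> \<omega>)) \<partial>N)"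
        using N f B Rm \<Theta>m
        by (intro expectation_tendsto[OF \<beta>z, where B = B and f = "\<lambda>v. f (V *v v)"] uniform_on_tangent_sphere_invariant
            continuous_on_compose2[OF _ V_cont, of UNIV f]) (auto simp: \<alpha>(2))
      then show "(\<lambda>n. integral\<^sup>L (distr M borel (\<lambda>\<omega>. sqrt (a n) *\<^sub>R Y n \<omega>)) f)
          \<longlonglongrightarrow> integral\<^sup>L (distr N borel (\<lambda>\<omega>. V *v (sqrt (2 * R \<omega>) *\<^sub>R \<Theta> \<omega>))) f"
        by (simp add: integral_distr a Y matrix_vector_mult_scaleR)
    qed
  qed
qed

end
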